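(* Let $d\ge2$ and $d-2<s<d$. Let $\mu$ and $\nu$ be positive measures on $\mathbb{R}^d$ such that $U^\nu$ is finite $\nu$-almost everywhere (for instance, $\nu$ has finite energy). If for some constant $C\ge0$, $$U^\nu\le U^\mu+C\quad\nu\text{-almost everywhere},$$ then the restriction of the signed measure $\mu-\nu$ to the set $$E=\{x\in\mathbb{R}^d:\ U^\nu(x)=U^\mu(x)+C<\infty\}$$ is a negative measure.
   Context: $U^\sigma(x)=\int|x-t|^{-s}d\sigma(t)$ is the Riesz $s$-potential. All positive measures considered are finite on compact sets and, if their support is unbounded, satisfy $\int_{|t|>1}|t|^{-s}d\mu(t)<\infty$. *)

theory Defs
  imports "HOL-Analysis.Analysis"
begin

definition riesz_kernel :: "real \<Rightarrow> 'a::euclidean_space \<Rightarrow> 'a \<Rightarrow> ennreal" where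
  "riesz_kernel s x t = (if x = t then \<infinity> else ennreal (norm (x - t) powr (- s)))"

definition riesz_potential :: "real \<Rightarrow> 'a::euclidean_space measure \<Rightarrow> 'a \<Rightarrow> ennreal" where
  "riesz_potential s \<sigma> x = (\<integral>\<^sup>+ t. riesz_kernel s x t \<partial>\<sigma>)"

definition admissible_measure :: "real \<Rightarrow> 'a::euclidean_space measure \<Rightarrow> bool" where
  "admissible_measure s \<mu> \<longleftrightarrow>
     sets \<mu> = sets borel \<and>
     (\<forall>K. compact K \<longrightarrow> emeasure \<mu> K < \<infinity>) \<and>
     (\<integral>\<^sup>+ t. indicator {t. norm t > 1} t * ennreal (norm t powr (- s)) \<partial>\<mu>) < \<infinity>"

end

theory Submission
  imports Defs "HOL-Probability.Distributions"
begin

text \<open>The Riesz kernel is a mixture of Gaussian kernels of variance \<open>u > 0\<close> with weight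
  \<open>u powr ((d - s) / 2 - 1)\<close>. Averaging it over the first passage of level \<open>r\<close> by the stable
  subordinator of index \<open>(d - s) / 2\<close>, which lies in \<open>(0, 1)\<close>, removes exactly the Gaussians of
  variance at most \<open>r\<close>; call this operation \<open>sweep\<close> and the removed part the near potential.
  Constants are preserved by it. Two consequences are used. First the domination principle holds:
  \<open>U\<^sup>\<nu> \<le> U\<^sup>\<mu> + C\<close> everywhere (reduce to compactly supported measures with continuous
  potential by Egorov's theorem, and sweep at a maximum of the difference). Secondly, sweeping at a
  point of \<open>E\<close> shows that the near potential of \<open>\<mu>\<close> is at most that of \<open>\<nu>\<close> there, for all
  \<open>r\<close>. By a layer-cake argument as \<open>r\<close> tends to \<open>0\<close>, some arbitrarily small balls around the
  point have no more \<open>\<mu>\<close>-mass than \<open>\<nu>\<close>-mass, up to a small multiple of Lebesgue measure. A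
  Besicovitch covering by such balls of a compact subset of \<open>E\<close> on which \<open>\<mu> \<ge> \<nu>\<close> gives the
  theorem.\<close>

section \<open>First passage of a stable subordinator\<close>

text \<open>Both uses of sweeping rest on one comparison of rates, and \<open>s > d - 2\<close>
  enters through it: with \<open>g = (d - s) / 2 < 1\<close>, a gain of order
  \<open>r powr g\<close> beats an error of order \<open>r\<close> as \<open>r\<close> tends to 0.
  In the domination principle the gain comes from the mass that sweeping carries to a fixed far
  region. At a point of \<open>E\<close> it is the near potential of \<tau> times Lebesgue measure,
  which is why balls are compared only up to a small multiple of Lebesgue measure. The errors of
  order \<open>r\<close> come from mass at a positive distance and from truncating the kernel. Good
  balls are found only at some radii around each point, and the measures have no doubling property,
  so the covering must be of Besicovitch type: its bounded overlap does not depend on the measure.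
  On a set where \<mu> \<ge> \<nu> the excess \<mu> - \<nu> is subadditive, so overlapping balls do
  no harm. Potentials take values in the extended nonnegative reals; identities are therefore stated
  as sums, and terms are cancelled only where they are finite.\<close>

lemma nn_integral_halfline_affine:
  fixes f :: "real \<Rightarrow> ennreal" and a r :: real
  assumes [measurable]: "f \<in> borel_measurable borel" and a: "a > 0"
  shows "(\<integral>\<^sup>+v\<in>{r<..}. f v \<partial>lborel) = ennreal a * (\<integral>\<^sup>+z\<in>{0<..}. f (r + a * z) \<partial>lborel)"
proof -
  have "(\<integral>\<^sup>+v\<in>{r<..}. f v \<partial>lborel) =
      ennreal \<bar>a\<bar> * (\<integral>\<^sup>+z. f (r + a * z) * indicator {r<..} (r + a * z) \<partial>lborel)"
    using a by (intro nn_integral_real_affine) auto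
  also have "(\<lambda>z. indicator {r<..} (r + a * z) :: ennreal) = indicator {0<..}"
    using a by (auto simp: fun_eq_iff indicator_def zero_less_mult_iff)
  then have "(\<integral>\<^sup>+z. f (r + a * z) * indicator {r<..} (r + a * z) \<partial>lborel)
      = (\<integral>\<^sup>+z\<in>{0<..}. f (r + a * z) \<partial>lborel)"
    by (metis (no_types))
  finally show ?thesis using a by simp
qed

lemma nn_integral_powr_zero_one:
  fixes a :: real assumes "a > -1"
  shows "(\<integral>\<^sup>+y\<in>{0<..1}. ennreal (y powr a) \<partial>lborel) < \<infinity>"
proof -
  have "(\<integral>\<^sup>+y\<in>{0..1}. ennreal (y powr a) \<partial>lborel) = ennreal (1 powr (a+1) / (a+1))"
    using has_integral_powr_from_0[of a 1] assms
    by (intro nn_integral_has_integral_lebesgue') auto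
  moreover have "(\<integral>\<^sup>+y\<in>{0<..1}. ennreal (y powr a) \<partial>lborel) \<le> (\<integral>\<^sup>+y\<in>{0..1}. ennreal (y powr a) \<partial>lborel)"
    by (intro nn_integral_mono) (auto split: split_indicator)
  ultimately show ?thesis by (simp add: le_less_trans)
qed

lemma nn_integral_powr_one_infinity:
  fixes a :: real assumes "a < -1"
  shows "(\<integral>\<^sup>+y\<in>{1<..}. ennreal (y powr a) \<partial>lborel) < \<infinity>"
proof -
  have "(\<integral>\<^sup>+y\<in>{1..}. ennreal (y powr a) \<partial>lborel) = ennreal (-(1 powr (a+1)) / (a+1))"
    using has_integral_powr_to_inf[of a 1] assms
    by (intro nn_integral_has_integral_lebesgue') auto
  moreover have "(\<integral>\<^sup>+y\<in>{1<..}. ennreal (y powr a) \<partial>lborel) \<le> (\<integral>\<^sup>+y\<in>{1..}. ennreal (y powr a) \<partial>lborel)"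
    by (intro nn_integral_mono) (auto split: split_indicator)
  ultimately show ?thesis by (simp add: le_less_trans)
qed

lemma nn_integral_halfline_finite:
  fixes f :: "real \<Rightarrow> real"
  assumes [measurable]: "f \<in> borel_measurable borel"
    and a: "a > -1" "\<And>y. 0 < y \<Longrightarrow> y \<le> 1 \<Longrightarrow> f y \<le> c * y powr a"
    and b: "b < -1" "\<And>y. 1 < y \<Longrightarrow> f y \<le> c * y powr b" and c: "c \<ge> 0"
  shows "(\<integral>\<^sup>+y\<in>{0<..}. ennreal (f y) \<partial>lborel) < \<infinity>"
proof -
  have "(\<integral>\<^sup>+y\<in>{0<..}. ennreal (f y) \<partial>lborel) \<le>
     (\<integral>\<^sup>+y. ennreal c * (ennreal (y powr a) * indicator {0<..1} y) + ennreal c * (ennreal (y powr b) * indicator {1<..} y) \<partial>lborel)"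
    using a b c by (intro nn_integral_mono)
      (auto split: split_indicator simp flip: ennreal_mult intro!: ennreal_leI)
  also have "\<dots> = ennreal c * (\<integral>\<^sup>+y\<in>{0<..1}. ennreal (y powr a) \<partial>lborel) +
      ennreal c * (\<integral>\<^sup>+y\<in>{1<..}. ennreal (y powr b) \<partial>lborel)"
    by (simp add: nn_integral_add nn_integral_cmult)
  also have "\<dots> < \<infinity>"
    using nn_integral_powr_zero_one[OF a(1)] nn_integral_powr_one_infinity[OF b(1)]
    by (auto simp: ennreal_mult_less_top less_top)
  finally show ?thesis .
qed

lemma nn_integral_halfline_pos:
  fixes f :: "real \<Rightarrow> real"
  assumes [measurable]: "f \<in> borel_measurable borel" and pos: "\<And>y. y > 0 \<Longrightarrow> f y > 0"
  shows "(\<integral>\<^sup>+y\<in>{0<..}. ennreal (f y) \<partial>lborel) > 0"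
proof -
  have "{x \<in> space lborel. ennreal (f x) * indicator {0<..} x \<noteq> 0} = {0::real<..}"
    using pos by (auto split: split_indicator simp: ennreal_eq_0_iff not_le)
  then have "(\<integral>\<^sup>+y\<in>{0<..}. ennreal (f y) \<partial>lborel) = 0 \<longleftrightarrow> emeasure lborel {0::real<..} = 0"
    by (subst nn_integral_0_iff) simp_all
  moreover have "emeasure lborel {0::real<..} \<ge> emeasure lborel {0<..1::real}"
    by (intro emeasure_mono) auto
  ultimately show ?thesis by (auto simp: zero_less_iff_neq_zero)
qed

text \<open>For \<open>0 < g < 1\<close> this is the Beta integral B(1 - g, g), that is, pi / sin(pi
  g). No closed form is used, only that the integral is finite and positive.\<close>

definition beta_const :: "real \<Rightarrow> real" where
  "beta_const g = enn2real (\<integral>\<^sup>+y\<in>{0<..}. ennreal (y powr (-g) / (1 + y)) \<partial>lborel)"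

lemma beta_const:
  assumes g: "0 < g" "g < 1"
  shows "ennreal (beta_const g) = (\<integral>\<^sup>+y\<in>{0<..}. ennreal (y powr (-g) / (1 + y)) \<partial>lborel)"
    and "beta_const g > 0"
proof -
  let ?I = "\<integral>\<^sup>+y\<in>{0<..}. ennreal (y powr (-g) / (1 + y)) \<partial>lborel"
  have "?I < \<infinity>"
  proof (rule nn_integral_halfline_finite[where a="-g" and b="-g-1" and c=1])
    fix y :: real assume "y > 1"
    then have "y powr (-g) / (1 + y) \<le> y powr (-g) / y" by (intro divide_left_mono) auto
    also have "\<dots> = y powr (-g-1)" using \<open>y > 1\<close> by (simp add: powr_diff)
    finally show "y powr (-g) / (1 + y) \<le> 1 * y powr (-g-1)" by simp
  next
    fix y :: real assume "y > 0" "y \<le> 1"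
    then have "y powr (-g) / (1 + y) \<le> y powr (-g) / 1" by (intro divide_left_mono) auto
    then show "y powr (-g) / (1 + y) \<le> 1 * y powr (-g)" by simp
  qed (use g in auto)
  moreover have "?I > 0" by (rule nn_integral_halfline_pos) auto
  ultimately show "ennreal (beta_const g) = ?I" "beta_const g > 0"
    by (auto simp: beta_const_def enn2real_positive_iff less_top)
qed

text \<open>The law of the position at which a stable subordinator of index \<open>g\<close> first passes level
  \<open>r\<close>; \<open>passage_conv\<close> is the corresponding first-passage decomposition of its potential kernel
  \<open>u powr (g - 1)\<close>.\<close>

definition passage :: "real \<Rightarrow> real \<Rightarrow> real \<Rightarrow> real" where
  "passage g r v = r powr g * (v - r) powr (-g) / (v * beta_const g)"

lemma passage_measurable [measurable]: "passage g r \<in> borel_measurable borel"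
  unfolding passage_def by measurable

lemma passage_nonneg: "0 < g \<Longrightarrow> g < 1 \<Longrightarrow> 0 < r \<Longrightarrow> r < v \<Longrightarrow> 0 \<le> passage g r v"
  using beta_const(2)[of g] by (auto simp: passage_def)

text \<open>The substitution \<open>v = r + r * z\<close> removes \<open>r\<close> by scaling and
  leaves the Beta integral by which \<open>passage\<close> is normalised.\<close>

lemma passage_mass:
  assumes g: "0 < g" "g < 1" and r: "r > 0"
  shows "(\<integral>\<^sup>+v\<in>{r<..}. ennreal (passage g r v) \<partial>lborel) = 1"
proof -
  note B = beta_const[OF g]
  have "(\<integral>\<^sup>+v\<in>{r<..}. ennreal (passage g r v) \<partial>lborel) =
      ennreal r * (\<integral>\<^sup>+z\<in>{0<..}. ennreal (passage g r (r + r * z)) \<partial>lborel)"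
    using r by (intro nn_integral_halfline_affine) auto
  also have "(\<integral>\<^sup>+z\<in>{0<..}. ennreal (passage g r (r + r * z)) \<partial>lborel) =
     (\<integral>\<^sup>+z. ennreal (1 / (r * beta_const g)) * (ennreal (z powr (-g) / (1 + z)) * indicator {0<..} z) \<partial>lborel)"
  proof (intro nn_integral_cong)
    fix z :: real
    have "passage g r (r + r * z) = 1 / (r * beta_const g) * (z powr (-g) / (1 + z))" if "z > 0"
    proof -
      have "passage g r (r + r * z) = (r powr g * r powr (-g)) * z powr (-g) / (r * (1 + z) * beta_const g)"
        using that r by (simp add: passage_def powr_mult algebra_simps)
      also have "r powr g * r powr (-g) = 1" using r by (simp flip: powr_add)
      finally show ?thesis by simp
    qed
    then show "ennreal (passage g r (r + r * z)) * indicator {0<..} z =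
      ennreal (1 / (r * beta_const g)) * (ennreal (z powr (-g) / (1 + z)) * indicator {0<..} z)"
      using r B by (auto split: split_indicator simp flip: ennreal_mult)
  qed
  also have "\<dots> = ennreal (1 / (r * beta_const g)) * ennreal (beta_const g)"
    by (simp add: nn_integral_cmult B(1))
  also have "ennreal r * \<dots> = 1"
    using r B(2) by (simp flip: ennreal_mult)
  finally show ?thesis .
qed

lemma passage_conv:
  fixes \<phi> :: "real \<Rightarrow> ennreal"
  assumes g: "0 < g" "g < 1" and r: "r > 0" and [measurable]: "\<phi> \<in> borel_measurable borel"
  shows "(\<integral>\<^sup>+v\<in>{r<..}. ennreal (passage g r v) * (\<integral>\<^sup>+u\<in>{0<..}. ennreal (u powr (g-1)) * \<phi> (u + v) \<partial>lborel) \<partial>lborel)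
    = (\<integral>\<^sup>+w\<in>{r<..}. ennreal (w powr (g-1)) * \<phi> w \<partial>lborel)"
    (is "?L = ?R")
proof -
  let ?B = "beta_const g"
  note B = beta_const[OF g]
  let ?c = "ennreal (r powr g / ?B)"
  have "?L = (\<integral>\<^sup>+v. \<integral>\<^sup>+u. ennreal (passage g r v) * ennreal (u powr (g-1)) * \<phi> (u + v)
       * indicator {0<..} u * indicator {r<..} v \<partial>lborel \<partial>lborel)"
    by (simp add: nn_integral_cmult[symmetric] nn_integral_multc[symmetric] mult_ac)
  also have "\<dots> = (\<integral>\<^sup>+u. \<integral>\<^sup>+v. ennreal (passage g r v) * ennreal (u powr (g-1)) * \<phi> (u + v)
       * indicator {0<..} u * indicator {r<..} v \<partial>lborel \<partial>lborel)"
    by (intro lborel_pair.Fubini') measurable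
  \<comment> \<open>Substitution \<open>v = r + u * z\<close> for fixed \<open>u\<close>: the
    Jacobian \<open>u\<close>, the factor \<open>u powr (-g)\<close> from the overshoot
    \<open>v - r\<close>, and the weight \<open>u powr (g-1)\<close> cancel exactly.\<close>
  also have "\<dots> = (\<integral>\<^sup>+u. \<integral>\<^sup>+z. ?c * (ennreal (z powr (-g) / (r + z * u)) * \<phi> (r + (1 + z) * u)
       * indicator {0<..} u * indicator {0<..} z) \<partial>lborel \<partial>lborel)"
  proof (rule nn_integral_cong)
    fix u :: real
    show "(\<integral>\<^sup>+v. ennreal (passage g r v) * ennreal (u powr (g-1)) * \<phi> (u + v)
       * indicator {0<..} u * indicator {r<..} v \<partial>lborel) =
      (\<integral>\<^sup>+z. ?c * (ennreal (z powr (-g) / (r + z * u)) * \<phi> (r + (1 + z) * u)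
       * indicator {0<..} u * indicator {0<..} z) \<partial>lborel)"
    proof (cases "u > 0")
      case True
      have "(\<integral>\<^sup>+v. ennreal (passage g r v) * ennreal (u powr (g-1)) * \<phi> (u + v)
         * indicator {0<..} u * indicator {r<..} v \<partial>lborel) =
        ennreal u * (\<integral>\<^sup>+z\<in>{0<..}. (ennreal (passage g r (r + u * z)) * ennreal (u powr (g-1)) * \<phi> (u + (r + u * z))
         * indicator {0<..} u) \<partial>lborel)"
        using True by (intro nn_integral_halfline_affine) measurable
      also have "\<dots> = (\<integral>\<^sup>+z. ennreal u * ((ennreal (passage g r (r + u * z)) * ennreal (u powr (g-1)) * \<phi> (u + (r + u * z))
         * indicator {0<..} u) * indicator {0<..} z) \<partial>lborel)"
        by (simp add: nn_integral_cmult)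
      also have "\<dots> = (\<integral>\<^sup>+z. ?c * (ennreal (z powr (-g) / (r + z * u)) * \<phi> (r + (1 + z) * u)
       * indicator {0<..} u * indicator {0<..} z) \<partial>lborel)"
      proof (intro nn_integral_cong)
        fix z :: real
        have "ennreal u * ennreal (passage g r (r + u * z)) * ennreal (u powr (g-1)) =
            ?c * ennreal (z powr (-g) / (r + z * u))" if z: "z > 0"
        proof -
          have "u * passage g r (r + u * z) * u powr (g-1) =
              (u powr 1 * u powr (-g) * u powr (g-1)) * (r powr g / ?B) * (z powr (-g) / (r + z * u))"
            using True z r by (simp add: passage_def powr_mult mult_ac)
          also have "u powr 1 * u powr (-g) * u powr (g-1) = 1"
            using True unfolding powr_add[symmetric] by simp
          finally show ?thesis
            using True z r B passage_nonneg[OF g r, of "r + u * z"] by (simp flip: ennreal_mult)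
        qed
        moreover have eq: "u + (r + u * z) = r + (1 + z) * u" by (simp add: algebra_simps)
        ultimately show "ennreal u * ((ennreal (passage g r (r + u * z)) * ennreal (u powr (g-1)) * \<phi> (u + (r + u * z))
         * indicator {0<..} u) * indicator {0<..} z) = ?c * (ennreal (z powr (-g) / (r + z * u)) * \<phi> (r + (1 + z) * u)
       * indicator {0<..} u * indicator {0<..} z)"
          unfolding eq by (auto split: split_indicator simp flip: mult.assoc)
      qed
      finally show ?thesis .
    qed (simp add: indicator_def)
  qed
  also have "\<dots> = (\<integral>\<^sup>+z. \<integral>\<^sup>+u. ?c * (ennreal (z powr (-g) / (r + z * u)) * \<phi> (r + (1 + z) * u)
       * indicator {0<..} u * indicator {0<..} z) \<partial>lborel \<partial>lborel)"
    by (intro lborel_pair.Fubini') measurable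
  \<comment> \<open>Substitution \<open>w = r + (1 + z) * u\<close>, the argument of \<phi>. Since
    \<open>r + z * w = (1 + z) * (r + z * u)\<close>, the Jacobian \<open>1 + z\<close> cancels, and
    \<open>z\<close> is left only in the weight.\<close>
  also have "\<dots> = (\<integral>\<^sup>+z. \<integral>\<^sup>+w. ?c * (ennreal (z powr (-g) / (r + z * w)) * \<phi> w
       * indicator {r<..} w * indicator {0<..} z) \<partial>lborel \<partial>lborel)"
  proof (rule nn_integral_cong)
    fix z :: real
    show "(\<integral>\<^sup>+u. ?c * (ennreal (z powr (-g) / (r + z * u)) * \<phi> (r + (1 + z) * u)
       * indicator {0<..} u * indicator {0<..} z) \<partial>lborel) = (\<integral>\<^sup>+w. ?c * (ennreal (z powr (-g) / (r + z * w)) * \<phi> w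
       * indicator {r<..} w * indicator {0<..} z) \<partial>lborel)"
    proof (cases "z > 0")
      case True
      have "(\<integral>\<^sup>+w. ?c * (ennreal (z powr (-g) / (r + z * w)) * \<phi> w
       * indicator {r<..} w * indicator {0<..} z) \<partial>lborel) =
        (\<integral>\<^sup>+w\<in>{r<..}. (?c * (ennreal (z powr (-g) / (r + z * w)) * \<phi> w * indicator {0<..} z)) \<partial>lborel)"
        by (simp add: mult_ac)
      also have "\<dots> = ennreal (1 + z) * (\<integral>\<^sup>+u\<in>{0<..}. (?c * (ennreal (z powr (-g) / (r + z * (r + (1 + z) * u)))
          * \<phi> (r + (1 + z) * u) * indicator {0<..} z)) \<partial>lborel)"
        using True by (intro nn_integral_halfline_affine) measurable
      also have "\<dots> = (\<integral>\<^sup>+u. ennreal (1 + z) * ((?c * (ennreal (z powr (-g) / (r + z * (r + (1 + z) * u)))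
          * \<phi> (r + (1 + z) * u) * indicator {0<..} z)) * indicator {0<..} u) \<partial>lborel)"
        by (simp add: nn_integral_cmult)
      also have "\<dots> = (\<integral>\<^sup>+u. ?c * (ennreal (z powr (-g) / (r + z * u)) * \<phi> (r + (1 + z) * u)
       * indicator {0<..} u * indicator {0<..} z) \<partial>lborel)"
      proof (intro nn_integral_cong)
        fix u :: real
        have eq: "ennreal (1 + z) * ennreal (z powr (-g) / (r + z * (r + (1 + z) * u))) = ennreal (z powr (-g) / (r + z * u))"
          if u: "u > 0"
        proof -
          have "r + z * (r + (1 + z) * u) = (1 + z) * (r + z * u)" by (simp add: algebra_simps)
          then show ?thesis using True u r by (simp flip: ennreal_mult del: ennreal_plus)
        qed
        show "ennreal (1 + z) * ((?c * (ennreal (z powr (-g) / (r + z * (r + (1 + z) * u)))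
          * \<phi> (r + (1 + z) * u) * indicator {0<..} z)) * indicator {0<..} u) =
          ?c * (ennreal (z powr (-g) / (r + z * u)) * \<phi> (r + (1 + z) * u) * indicator {0<..} u * indicator {0<..} z)"
          proof (cases "u > 0")
          case pos: True
          have ac: "a * ((k * (b * f * i)) * j) = k * ((a * b) * f * j * i)" for a b k f i j :: ennreal
            by (simp only: mult_ac)
          show ?thesis unfolding ac eq[OF pos] ..
        qed (simp add: indicator_def)
      qed
      finally show ?thesis by simp
    qed (simp add: indicator_def)
  qed
  also have "\<dots> = (\<integral>\<^sup>+w. \<integral>\<^sup>+z. ?c * (ennreal (z powr (-g) / (r + z * w)) * \<phi> w
       * indicator {r<..} w * indicator {0<..} z) \<partial>lborel \<partial>lborel)"
    by (intro lborel_pair.Fubini') measurable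
  also have "\<dots> = ?R"
  proof (intro nn_integral_cong)
    fix w :: real
    show "(\<integral>\<^sup>+z. ?c * (ennreal (z powr (-g) / (r + z * w)) * \<phi> w
       * indicator {r<..} w * indicator {0<..} z) \<partial>lborel) = ennreal (w powr (g-1)) * \<phi> w * indicator {r<..} w"
    proof (cases "w > r")
      case True
      then have w: "w > 0" using r by simp
      have "(\<integral>\<^sup>+z. ?c * (ennreal (z powr (-g) / (r + z * w)) * \<phi> w
       * indicator {r<..} w * indicator {0<..} z) \<partial>lborel) =
         (\<integral>\<^sup>+z\<in>{0<..}. (?c * \<phi> w * ennreal (z powr (-g) / (r + z * w))) \<partial>lborel)"
        using True by (simp add: mult_ac)
      \<comment> \<open>With \<open>z = r / w * y\<close> the denominator \<open>r + z * w\<close>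
        becomes \<open>r * (1 + y)\<close>: the Beta integral appears and cancels the normalising
        constant.\<close>
      also have "\<dots> = ennreal (r / w) * (\<integral>\<^sup>+y\<in>{0<..}. (?c * \<phi> w * ennreal ((0 + r / w * y) powr (-g) / (r + (0 + r / w * y) * w))) \<partial>lborel)"
        using w r by (intro nn_integral_halfline_affine) auto
      also have "\<dots> = (\<integral>\<^sup>+y. (ennreal (w powr (g-1) / ?B) * \<phi> w) * (ennreal (y powr (-g) / (1 + y)) * indicator {0<..} y) \<partial>lborel)"
        unfolding nn_integral_cmult[symmetric]
      proof (subst nn_integral_cmult[symmetric], measurable, intro nn_integral_cong)
        fix y :: real
        have eq: "ennreal (r / w) * ?c * ennreal ((0 + r / w * y) powr (-g) / (r + (0 + r / w * y) * w))
           = ennreal (w powr (g-1) / ?B) * ennreal (y powr (-g) / (1 + y))" if y: "y > 0"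
        proof -
          have "(r / w) powr (-g) = r powr (-g) * w powr g"
            using w r by (simp add: powr_divide powr_minus field_simps)
          then have "(0 + r / w * y) powr (-g) = r powr (-g) * w powr g * y powr (-g)"
            using w r y powr_mult[of "r / w" y "-g"] by simp
          moreover have "r + (0 + r / w * y) * w = r * (1 + y)" using w by (simp add: algebra_simps)
          ultimately have "r / w * (r powr g / ?B) * ((0 + r / w * y) powr (-g) / (r + (0 + r / w * y) * w))
            = (r / w) * (r powr g * r powr (-g)) * w powr g * y powr (-g) / (?B * (r * (1 + y)))"
            by simp
          also have "r powr g * r powr (-g) = 1" using r by (simp flip: powr_add)
          also have "(r / w) * 1 * w powr g * y powr (-g) / (?B * (r * (1 + y))) =
             w powr (g-1) / ?B * (y powr (-g) / (1 + y))"
            using w r y by (simp add: powr_diff)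
          finally show ?thesis using w r y B(2) by (simp flip: ennreal_mult)
        qed
        show "ennreal (r / w) * (?c * \<phi> w * ennreal ((0 + r / w * y) powr (-g) / (r + (0 + r / w * y) * w)) * indicator {0<..} y)
          = ennreal (w powr (g-1) / ?B) * \<phi> w * (ennreal (y powr (-g) / (1 + y)) * indicator {0<..} y)"
          proof (cases "y > 0")
          case pos: True
          have ac: "a * (k * f * b * i) = (a * k * b) * f * i" for a b k f i :: ennreal
            by (simp only: mult_ac)
          have ac': "(a * f) * (b * i) = (a * b) * f * i" for a b f i :: ennreal
            by (simp only: mult_ac)
          show ?thesis unfolding ac ac' eq[OF pos] ..
        qed (simp add: indicator_def)
      qed
      also have "\<dots> = (ennreal (w powr (g-1) / ?B) * \<phi> w) * ennreal ?B"
        by (simp add: nn_integral_cmult B(1))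
      also have "\<dots> = (ennreal (w powr (g-1) / ?B) * ennreal ?B) * \<phi> w" by (simp add: mult_ac)
      also have "ennreal (w powr (g-1) / ?B) * ennreal ?B = ennreal (w powr (g-1))"
        using B(2) by (simp flip: ennreal_mult)
      finally show ?thesis using True by simp
    qed (simp add: indicator_def)
  qed
  finally show ?thesis .
qed

section \<open>Gaussian kernels and the Riesz kernel\<close>

text \<open>The centred Gaussian density with variance \<open>u / 2\<close> in each coordinate. With
  this normalisation the exponent is that of \<open>subord\<close>, and the parameter is additive
  under convolution.\<close>

definition heat :: "real \<Rightarrow> 'a::euclidean_space \<Rightarrow> real" where
  "heat u z = (pi * u) powr (- real DIM('a) / 2) * exp (- (norm z)\<^sup>2 / u)"

lemma heat_nonneg: "heat u z \<ge> 0"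
  by (simp add: heat_def)

lemma heat_measurable [measurable (raw)]:
  assumes [measurable]: "f \<in> borel_measurable M" "h \<in> borel_measurable M"
  shows "(\<lambda>x. heat (f x) (h x :: 'a::euclidean_space)) \<in> borel_measurable M"
  unfolding heat_def by measurable

lemma heat_eq_prod:
  assumes "u > 0"
  shows "heat u (z::'a::euclidean_space) = (\<Prod>b\<in>Basis. normal_density 0 (sqrt (u/2)) (z \<bullet> b))"
proof -
  have *: "normal_density 0 (sqrt (u/2)) x = (pi * u) powr (-1/2) * exp (-x\<^sup>2 / u)" for x
  proof -
    have "(pi * u) powr (-1/2) = 1 / sqrt (pi * u)"
      using powr_minus_divide[of "pi * u" "1/2"] assms by (simp add: powr_half_sqrt)
    then show ?thesis using assms by (simp add: normal_density_def)
  qed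
  have "(\<Prod>b\<in>Basis. normal_density 0 (sqrt (u/2)) (z \<bullet> b)) =
      ((pi * u) powr (-1/2)) ^ DIM('a) * exp (\<Sum>b\<in>Basis. - (z \<bullet> b)\<^sup>2 / u)"
    by (simp add: * prod.distrib exp_sum)
  also have "(\<Sum>b\<in>Basis. - (z \<bullet> b)\<^sup>2 / u) = - (norm z)\<^sup>2 / u"
    by (simp add: norm_eq_sqrt_inner euclidean_inner[of z z] sum_nonneg power2_eq_square sum_divide_distrib sum_negf)
  also have "((pi * u) powr (-1/2)) ^ DIM('a) = (pi * u) powr (- real DIM('a) / 2)"
    using assms by (subst powr_realpow[symmetric]) (simp_all add: powr_powr)
  finally show ?thesis by (simp add: heat_def)
qed

lemma heat_mass:
  assumes "u > 0"
  shows "(\<integral>\<^sup>+y. ennreal (heat u (y - a :: 'a::euclidean_space)) \<partial>lborel) = 1"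
proof -
  have n: "(\<integral>\<^sup>+x. ennreal (normal_density 0 (sqrt (u/2)) x) \<partial>lborel) = 1"
  proof -
    interpret prob_space "density lborel (normal_density 0 (sqrt (u/2)))"
      using assms by (intro prob_space_normal_density) simp
    show ?thesis using emeasure_space_1 by (simp add: emeasure_density)
  qed
  have "(\<integral>\<^sup>+y. ennreal (heat u (y - a)) \<partial>lborel) =
      (\<integral>\<^sup>+y. ennreal (heat u (y - a)) \<partial>distr lborel borel ((+) a))"
    by (simp only: lborel_distr_plus)
  also have "\<dots> = (\<integral>\<^sup>+y. ennreal (heat u (y::'a)) \<partial>lborel)"
    by (subst nn_integral_distr) simp_all
  also have "\<dots> = (\<integral>\<^sup>+y. (\<Prod>b\<in>Basis. ennreal (normal_density 0 (sqrt (u/2)) ((y::'a) \<bullet> b))) \<partial>lborel)"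
    using assms by (simp add: heat_eq_prod prod_ennreal)
  also have "\<dots> = 1"
    by (subst nn_integral_lborel_prod) (simp_all add: n)
  finally show ?thesis .
qed

text \<open>The exponent behind \<open>heat_semigroup\<close>: in the variable \<open>Y\<close> a
  product of two Gaussians is one Gaussian, centred at the fraction \<open>u / (u + v)\<close> of
  the way from 0 to \<open>X\<close>, and what splits off is a Gaussian in \<open>X\<close> with
  parameter \<open>u + v\<close>.\<close>

lemma gaussian_complete_square:
  fixes X Y :: "'a::real_inner"
  assumes "u > 0" "v > 0"
  shows "(norm (X - Y))\<^sup>2 / v + (norm Y)\<^sup>2 / u =
    (norm X)\<^sup>2 / (u + v) + (norm (Y - (u / (u + v)) *\<^sub>R X))\<^sup>2 / (u * v / (u + v))"
proof -
  have e: "(norm (Y - c *\<^sub>R X))\<^sup>2 = (norm Y)\<^sup>2 - 2 * c * (X \<bullet> Y) + c\<^sup>2 * (norm X)\<^sup>2" for c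
    unfolding power2_norm_eq_inner
    by (simp add: inner_diff_left inner_diff_right inner_commute power2_eq_square algebra_simps)
  have e1: "(norm (X - Y))\<^sup>2 = (norm Y)\<^sup>2 - 2 * (X \<bullet> Y) + (norm X)\<^sup>2"
    using e[of 1] by (simp add: norm_minus_commute)
  define w where "w = u + v"
  have w: "w > 0" using assms by (simp add: w_def)
  have m1: "(D - 2 * (u / w) * B + (u / w)\<^sup>2 * A) / (u * v / w) = D * (w / (u * v)) - 2 * B / v + u * A / (v * w)" for A B D :: real
    using assms w by (simp add: field_simps power2_eq_square)
  have m2: "w / (u * v) = 1 / u + 1 / v" "u * A / (v * w) = A / v - A / w" for A :: real
    using assms w by (simp_all add: w_def field_simps)
  show ?thesis unfolding e e1 w_def[symmetric] m1 unfolding m2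
    by (simp add: algebra_simps add_divide_distrib diff_divide_distrib)
qed

lemma heat_semigroup:
  assumes "u > 0" "v > 0"
  shows "(\<integral>\<^sup>+y. ennreal (heat v (x - y)) * ennreal (heat u (y - t)) \<partial>lborel) = ennreal (heat (u + v) (x - t :: 'a::euclidean_space))"
proof -
  let ?w = "u * v / (u + v)" and ?a = "t + (u / (u + v)) *\<^sub>R (x - t)"
  have *: "heat v (x - y) * heat u (y - t) = heat (u + v) (x - t) * heat ?w (y - ?a)" for y
  proof -
    have "- (norm (x - y))\<^sup>2 / v + - (norm (y - t))\<^sup>2 / u =
        - (norm (x - t))\<^sup>2 / (u + v) + - (norm (y - ?a))\<^sup>2 / ?w"
    proof -
      have d: "x - t - (y - t) = x - y" "y - t - c *\<^sub>R (x - t) = y - (t + c *\<^sub>R (x - t))" for c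
        by (simp_all add: algebra_simps)
      show ?thesis
        using gaussian_complete_square[OF assms, of "x - t" "y - t"] unfolding d
        by (simp only: minus_divide_left[symmetric])
    qed
    then have "exp (- (norm (x - y))\<^sup>2 / v) * exp (- (norm (y - t))\<^sup>2 / u) =
        exp (- (norm (x - t))\<^sup>2 / (u + v)) * exp (- (norm (y - ?a))\<^sup>2 / ?w)"
      by (simp only: exp_add[symmetric])
    \<comment> \<open>The normalising factors agree because
      \<open>v * u = (u + v) * ?w\<close>.\<close>
    moreover have "(pi * v) powr c * (pi * u) powr c = (pi * (u + v)) powr c * (pi * ?w) powr c" for c
      using assms by (subst powr_mult[symmetric], simp, simp)+ (simp add: mult_ac)
    moreover have ac: "heat a p * heat b q = ((pi * a) powr c * (pi * b) powr c) *
        (exp (- (norm p)\<^sup>2 / a) * exp (- (norm q)\<^sup>2 / b))"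
      if "c = - real DIM('a) / 2" for a b c and p q :: 'a
      unfolding heat_def that by (simp only: mult_ac)
    ultimately show ?thesis by (simp only: ac)
  qed
  have "(\<integral>\<^sup>+y. ennreal (heat v (x - y)) * ennreal (heat u (y - t)) \<partial>lborel) =
     (\<integral>\<^sup>+y. ennreal (heat (u + v) (x - t)) * ennreal (heat ?w (y - ?a)) \<partial>lborel)"
    by (intro nn_integral_cong) (simp add: * heat_nonneg flip: ennreal_mult)
  also have "\<dots> = ennreal (heat (u + v) (x - t))"
    using assms by (subst nn_integral_cmult) (simp_all add: heat_mass)
  finally show ?thesis .
qed

section \<open>The Riesz kernel as a mixture of Gaussians\<close>

lemma exp_minus_power_bound:
  fixes a :: real assumes "a \<ge> 0"
  obtains M where "M > 0" "\<And>y. y > 0 \<Longrightarrow> y powr a * exp (-y) \<le> M"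
proof -
  define n where "n = nat \<lceil>a\<rceil>"
  have n: "a \<le> real n" unfolding n_def by linarith
  have "y powr a * exp (-y) \<le> 1 + fact n" if y: "y > 0" for y :: real
  proof (cases "y \<le> 1")
    case True
    have "y powr a \<le> 1" using True y assms by (simp add: powr_le1)
    moreover have "exp (-y) \<le> 1" using y by simp
    ultimately have "y powr a * exp (-y) \<le> 1 * 1" by (intro mult_mono) auto
    then show ?thesis by (simp add: add_increasing2)
  next
    case False
    then have "y powr a \<le> y powr real n" using n by (intro powr_mono) auto
    also have "\<dots> = y ^ n" using y by (simp add: powr_realpow)
    also have "\<dots> \<le> fact n * exp y"
    proof -
      have "(\<Sum>k\<in>{n}. y ^ k /\<^sub>R fact k) \<le> (\<Sum>k. y ^ k /\<^sub>R fact k)"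
        using y by (intro sum_le_suminf summable_exp_generic) auto
      then have "y ^ n / fact n \<le> exp y" by (simp add: exp_def divide_inverse mult.commute)
      then show ?thesis by (simp add: field_simps)
    qed
    finally have "y powr a * exp (-y) \<le> fact n * exp y * exp (-y)" by (intro mult_right_mono) auto
    also have "\<dots> = fact n" by (simp add: exp_minus)
    finally show ?thesis by simp
  qed
  then show thesis by (intro that[of "1 + fact n"]) (auto simp: add_pos_pos)
qed

text \<open>By \<open>w = 1 / y\<close> this is Gamma(s / 2), the constant in the subordination
  formula for \<open>norm z powr (- s)\<close>.\<close>

definition riesz_const :: "real \<Rightarrow> real" where
  "riesz_const s = enn2real (\<integral>\<^sup>+w\<in>{0<..}. ennreal (w powr (-s/2-1) * exp (-1/w)) \<partial>lborel)"

lemma riesz_const: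
  assumes s: "s > 0"
  shows "ennreal (riesz_const s) = (\<integral>\<^sup>+w\<in>{0<..}. ennreal (w powr (-s/2-1) * exp (-1/w)) \<partial>lborel)"
    and "riesz_const s > 0"
proof -
  let ?I = "\<integral>\<^sup>+w\<in>{0<..}. ennreal (w powr (-s/2-1) * exp (-1/w)) \<partial>lborel"
  obtain M where M: "M > 0" "\<And>y. y > 0 \<Longrightarrow> y powr (s/2+1) * exp (-y) \<le> M"
    using exp_minus_power_bound[of "s/2+1"] s by auto
  have "?I < \<infinity>"
  proof (rule nn_integral_halfline_finite[where a=0 and b="-s/2-1" and c="max M 1"])
    fix y :: real assume y: "y > 1"
    have "y powr (-s/2-1) * exp (-1/y) \<le> y powr (-s/2-1) * 1" using y by (intro mult_left_mono) auto
    also have "\<dots> \<le> max M 1 * y powr (-s/2-1)" using y by (simp add: mult_le_cancel_right1)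
    finally show "y powr (-s/2-1) * exp (-1/y) \<le> max M 1 * y powr (-s/2-1)" .
  next
    fix y :: real assume y: "y > 0" "y \<le> 1"
    have "y powr (-s/2-1) = 1 / y powr (s/2+1)" using powr_minus_divide[of y "s/2+1"] by simp
    also have "\<dots> = (1/y) powr (s/2+1)" using y by (simp add: powr_divide)
    finally have "y powr (-s/2-1) * exp (-1/y) \<le> M" using M(2)[of "1/y"] y by simp
    then show "y powr (-s/2-1) * exp (-1/y) \<le> max M 1 * y powr 0" using y by simp
  qed (use s in auto)
  moreover have "?I > 0" by (rule nn_integral_halfline_pos) auto
  ultimately show "ennreal (riesz_const s) = ?I" "riesz_const s > 0"
    by (auto simp: riesz_const_def enn2real_positive_iff less_top)
qed

text \<open>The Riesz kernel is a mixture of Gaussians, \<open>riesz_kernel s x t\<close> being the integral of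
  \<open>subord s u (x - t)\<close> over \<open>u > 0\<close>.\<close>

definition subord :: "real \<Rightarrow> real \<Rightarrow> 'a::euclidean_space \<Rightarrow> real" where
  "subord s u z = u powr (-s/2-1) * exp (- (norm z)\<^sup>2 / u) / riesz_const s"

lemma subord_measurable [measurable (raw)]:
  assumes [measurable]: "f \<in> borel_measurable M" "h \<in> borel_measurable M"
  shows "(\<lambda>x. subord s (f x) (h x :: 'a::euclidean_space)) \<in> borel_measurable M"
  unfolding subord_def by measurable

text \<open>Off the diagonal, scaling \<open>u\<close> by the squared distance reduces the integral
  to \<open>riesz_const s\<close>. On the diagonal the Gaussian factor is 1 and the weight
  \<open>u powr (-s/2-1)\<close> is not integrable at 0.\<close>

lemma riesz_kernel_subord:
  assumes s: "s > 0"
  shows "(\<integral>\<^sup>+u\<in>{0<..}. ennreal (subord s u (x - t)) \<partial>lborel) = riesz_kernel s x (t::'a::euclidean_space)"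
proof (cases "x = t")
  case True
  have top: "(\<integral>\<^sup>+u\<in>{0<..}. ennreal (subord s u (0::'a)) \<partial>lborel) = \<infinity>"
  proof -
    have "ennreal (1 / riesz_const s * real n) \<le> (\<integral>\<^sup>+u\<in>{0<..}. ennreal (subord s u (0::'a)) \<partial>lborel)" if n: "n > 0" for n :: nat
    proof -
      \<comment> \<open>Chosen so that \<open>q powr (-s/2) = real n\<close>: below \<open>q\<close>
        the weight is at least \<open>q powr (-s/2-1)\<close>, which contributes
        \<open>real n / riesz_const s\<close>.\<close>
      define q where "q = real n powr (- 2 / s)"
      have q: "q > 0" using n by (simp add: q_def)
      have "ennreal (1 / riesz_const s * real n) = ennreal (q powr (-s/2-1) / riesz_const s) * emeasure lborel {0<..<q}"
      proof -
        have "q powr (-s/2-1) * q = q powr (-s/2)" using q by (simp add: powr_diff)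
        also have "\<dots> = real n" using n s by (simp add: q_def powr_powr)
        finally show ?thesis using q s riesz_const(2)[of s] by (simp flip: ennreal_mult)
      qed
      also have "\<dots> = (\<integral>\<^sup>+u\<in>{0<..<q}. ennreal (q powr (-s/2-1) / riesz_const s) \<partial>lborel)"
        by (simp add: nn_integral_cmult_indicator)
      also have "\<dots> \<le> (\<integral>\<^sup>+u\<in>{0<..}. ennreal (subord s u (0::'a)) \<partial>lborel)"
        using s riesz_const(2)[OF s] q
        by (intro nn_integral_mono)
          (auto split: split_indicator simp: subord_def intro!: ennreal_leI divide_right_mono powr_mono2')
      finally show ?thesis .
    qed
    note le = this
    show ?thesis
    proof (rule ccontr)
      assume "(\<integral>\<^sup>+u\<in>{0<..}. ennreal (subord s u (0::'a)) \<partial>lborel) \<noteq> \<infinity>"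
      then obtain I where I: "I \<ge> 0" "(\<integral>\<^sup>+u\<in>{0<..}. ennreal (subord s u (0::'a)) \<partial>lborel) = ennreal I"
        by (cases "(\<integral>\<^sup>+u\<in>{0<..}. ennreal (subord s u (0::'a)) \<partial>lborel)") auto
      obtain n :: nat where n: "riesz_const s * (I + 1) < real n" using reals_Archimedean2 by blast
      with I riesz_const(2)[OF s] have "n > 0" by (intro gr0I) (auto simp: mult_less_0_iff)
      from le[OF this] I have "1 / riesz_const s * real n \<le> I" by (simp add: ennreal_le_iff)
      with n riesz_const(2)[OF s] show False by (simp add: field_simps)
    qed
  qed
  show ?thesis using True top by (simp add: riesz_kernel_def)
next
  case False
  define \<rho> where "\<rho> = norm (x - t)"
  have \<rho>: "\<rho> > 0" using False by (simp add: \<rho>_def)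
  note R = riesz_const[OF s]
  have "(\<integral>\<^sup>+u\<in>{0<..}. ennreal (subord s u (x - t)) \<partial>lborel) =
      ennreal (\<rho>\<^sup>2) * (\<integral>\<^sup>+w\<in>{0<..}. ennreal (subord s (0 + \<rho>\<^sup>2 * w) (x - t)) \<partial>lborel)"
    using \<rho> by (intro nn_integral_halfline_affine) auto
  also have "(\<integral>\<^sup>+w\<in>{0<..}. ennreal (subord s (0 + \<rho>\<^sup>2 * w) (x - t)) \<partial>lborel) =
      (\<integral>\<^sup>+w. ennreal (\<rho> powr (-s-2) / riesz_const s) * (ennreal (w powr (-s/2-1) * exp (-1/w)) * indicator {0<..} w) \<partial>lborel)"
  proof (intro nn_integral_cong)
    fix w :: real
    have "subord s (0 + \<rho>\<^sup>2 * w) (x - t) = \<rho> powr (-s-2) / riesz_const s * (w powr (-s/2-1) * exp (-1/w))" if "w > 0"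
    proof -
      have "(\<rho>\<^sup>2) powr (-s/2-1) = (\<rho> powr 2) powr (-s/2-1)" using \<rho> by (simp add: powr_numeral)
      also have "\<dots> = \<rho> powr (-s-2)" unfolding powr_powr by (simp add: algebra_simps)
      finally show ?thesis using \<rho> that by (simp add: subord_def powr_mult \<rho>_def[symmetric])
    qed
    then show "ennreal (subord s (0 + \<rho>\<^sup>2 * w) (x - t)) * indicator {0<..} w =
      ennreal (\<rho> powr (-s-2) / riesz_const s) * (ennreal (w powr (-s/2-1) * exp (-1/w)) * indicator {0<..} w)"
      using R(2) by (auto split: split_indicator simp flip: ennreal_mult)
  qed
  also have "\<dots> = ennreal (\<rho> powr (-s-2) / riesz_const s) * ennreal (riesz_const s)"
    by (simp add: nn_integral_cmult R(1))
  also have "ennreal (\<rho>\<^sup>2) * \<dots> = ennreal (\<rho> powr (-s))"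
  proof -
    have "\<rho>\<^sup>2 * \<rho> powr (-s-2) = \<rho> powr (-s)"
      using \<rho> by (simp add: powr_diff powr_numeral)
    then show ?thesis using R(2) \<rho> by (simp flip: ennreal_mult)
  qed
  finally show ?thesis using False by (simp add: riesz_kernel_def \<rho>_def)
qed

text \<open>Brings the mixture into the form of \<open>passage_conv\<close> with
  \<open>g = (d - s) / 2\<close>: in front of the normalised Gaussian the weight is
  \<open>u powr (g - 1)\<close>.\<close>

lemma subord_heat:
  "u > 0 \<Longrightarrow> subord s u (z::'a::euclidean_space) =
    pi powr (real DIM('a) / 2) / riesz_const s * (u powr ((real DIM('a) - s) / 2 - 1) * heat u z)"
proof -
  assume u: "u > 0"
  have "u powr ((real DIM('a) - s) / 2 - 1) * (pi * u) powr (- real DIM('a) / 2) =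
      pi powr (- real DIM('a) / 2) * (u powr ((real DIM('a) - s) / 2 - 1) * u powr (- real DIM('a) / 2))"
    using u by (simp add: powr_mult)
  also have "u powr ((real DIM('a) - s) / 2 - 1) * u powr (- real DIM('a) / 2) = u powr (-s/2-1)"
    unfolding powr_add[symmetric] by (rule arg_cong[where f="\<lambda>a. u powr a"]) (simp add: diff_divide_distrib)
  finally have "pi powr (real DIM('a) / 2) * (u powr ((real DIM('a) - s) / 2 - 1) * (pi * u) powr (- real DIM('a) / 2)) = u powr (-s/2-1)"
    by (simp add: powr_minus)
  then show ?thesis by (simp add: subord_def heat_def mult.assoc[symmetric])
qed

text \<open>The bound is uniform in \<open>u\<close> because
  \<open>y powr (s/2+1) * exp (-y)\<close> is bounded, here taken at
  \<open>y = \<rho>^2 / u\<close>. Layers seen from a positive distance thus add up to order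
  \<open>r\<close> over \<open>u \<le> r\<close>.\<close>

lemma subord_le:
  assumes s: "s > 0"
  obtains M where "M > 0" "\<And>u (z::'a::euclidean_space) \<rho>. u > 0 \<Longrightarrow> \<rho> > 0 \<Longrightarrow> \<rho> \<le> norm z \<Longrightarrow> subord s u z \<le> M * \<rho> powr (-s-2)"
proof -
  obtain M where M: "M > 0" "\<And>y. y > 0 \<Longrightarrow> y powr (s/2+1) * exp (-y) \<le> M"
    using exp_minus_power_bound[of "s/2+1"] s by auto
  have "subord s u z \<le> M / riesz_const s * \<rho> powr (-s-2)" if "u > 0" "\<rho> > 0" "\<rho> \<le> norm z" for u \<rho> and z :: 'a
  proof -
    have "u powr (-s/2-1) = \<rho> powr (-s-2) * (\<rho>\<^sup>2 / u) powr (s/2+1)"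
    proof -
      have "(\<rho>\<^sup>2) powr (s/2+1) = (\<rho> powr 2) powr (s/2+1)" using that by (simp add: powr_numeral)
      also have "\<dots> = \<rho> powr (s+2)" unfolding powr_powr by (simp add: algebra_simps)
      finally have "\<rho> powr (-s-2) * (\<rho>\<^sup>2 / u) powr (s/2+1) = (\<rho> powr (-s-2) * \<rho> powr (s+2)) / u powr (s/2+1)"
        using that by (simp add: powr_divide)
      also have "\<rho> powr (-s-2) * \<rho> powr (s+2) = 1" using that by (simp flip: powr_add)
      finally have "\<rho> powr (-s-2) * (\<rho>\<^sup>2 / u) powr (s/2+1) = 1 / u powr (s/2+1)" .
      also have "\<dots> = u powr (-s/2-1)" using powr_minus_divide[of u "s/2+1"] by simp
      finally show ?thesis ..
    qed
    then have "u powr (-s/2-1) * exp (- (norm z)\<^sup>2 / u) = \<rho> powr (-s-2) * ((\<rho>\<^sup>2 / u) powr (s/2+1) * exp (- (norm z)\<^sup>2 / u))"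
      by simp
    also have "\<dots> \<le> \<rho> powr (-s-2) * ((\<rho>\<^sup>2 / u) powr (s/2+1) * exp (- (\<rho>\<^sup>2 / u)))"
      using that by (intro mult_left_mono) (auto intro!: divide_right_mono power_mono)
    also have "\<dots> \<le> \<rho> powr (-s-2) * M" using that by (intro mult_left_mono M) auto
    finally show ?thesis using riesz_const(2)[OF s] by (simp add: subord_def field_simps)
  qed
  then show thesis using M riesz_const(2)[OF s] by (intro that[of "M / riesz_const s"]) auto
qed

section \<open>Sweeping of potentials\<close>

definition subord_potential :: "real \<Rightarrow> real \<Rightarrow> 'a::euclidean_space measure \<Rightarrow> 'a \<Rightarrow> ennreal" where
  "subord_potential s u \<sigma> x = (\<integral>\<^sup>+t. ennreal (subord s u (x - t)) \<partial>\<sigma>)"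

definition near_potential :: "real \<Rightarrow> real \<Rightarrow> 'a::euclidean_space measure \<Rightarrow> 'a \<Rightarrow> ennreal" where
  "near_potential s r \<sigma> x = (\<integral>\<^sup>+u\<in>{0<..r}. subord_potential s u \<sigma> x \<partial>lborel)"

text \<open>Averaging over the position of an isotropic stable process at the moment when its
  subordinator passes level \<open>r\<close>.\<close>

definition sweep :: "real \<Rightarrow> real \<Rightarrow> ('a::euclidean_space \<Rightarrow> ennreal) \<Rightarrow> 'a \<Rightarrow> ennreal" where
  "sweep s r f x = (\<integral>\<^sup>+v\<in>{r<..}. ennreal (passage ((real DIM('a) - s) / 2) r v) *
     (\<integral>\<^sup>+y. ennreal (heat v (x - y)) * f y \<partial>lborel) \<partial>lborel)"

lemma heat_minus_commute: "heat v (x - y) = heat v (y - x)"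
  by (simp add: heat_def norm_minus_commute)

lemma sweep_mono: "(\<And>y. f y \<le> h y) \<Longrightarrow> sweep s r f x \<le> sweep s r h x"
  unfolding sweep_def by (intro nn_integral_mono mult_right_mono mult_left_mono) auto

lemma sweep_add:
  assumes [measurable]: "f \<in> borel_measurable borel" "h \<in> borel_measurable borel"
  shows "sweep s r (\<lambda>y. f y + h y) x = sweep s r f x + sweep s r h x"
  by (simp add: sweep_def distrib_left distrib_right nn_integral_add)

lemma sweep_cmult:
  assumes [measurable]: "f \<in> borel_measurable borel"
  shows "sweep s r (\<lambda>y. c * f y) x = c * sweep s r f x"
proof -
  have "(\<integral>\<^sup>+y. ennreal (heat v (x - y)) * (c * f y) \<partial>lborel) =
      c * (\<integral>\<^sup>+y. ennreal (heat v (x - y)) * f y \<partial>lborel)" for v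
    by (subst nn_integral_cmult[symmetric]) (simp_all add: mult_ac)
  then have "sweep s r (\<lambda>y. c * f y) x = (\<integral>\<^sup>+v. c * (ennreal (passage ((real DIM('a) - s) / 2) r v) *
     (\<integral>\<^sup>+y. ennreal (heat v (x - y)) * f y \<partial>lborel) * indicator {r<..} v) \<partial>lborel)"
    by (simp add: sweep_def mult_ac)
  also have "\<dots> = c * sweep s r f x"
    unfolding sweep_def by (rule nn_integral_cmult) measurable
  finally show ?thesis .
qed

lemma sweep_const:
  assumes s: "real DIM('a) - 2 < s" "s < real DIM('a)" and r: "r > 0"
  shows "sweep s r (\<lambda>_. c) (x::'a::euclidean_space) = c"
proof -
  let ?g = "(real DIM('a) - s) / 2"
  have g: "0 < ?g" "?g < 1" using s by auto
  have "(\<integral>\<^sup>+y. ennreal (heat v (x - y)) * 1 \<partial>lborel) = 1" if "v > r" for v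
    using heat_mass[of v x] that r by (simp add: heat_minus_commute)
  then have "sweep s r (\<lambda>_. 1) x = (\<integral>\<^sup>+v\<in>{r<..}. ennreal (passage ?g r v) \<partial>lborel)"
    unfolding sweep_def by (intro nn_integral_cong) (auto split: split_indicator)
  also have "\<dots> = 1" using g r by (rule passage_mass)
  finally show ?thesis using sweep_cmult[of "\<lambda>_. 1" s r c x] by simp
qed

text \<open>The range \<open>2 < v < 3\<close> lies beyond every level \<open>r \<le> 1\<close>.
  There the passage density is at least a constant times \<open>r powr ((d - s) / 2)\<close>, and
  the Gaussians give \<open>F\<close> a mass bounded below.\<close>

lemma sweep_indicator_lower:
  assumes s: "real DIM('a) - 2 < s" "s < real DIM('a)"
    and F [measurable]: "F \<in> sets borel" and F0: "emeasure lborel F > 0"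
  obtains c where "c > 0" "\<And>r. 0 < r \<Longrightarrow> r \<le> 1 \<Longrightarrow>
    ennreal (c * r powr ((real DIM('a) - s) / 2)) \<le> sweep s r (indicator F) (x::'a::euclidean_space)"
proof -
  define g where "g = (real DIM('a) - s) / 2"
  have g: "0 < g" "g < 1" using s by (auto simp: g_def)
  note B = beta_const(2)[OF g]
  \<comment> \<open>A common lower bound for \<open>heat v (x - y)\<close> with
    \<open>2 < v < 3\<close>: the prefactor is smallest at 3, the exponential at 2.\<close>
  define h where "h y = (pi * 3) powr (- real DIM('a) / 2) * exp (- (norm (x - y))\<^sup>2 / 2)" for y
  have [measurable]: "h \<in> borel_measurable borel" unfolding h_def by measurable
  define J where "J = (\<integral>\<^sup>+y. ennreal (h y) * indicator F y \<partial>lborel)"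
  have "J \<noteq> 0"
  proof -
    have "{y \<in> space lborel. ennreal (h y) * indicator F y \<noteq> 0} = F"
      by (auto simp: h_def split: split_indicator)
    then show ?thesis unfolding J_def using F0 by (subst nn_integral_0_iff) auto
  qed
  obtain j where j: "j > 0" "ennreal j \<le> J"
  proof (cases J)
    case (real j)
    with \<open>J \<noteq> 0\<close> show ?thesis by (intro that[of j]) (auto simp: order_le_less)
  qed (auto intro: that[of 1])
  have inner: "J \<le> (\<integral>\<^sup>+y. ennreal (heat v (x - y)) * indicator F y \<partial>lborel)" if v: "2 < v" "v < 3" for v
    unfolding J_def
  proof (intro nn_integral_mono mult_right_mono ennreal_leI)
    fix y
    have "(pi * 3) powr (- real DIM('a) / 2) \<le> (pi * v) powr (- real DIM('a) / 2)"
      using v by (intro powr_mono2') auto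
    moreover have "(norm (x - y))\<^sup>2 / v \<le> (norm (x - y))\<^sup>2 / 2" using v by (intro divide_left_mono) auto
    ultimately show "h y \<le> heat v (x - y)"
      unfolding h_def heat_def by (intro mult_mono) auto
  qed simp
  define c where "c = 3 powr (-g) / (3 * beta_const g) * j"
  have "ennreal (c * r powr g) \<le> sweep s r (indicator F) x" if r: "0 < r" "r \<le> 1" for r
  proof -
    have "ennreal (c * r powr g) = (\<integral>\<^sup>+v. ennreal (c * r powr g) * indicator {2<..<3::real} v \<partial>lborel)"
      by (simp add: nn_integral_cmult_indicator)
    also have "\<dots> \<le> sweep s r (indicator F) x"
      unfolding sweep_def g_def[symmetric]
    proof (intro nn_integral_mono)
      fix v :: real
      have "ennreal (c * r powr g) \<le> ennreal (passage g r v) * (\<integral>\<^sup>+y. ennreal (heat v (x - y)) * indicator F y \<partial>lborel)"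
        if v: "2 < v" "v < 3"
      proof -
        have "3 powr (-g) / (3 * beta_const g) * r powr g \<le> passage g r v"
        proof -
          have "3 powr (-g) \<le> (v - r) powr (-g)" using v r g by (intro powr_mono2') auto
          moreover have "1 / (3 * beta_const g) \<le> 1 / (v * beta_const g)"
            using v B by (intro divide_left_mono) auto
          ultimately have "3 powr (-g) * (1 / (3 * beta_const g)) * r powr g \<le> (v - r) powr (-g) * (1 / (v * beta_const g)) * r powr g"
            using B v by (intro mult_mono) auto
          then show ?thesis by (simp add: passage_def mult_ac)
        qed
        moreover have "ennreal (c * r powr g) = ennreal (3 powr (-g) / (3 * beta_const g) * r powr g) * ennreal j"
          using j B by (simp add: c_def mult_ac flip: ennreal_mult)
        ultimately show ?thesis
          using order_trans[OF j(2) inner[OF v]] by (auto intro!: mult_mono ennreal_leI)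
      qed
      then show "ennreal (c * r powr g) * indicator {2<..<3} v \<le>
         ennreal (passage g r v) * (\<integral>\<^sup>+y. ennreal (heat v (x - y)) * indicator F y \<partial>lborel) * indicator {r<..} v"
        using r by (auto split: split_indicator)
    qed
    finally show ?thesis .
  qed
  moreover have "c > 0" using j B by (simp add: c_def)
  ultimately show thesis using that unfolding g_def by blast
qed

lemma riesz_kernel_measurable [measurable (raw)]:
  assumes [measurable]: "f \<in> borel_measurable M" "h \<in> borel_measurable M"
  shows "(\<lambda>x. riesz_kernel s (f x) (h x :: 'a::euclidean_space)) \<in> borel_measurable M"
  unfolding riesz_kernel_def by measurable

text \<open>The properties shared by \<mu>, \<nu> and the restrictions of \<nu> to compact sets:
  sigma-finiteness for exchanging integrals, and the range of \<open>s\<close> in which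
  \<open>(d - s) / 2\<close> lies strictly between 0 and 1.\<close>

locale riesz_measure = sigma_finite_measure \<sigma> for \<sigma> :: "'a::euclidean_space measure" +
  fixes s :: real
  assumes sets_eq [measurable_cong]: "sets \<sigma> = sets borel"
    and s_pos: "0 < s" and s_gt: "real DIM('a) - 2 < s" and s_less: "s < real DIM('a)"
begin

sublocale pair: pair_sigma_finite lborel \<sigma> ..

lemma riesz_potential_measurable [measurable (raw)]:
  assumes [measurable]: "f \<in> borel_measurable M"
  shows "(\<lambda>x. riesz_potential s \<sigma> (f x)) \<in> borel_measurable M"
  unfolding riesz_potential_def by measurable

lemma subord_potential_measurable [measurable (raw)]:
  assumes [measurable]: "f \<in> borel_measurable M" "h \<in> borel_measurable M"
  shows "(\<lambda>x. subord_potential s (h x) \<sigma> (f x)) \<in> borel_measurable M"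
  unfolding subord_potential_def by measurable

lemma near_potential_measurable [measurable (raw)]:
  assumes [measurable]: "f \<in> borel_measurable M"
  shows "(\<lambda>x. near_potential s r \<sigma> (f x)) \<in> borel_measurable M"
  unfolding near_potential_def by measurable

lemma riesz_potential_eq:
  "riesz_potential s \<sigma> x = (\<integral>\<^sup>+u\<in>{0<..}. subord_potential s u \<sigma> x \<partial>lborel)"
proof -
  have "riesz_potential s \<sigma> x = (\<integral>\<^sup>+t. \<integral>\<^sup>+u. ennreal (subord s u (x - t)) * indicator {0<..} u \<partial>lborel \<partial>\<sigma>)"
    by (simp add: riesz_potential_def riesz_kernel_subord[OF s_pos, symmetric])
  also have "\<dots> = (\<integral>\<^sup>+u. \<integral>\<^sup>+t. ennreal (subord s u (x - t)) * indicator {0<..} u \<partial>\<sigma> \<partial>lborel)"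
    by (rule pair.Fubini') measurable
  also have "\<dots> = (\<integral>\<^sup>+u\<in>{0<..}. subord_potential s u \<sigma> x \<partial>lborel)"
    by (intro nn_integral_cong) (simp add: subord_potential_def nn_integral_multc)
  finally show ?thesis .
qed

text \<open>By \<open>heat_semigroup\<close>, smoothing with parameter \<open>v\<close> merely
  shifts the mixture variable from \<open>u\<close> to \<open>u + v\<close>, the shape in which
  \<open>passage_conv\<close> takes its argument.\<close>

lemma heat_riesz_potential:
  assumes v: "v > 0"
  shows "(\<integral>\<^sup>+y. ennreal (heat v (x - y)) * riesz_potential s \<sigma> y \<partial>lborel) =
    (\<integral>\<^sup>+u\<in>{0<..}. ennreal (u powr ((real DIM('a) - s) / 2 - 1)) *
      (\<integral>\<^sup>+t. ennreal (pi powr (real DIM('a) / 2) / riesz_const s * heat (u + v) (x - t)) \<partial>\<sigma>) \<partial>lborel)"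
proof -
  let ?g = "(real DIM('a) - s) / 2"
  define c where "c = pi powr (real DIM('a) / 2) / riesz_const s"
  have c: "c \<ge> 0" using riesz_const(2)[OF s_pos] by (simp add: c_def)
  have sh: "subord s u z = c * (u powr (?g - 1) * heat u z)" if "u > 0" for u and z :: 'a
    using subord_heat[OF that, of s z] by (simp add: c_def)
  have "(\<integral>\<^sup>+y. ennreal (heat v (x - y)) * riesz_potential s \<sigma> y \<partial>lborel) =
    (\<integral>\<^sup>+y. \<integral>\<^sup>+u. ennreal (heat v (x - y)) * (subord_potential s u \<sigma> y * indicator {0<..} u) \<partial>lborel \<partial>lborel)"
    unfolding riesz_potential_eq by (intro nn_integral_cong nn_integral_cmult[symmetric]) measurable
  also have "\<dots> = (\<integral>\<^sup>+u. \<integral>\<^sup>+y. ennreal (heat v (x - y)) * (subord_potential s u \<sigma> y * indicator {0<..} u) \<partial>lborel \<partial>lborel)"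
    by (rule lborel_pair.Fubini') measurable
  also have "\<dots> = (\<integral>\<^sup>+u\<in>{0<..}. ennreal (u powr (?g - 1)) *
      (\<integral>\<^sup>+t. ennreal (c * heat (u + v) (x - t)) \<partial>\<sigma>) \<partial>lborel)"
  proof (rule nn_integral_cong)
    fix u :: real
    show "(\<integral>\<^sup>+y. ennreal (heat v (x - y)) * (subord_potential s u \<sigma> y * indicator {0<..} u) \<partial>lborel) =
      ennreal (u powr (?g - 1)) * (\<integral>\<^sup>+t. ennreal (c * heat (u + v) (x - t)) \<partial>\<sigma>) * indicator {0<..} u"
    proof (cases "u > 0")
      case True
      have "(\<integral>\<^sup>+y. ennreal (heat v (x - y)) * (subord_potential s u \<sigma> y * indicator {0<..} u) \<partial>lborel) =
        (\<integral>\<^sup>+y. \<integral>\<^sup>+t. ennreal (heat v (x - y)) * ennreal (subord s u (y - t)) \<partial>\<sigma> \<partial>lborel)"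
        using True by (simp add: subord_potential_def nn_integral_cmult)
      also have "\<dots> = (\<integral>\<^sup>+t. \<integral>\<^sup>+y. ennreal (heat v (x - y)) * ennreal (subord s u (y - t)) \<partial>lborel \<partial>\<sigma>)"
        by (rule pair.Fubini'[symmetric]) measurable
      also have "\<dots> = (\<integral>\<^sup>+t. ennreal (u powr (?g - 1)) * ennreal (c * heat (u + v) (x - t)) \<partial>\<sigma>)"
      proof (rule nn_integral_cong)
        fix t
        have "(\<integral>\<^sup>+y. ennreal (heat v (x - y)) * ennreal (subord s u (y - t)) \<partial>lborel) =
          (\<integral>\<^sup>+y. ennreal (c * u powr (?g - 1)) * (ennreal (heat v (x - y)) * ennreal (heat u (y - t))) \<partial>lborel)"
          using True c by (intro nn_integral_cong) (simp add: sh heat_nonneg mult_ac flip: ennreal_mult)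
        also have "\<dots> = ennreal (c * u powr (?g - 1)) * ennreal (heat (u + v) (x - t))"
          using True v by (subst nn_integral_cmult) (simp_all add: heat_semigroup)
        also have "\<dots> = ennreal (u powr (?g - 1)) * ennreal (c * heat (u + v) (x - t))"
          using c by (simp add: heat_nonneg mult_ac flip: ennreal_mult)
        finally show "(\<integral>\<^sup>+y. ennreal (heat v (x - y)) * ennreal (subord s u (y - t)) \<partial>lborel) =
          ennreal (u powr (?g - 1)) * ennreal (c * heat (u + v) (x - t))" .
      qed
      also have "\<dots> = ennreal (u powr (?g - 1)) * (\<integral>\<^sup>+t. ennreal (c * heat (u + v) (x - t)) \<partial>\<sigma>)"
        by (rule nn_integral_cmult) measurable
      finally show ?thesis using True by simp
    qed (simp add: indicator_def)
  qed
  finally show ?thesis by (simp only: c_def)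
qed

lemma sweep_riesz_potential:
  assumes r: "r > 0"
  shows "sweep s r (riesz_potential s \<sigma>) x = (\<integral>\<^sup>+w\<in>{r<..}. subord_potential s w \<sigma> x \<partial>lborel)"
proof -
  let ?g = "(real DIM('a) - s) / 2"
  define c where "c = pi powr (real DIM('a) / 2) / riesz_const s"
  have c: "c \<ge> 0" using riesz_const(2)[OF s_pos] by (simp add: c_def)
  have sh: "subord s u z = c * (u powr (?g - 1) * heat u z)" if "u > 0" for u and z :: 'a
    using subord_heat[OF that, of s z] by (simp add: c_def)
  have g: "0 < ?g" "?g < 1" using s_gt s_less by auto
  define \<phi> where "\<phi> w = (\<integral>\<^sup>+t. ennreal (c * heat w (x - t)) \<partial>\<sigma>)" for w
  have [measurable]: "\<phi> \<in> borel_measurable borel" unfolding \<phi>_def by measurable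
  have "sweep s r (riesz_potential s \<sigma>) x = (\<integral>\<^sup>+v\<in>{r<..}. ennreal (passage ?g r v) *
      (\<integral>\<^sup>+u\<in>{0<..}. ennreal (u powr (?g - 1)) * \<phi> (u + v) \<partial>lborel) \<partial>lborel)"
    unfolding sweep_def \<phi>_def using r
    by (intro nn_integral_cong) (auto split: split_indicator simp: heat_riesz_potential c_def)
  also have "\<dots> = (\<integral>\<^sup>+w\<in>{r<..}. ennreal (w powr (?g - 1)) * \<phi> w \<partial>lborel)"
    using g r by (intro passage_conv) measurable
  also have "\<dots> = (\<integral>\<^sup>+w\<in>{r<..}. subord_potential s w \<sigma> x \<partial>lborel)"
  proof (intro nn_integral_cong)
    fix w :: real
    have "ennreal (w powr (?g - 1)) * \<phi> w = subord_potential s w \<sigma> x" if "w > r"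
    proof -
      have "ennreal (w powr (?g - 1)) * \<phi> w = (\<integral>\<^sup>+t. ennreal (w powr (?g - 1)) * ennreal (c * heat w (x - t)) \<partial>\<sigma>)"
        unfolding \<phi>_def by (rule nn_integral_cmult[symmetric]) measurable
      also have "\<dots> = subord_potential s w \<sigma> x"
        unfolding subord_potential_def using that r c
        by (intro nn_integral_cong) (simp add: sh heat_nonneg mult_ac flip: ennreal_mult)
      finally show ?thesis .
    qed
    then show "ennreal (w powr (?g - 1)) * \<phi> w * indicator {r<..} w = subord_potential s w \<sigma> x * indicator {r<..} w"
      by (auto split: split_indicator)
  qed
  finally show ?thesis .
qed

text \<open>A sum rather than a difference, since both parts may be infinite; the swept part is
  cancelled later only at points where it is finite.\<close>

lemma riesz_potential_decomp:
  assumes r: "r > 0"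
  shows "riesz_potential s \<sigma> x = sweep s r (riesz_potential s \<sigma>) x + near_potential s r \<sigma> x"
proof -
  have "riesz_potential s \<sigma> x = (\<integral>\<^sup>+u. subord_potential s u \<sigma> x * indicator {r<..} u
       + subord_potential s u \<sigma> x * indicator {0<..r} u \<partial>lborel)"
    unfolding riesz_potential_eq using r by (intro nn_integral_cong) (auto split: split_indicator)
  then show ?thesis
    by (simp add: nn_integral_add sweep_riesz_potential[OF r] near_potential_def)
qed

lemma sweep_riesz_potential_le: "r > 0 \<Longrightarrow> sweep s r (riesz_potential s \<sigma>) x \<le> riesz_potential s \<sigma> x"
  unfolding le_iff_add using riesz_potential_decomp by blast

lemma near_potential_le: "near_potential s r \<sigma> x \<le> riesz_potential s \<sigma> x"
  unfolding near_potential_def riesz_potential_eq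
  by (intro nn_integral_mono) (auto split: split_indicator)

end

section \<open>Near potentials: scaling, distant sources, continuity\<close>

text \<open>The contradiction of rates shared by \<open>no_positive_excess_off_support\<close> and
  \<open>small_ball_comparison\<close>; there \<open>g = (d - s) / 2\<close>, and
  \<open>g < 1\<close> amounts to \<open>s > d - 2\<close>.\<close>

lemma powr_not_le_linear:
  fixes a D g r0 :: real
  assumes "a > 0" "D \<ge> 0" "g < 1" "r0 > 0"
  obtains r where "0 < r" "r \<le> r0" "D * r < a * r powr g"
proof -
  \<comment> \<open>The intended value of \<open>r powr (1 - g)\<close>: the first entry forces
    \<open>D * b < a\<close>, the second \<open>r \<le> r0\<close>.\<close>
  define b where "b = min (a / (D + 1)) (r0 powr (1 - g))"
  have b: "b > 0" using assms by (simp add: b_def)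
  have "D * b < a"
  proof -
    have "D * b \<le> D * (a / (D + 1))" using assms by (intro mult_left_mono) (simp_all add: b_def)
    also have "\<dots> < a" using assms by (simp add: field_simps)
    finally show ?thesis .
  qed
  define r where "r = b powr (1 / (1 - g))"
  have r: "r > 0" using b by (simp add: r_def)
  have rb: "r powr (1 - g) = b" using b assms by (simp add: r_def powr_powr)
  have "r \<le> (r0 powr (1 - g)) powr (1 / (1 - g))"
    unfolding r_def using assms b by (intro powr_mono2) (auto simp: b_def)
  also have "\<dots> = r0" using assms by (simp add: powr_powr)
  finally have "r \<le> r0" .
  have "r = r powr (1 - g) * r powr g" using r by (simp flip: powr_add)
  then have "D * r = (D * b) * r powr g" unfolding rb mult.assoc by (rule arg_cong)
  also have "\<dots> < a * r powr g" using \<open>D * b < a\<close> r by simp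
  finally have "D * r < a * r powr g" .
  with r \<open>r \<le> r0\<close> show thesis by (rule that)
qed

text \<open>Doubling the distance is compensated in the exponent by quadrupling \<open>u\<close>;
  the constant only restores the power of \<open>u\<close>.\<close>

lemma subord_doubling:
  assumes "s > 0" "u > 0" and "norm z' \<le> 2 * norm z"
  shows "subord s u (z::'a::euclidean_space) \<le> 4 powr (s/2+1) * subord s (4 * u) (z'::'a)"
proof -
  have "(norm z')\<^sup>2 \<le> (2 * norm z)\<^sup>2" using assms by (intro power_mono) auto
  then have "exp (- (norm z)\<^sup>2 / u) \<le> exp (- (norm z')\<^sup>2 / (4 * u))"
    using assms by (simp add: power_mult_distrib field_simps)
  moreover have "4 powr (s/2+1) * (4 * u) powr (-s/2-1) = u powr (-s/2-1)"
  proof -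
    have "4 powr (s/2+1) * 4 powr (-s/2-1) = (1::real)" by (simp flip: powr_add)
    then show ?thesis using assms by (simp add: powr_mult flip: mult.assoc)
  qed
  ultimately have "u powr (-s/2-1) * exp (- (norm z)\<^sup>2 / u) \<le>
      (4 powr (s/2+1) * (4 * u) powr (-s/2-1)) * exp (- (norm z')\<^sup>2 / (4 * u))"
    by (simp add: mult_left_mono)
  then show ?thesis using riesz_const(2)[OF assms(1)] by (simp add: subord_def divide_right_mono mult.assoc)
qed

context riesz_measure
begin

lemma near_potential_doubling:
  assumes AE: "AE t in \<sigma>. norm (x' - t) \<le> 2 * norm (x - t)"
  shows "near_potential s r \<sigma> x \<le> ennreal (4 powr (s/2)) * near_potential s (4 * r) \<sigma> x'"
proof -
  have "subord_potential s u \<sigma> x \<le> ennreal (4 powr (s/2+1)) * subord_potential s (4 * u) \<sigma> x'" if "u > 0" for u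
  proof -
    have "subord_potential s u \<sigma> x \<le> (\<integral>\<^sup>+t. ennreal (4 powr (s/2+1)) * ennreal (subord s (4 * u) (x' - t)) \<partial>\<sigma>)"
      unfolding subord_potential_def using AE
      by (intro nn_integral_mono_AE, eventually_elim)
        (use subord_doubling[OF s_pos that] in \<open>auto intro!: ennreal_leI simp flip: ennreal_mult'\<close>)
    also have "\<dots> = ennreal (4 powr (s/2+1)) * subord_potential s (4 * u) \<sigma> x'"
      unfolding subord_potential_def by (rule nn_integral_cmult) measurable
    finally show ?thesis .
  qed
  then have "near_potential s r \<sigma> x \<le>
      (\<integral>\<^sup>+u. ennreal (4 powr (s/2+1)) * (subord_potential s (4 * u) \<sigma> x' * indicator {0<..r} u) \<partial>lborel)"
    unfolding near_potential_def by (intro nn_integral_mono) (auto split: split_indicator)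
  also have "\<dots> = ennreal (4 powr (s/2+1)) * (\<integral>\<^sup>+u. subord_potential s (4 * u) \<sigma> x' * indicator {0<..r} u \<partial>lborel)"
    by (rule nn_integral_cmult) measurable
  \<comment> \<open>One factor 4 is split off as the Jacobian of the substitution that turns
    \<open>4 * u\<close> into \<open>u\<close>.\<close>
  also have "ennreal (4 powr (s/2+1)) = ennreal (4 powr (s/2)) * ennreal 4"
    by (subst ennreal_mult[symmetric]) (simp_all add: powr_add)
  also have "ennreal (4 powr (s/2)) * ennreal 4 * (\<integral>\<^sup>+u. subord_potential s (4 * u) \<sigma> x' * indicator {0<..r} u \<partial>lborel) =
     ennreal (4 powr (s/2)) * near_potential s (4 * r) \<sigma> x'"
  proof -
    have "near_potential s (4 * r) \<sigma> x' =
      ennreal \<bar>4\<bar> * (\<integral>\<^sup>+u. subord_potential s (0 + 4 * u) \<sigma> x' * indicator {0<..4 * r} (0 + 4 * u) \<partial>lborel)"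
      unfolding near_potential_def by (rule nn_integral_real_affine) auto
    also have "(\<lambda>u. indicator {0<..4 * r} (0 + 4 * u) :: ennreal) = indicator {0<..r}"
      by (auto simp: fun_eq_iff indicator_def)
    then have "(\<integral>\<^sup>+u. subord_potential s (0 + 4 * u) \<sigma> x' * indicator {0<..4 * r} (0 + 4 * u) \<partial>lborel) =
      (\<integral>\<^sup>+u. subord_potential s (4 * u) \<sigma> x' * indicator {0<..r} u \<partial>lborel)"
      by (intro nn_integral_cong) (metis add_0)
    finally show ?thesis by (simp add: mult.assoc)
  qed
  finally show ?thesis .
qed

text \<open>Seen from distance \<rho>, every layer is bounded independently of \<open>u\<close> by
  \<open>subord_le\<close>, so integrating over \<open>u \<le> r\<close> costs only a factor
  \<open>r\<close>.\<close>

lemma near_potential_le_off_support: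
  assumes "\<rho> > 0" "AE t in \<sigma>. \<rho> \<le> norm (x - t)" "emeasure \<sigma> (space \<sigma>) < \<infinity>"
  obtains D where "D \<ge> 0" "\<And>r. r > 0 \<Longrightarrow> near_potential s r \<sigma> x \<le> ennreal (D * r)"
proof -
  obtain M where M: "M > 0" "\<And>u (z::'a) \<rho>. u > 0 \<Longrightarrow> \<rho> > 0 \<Longrightarrow> \<rho> \<le> norm z \<Longrightarrow> subord s u z \<le> M * \<rho> powr (-s-2)"
    using subord_le[OF s_pos] by metis
  define D where "D = M * \<rho> powr (-s-2) * enn2real (emeasure \<sigma> (space \<sigma>))"
  have "near_potential s r \<sigma> x \<le> ennreal (D * r)" if r: "r > 0" for r
  proof -
    have "subord_potential s u \<sigma> x \<le> ennreal D" if "u > 0" for u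
    proof -
      have "subord_potential s u \<sigma> x \<le> (\<integral>\<^sup>+t. ennreal (M * \<rho> powr (-s-2)) \<partial>\<sigma>)"
        unfolding subord_potential_def using assms(2) M(2)[OF that \<open>\<rho> > 0\<close>]
        by (intro nn_integral_mono_AE) (auto intro!: ennreal_leI)
      also have "\<dots> = ennreal D"
        using assms(3) M(1) by (simp add: D_def ennreal_mult)
      finally show ?thesis .
    qed
    then have "near_potential s r \<sigma> x \<le> (\<integral>\<^sup>+u. ennreal D * indicator {0<..r} u \<partial>lborel)"
      unfolding near_potential_def by (intro nn_integral_mono) (auto split: split_indicator)
    also have "\<dots> = ennreal (D * r)" using r M(1) by (simp add: nn_integral_cmult_indicator D_def flip: ennreal_mult)
    finally show ?thesis .
  qed
  then show thesis using M(1) by (intro that[of D]) (auto simp: D_def)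
qed

lemma subord_tendsto:
  assumes "X \<longlonglongrightarrow> x"
  shows "(\<lambda>n. ennreal (subord s u (X n - t))) \<longlonglongrightarrow> ennreal (subord s u (x - t))"
proof (cases "u = 0")
  case False
  then show ?thesis using riesz_const(2)[OF s_pos]
    unfolding subord_def by (intro tendsto_intros assms) auto
qed (simp add: subord_def)

text \<open>Fatou's lemma in \<open>t\<close> and then in \<open>u\<close>; unlike the kernel
  itself, each Gaussian layer is continuous and finite.\<close>

lemma riesz_potential_lsc:
  assumes X: "X \<longlonglongrightarrow> x"
  shows "riesz_potential s \<sigma> x \<le> liminf (\<lambda>n. riesz_potential s \<sigma> (X n))"
proof -
  have *: "subord_potential s u \<sigma> x \<le> liminf (\<lambda>n. subord_potential s u \<sigma> (X n))" for u
  proof -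
    have "subord_potential s u \<sigma> x = (\<integral>\<^sup>+t. liminf (\<lambda>n. ennreal (subord s u (X n - t))) \<partial>\<sigma>)"
      unfolding subord_potential_def
      by (intro nn_integral_cong lim_imp_Liminf[symmetric] subord_tendsto X) simp
    also have "\<dots> \<le> liminf (\<lambda>n. subord_potential s u \<sigma> (X n))"
      unfolding subord_potential_def by (rule nn_integral_liminf) measurable
    finally show ?thesis .
  qed
  have "riesz_potential s \<sigma> x \<le> (\<integral>\<^sup>+u. liminf (\<lambda>n. subord_potential s u \<sigma> (X n) * indicator {0<..} u) \<partial>lborel)"
    unfolding riesz_potential_eq using * by (intro nn_integral_mono) (auto split: split_indicator)
  also have "\<dots> \<le> liminf (\<lambda>n. riesz_potential s \<sigma> (X n))"
    unfolding riesz_potential_eq by (rule nn_integral_liminf) measurable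
  finally show ?thesis .
qed

text \<open>Removing the layers \<open>u \<le> r\<close> removes the singularity. The others are
  bounded by \<open>b u\<close> times the total mass, which is integrable beyond \<open>r\<close>
  because \<open>s > 0\<close>, so dominated convergence applies in \<open>t\<close> and in
  \<open>u\<close>.\<close>

lemma sweep_riesz_potential_continuous:
  assumes X: "X \<longlonglongrightarrow> x" and r: "r > 0" and fin: "emeasure \<sigma> (space \<sigma>) < \<infinity>"
  shows "(\<lambda>n. sweep s r (riesz_potential s \<sigma>) (X n)) \<longlonglongrightarrow> sweep s r (riesz_potential s \<sigma>) x"
    and "\<exists>B. \<forall>y. sweep s r (riesz_potential s \<sigma>) y \<le> ennreal B"
proof -
  define b where "b u = u powr (-s/2-1) / riesz_const s" for u
  define m where "m = enn2real (emeasure \<sigma> (space \<sigma>))"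
  have m: "emeasure \<sigma> (space \<sigma>) = ennreal m" using fin by (simp add: m_def)
  note R = riesz_const(2)[OF s_pos]
  have le: "subord s u z \<le> b u" if "u > 0" for u and z :: 'a
    using R that by (auto simp: subord_def b_def intro!: divide_right_mono mult_left_le)
  have [measurable]: "b \<in> borel_measurable borel" unfolding b_def by measurable
  have b0: "b u \<ge> 0" for u using R by (simp add: b_def)
  have sle: "subord_potential s u \<sigma> y \<le> ennreal (b u) * ennreal m" if "u > 0" for u y
  proof -
    have "subord_potential s u \<sigma> y \<le> (\<integral>\<^sup>+t. ennreal (b u) \<partial>\<sigma>)"
      unfolding subord_potential_def using le that by (intro nn_integral_mono ennreal_leI) auto
    then show ?thesis by (simp add: m)
  qed
  have lim: "(\<lambda>n. subord_potential s u \<sigma> (X n)) \<longlonglongrightarrow> subord_potential s u \<sigma> x" if "u > 0" for u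
    unfolding subord_potential_def
  proof (rule nn_integral_dominated_convergence[where w="\<lambda>_. ennreal (b u)"])
    show "(\<integral>\<^sup>+ x. ennreal (b u) \<partial>\<sigma>) < \<infinity>" by (simp add: m ennreal_mult_less_top)
  qed (use le that in \<open>auto intro!: ennreal_leI subord_tendsto X\<close>)
  have bfin: "(\<integral>\<^sup>+u\<in>{r<..}. (ennreal (b u) * ennreal m) \<partial>lborel) < \<infinity>"
  proof -
    have "(\<integral>\<^sup>+u\<in>{r..}. ennreal (u powr (-s/2-1)) \<partial>lborel) < \<infinity>"
      using has_integral_powr_to_inf[of "-s/2-1" r] s_pos r
      by (subst nn_integral_has_integral_lebesgue') auto
    then have "ennreal (m / riesz_const s) * (\<integral>\<^sup>+u\<in>{r..}. ennreal (u powr (-s/2-1)) \<partial>lborel) < \<infinity>"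
      by (auto simp: ennreal_mult_less_top)
    also have "ennreal (m / riesz_const s) * (\<integral>\<^sup>+u\<in>{r..}. ennreal (u powr (-s/2-1)) \<partial>lborel) =
      (\<integral>\<^sup>+u. ennreal (m / riesz_const s) * (ennreal (u powr (-s/2-1)) * indicator {r..} u) \<partial>lborel)"
      by (rule nn_integral_cmult[symmetric]) measurable
    finally show ?thesis
    proof (rule le_less_trans[rotated], intro nn_integral_mono)
      fix u :: real
      have "m \<ge> 0" by (simp add: m_def)
      then show "ennreal (b u) * ennreal m * indicator {r<..} u \<le>
        ennreal (m / riesz_const s) * (ennreal (u powr (-s/2-1)) * indicator {r..} u)"
        using R by (auto simp: b_def mult_ac split: split_indicator simp flip: ennreal_mult)
    qed
  qed
  show "(\<lambda>n. sweep s r (riesz_potential s \<sigma>) (X n)) \<longlonglongrightarrow> sweep s r (riesz_potential s \<sigma>) x"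
    unfolding sweep_riesz_potential[OF r]
  proof (rule nn_integral_dominated_convergence[where w="\<lambda>u. ennreal (b u) * ennreal m * indicator {r<..} u"])
    show "AE u in lborel. (\<lambda>n. subord_potential s u \<sigma> (X n) * indicator {r<..} u) \<longlonglongrightarrow> subord_potential s u \<sigma> x * indicator {r<..} u"
      using r by (auto split: split_indicator intro!: lim)
  qed (use sle r bfin in \<open>auto split: split_indicator\<close>)
  show "\<exists>B. \<forall>y. sweep s r (riesz_potential s \<sigma>) y \<le> ennreal B"
  proof (intro exI allI)
    fix y
    have "sweep s r (riesz_potential s \<sigma>) y \<le> (\<integral>\<^sup>+u\<in>{r<..}. (ennreal (b u) * ennreal m) \<partial>lborel)"
      unfolding sweep_riesz_potential[OF r] using sle r
      by (intro nn_integral_mono) (auto split: split_indicator)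
    then show "sweep s r (riesz_potential s \<sigma>) y \<le> ennreal (enn2real (\<integral>\<^sup>+u\<in>{r<..}. (ennreal (b u) * ennreal m) \<partial>lborel))"
      using bfin by simp
  qed
qed

lemma riesz_potential_small_at_infinity:
  assumes fin: "emeasure \<sigma> (space \<sigma>) < \<infinity>" and R: "AE t in \<sigma>. norm t \<le> R" and e: "e > 0"
  obtains R' where "\<And>x. norm x > R' \<Longrightarrow> riesz_potential s \<sigma> x \<le> ennreal e"
proof -
  define m where "m = enn2real (emeasure \<sigma> (space \<sigma>)) + 1"
  have m: "emeasure \<sigma> (space \<sigma>) \<le> ennreal m" "m > 0" using fin by (simp_all add: m_def add_nonneg_pos)
  \<comment> \<open>The distance at which mass \<open>m\<close> has potential exactly
    \<open>e\<close>; the 1 added in \<open>m\<close> keeps it positive for the zero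
    measure.\<close>
  define D where "D = (m / e) powr (1/s)"
  have D: "D > 0" using m e by (simp add: D_def)
  have Ds: "D powr (-s) * m = e"
    using m e s_pos by (simp add: D_def powr_powr powr_minus)
  have "riesz_potential s \<sigma> x \<le> ennreal e" if x: "norm x > R + D" for x
  proof -
    have "riesz_potential s \<sigma> x \<le> (\<integral>\<^sup>+t. ennreal (D powr (-s)) \<partial>\<sigma>)"
      unfolding riesz_potential_def using R
    proof (intro nn_integral_mono_AE, eventually_elim)
      fix t :: 'a assume t: "norm t \<le> R"
      then have n: "D \<le> norm (x - t)" using x norm_triangle_ineq2[of x t] by linarith
      then have "norm (x - t) powr (-s) \<le> D powr (-s)" using D s_pos by (intro powr_mono2') auto
      then show "riesz_kernel s x t \<le> ennreal (D powr (-s))" using n D by (auto simp: riesz_kernel_def intro!: ennreal_leI)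
    qed
    also have "\<dots> \<le> ennreal (D powr (-s)) * ennreal m" using m by (simp add: mult_left_mono)
    also have "\<dots> = ennreal e" using m by (simp add: Ds flip: ennreal_mult)
    finally show ?thesis .
  qed
  then show thesis by (rule that)
qed

end

section \<open>The domination principle\<close>

context riesz_measure
begin

text \<open>Uniform smallness spreads from \<open>K\<close> to the whole space: the point of
  \<open>K\<close> nearest to \<open>x\<close> is at most twice as far from any \<open>t\<close> in
  \<open>K\<close> as \<open>x\<close> is, so \<open>near_potential_doubling\<close>
  applies.\<close>

lemma near_potential_uniform:
  assumes K: "compact K" "K \<noteq> {}" and supp: "AE t in \<sigma>. t \<in> K"
    and unif: "\<And>\<tau>. \<tau> > 0 \<Longrightarrow> \<exists>r>0. \<forall>x\<in>K. near_potential s r \<sigma> x \<le> ennreal \<tau>"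
    and \<tau>: "\<tau> > 0"
  shows "\<exists>r>0. \<forall>x. near_potential s r \<sigma> x \<le> ennreal \<tau>"
proof -
  obtain r where r: "r > 0" "\<And>x. x \<in> K \<Longrightarrow> near_potential s r \<sigma> x \<le> ennreal (\<tau> / 4 powr (s/2))"
    using unif[of "\<tau> / 4 powr (s/2)"] \<tau> by auto
  have "near_potential s (r/4) \<sigma> x \<le> ennreal \<tau>" for x
  proof -
    let ?x' = "closest_point K x"
    have "?x' \<in> K" using K by (intro closest_point_in_set) (auto simp: compact_imp_closed)
    have "AE t in \<sigma>. norm (?x' - t) \<le> 2 * norm (x - t)"
      using supp
    proof eventually_elim
      case (elim t)
      have "dist x ?x' \<le> dist x t" using K elim by (intro closest_point_le) (auto simp: compact_imp_closed)
      moreover have "dist ?x' t \<le> dist x ?x' + dist x t" by (simp add: dist_triangle3)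
      ultimately show ?case by (simp add: dist_norm)
    qed
    then have "near_potential s (r/4) \<sigma> x \<le> ennreal (4 powr (s/2)) * near_potential s (4 * (r/4)) \<sigma> ?x'"
      by (rule near_potential_doubling)
    also have "\<dots> \<le> ennreal (4 powr (s/2)) * ennreal (\<tau> / 4 powr (s/2))"
      using r(2)[OF \<open>?x' \<in> K\<close>] by (intro mult_left_mono) simp_all
    also have "\<dots> = ennreal \<tau>" using \<tau> by (subst ennreal_mult[symmetric]) auto
    finally show ?thesis .
  qed
  then show ?thesis using r(1) by (intro exI[of _ "r/4"]) auto
qed

text \<open>The potential is a continuous swept part plus a near part that is uniformly small. This
  gives upper semicontinuity; lower semicontinuity always holds.\<close>

lemma riesz_potential_continuous:
  assumes fin: "emeasure \<sigma> (space \<sigma>) < \<infinity>"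
    and unif: "\<And>\<tau>. \<tau> > 0 \<Longrightarrow> \<exists>r>0. \<forall>x. near_potential s r \<sigma> x \<le> ennreal \<tau>"
  shows "\<exists>B. \<forall>x. riesz_potential s \<sigma> x \<le> ennreal B"
    and "X \<longlonglongrightarrow> x \<Longrightarrow> (\<lambda>n. riesz_potential s \<sigma> (X n)) \<longlonglongrightarrow> riesz_potential s \<sigma> x"
proof -
  obtain r where r: "r > 0" "\<And>x. near_potential s r \<sigma> x \<le> ennreal 1" using unif[of 1] by auto
  obtain B where B: "\<And>y. sweep s r (riesz_potential s \<sigma>) y \<le> ennreal B"
    using sweep_riesz_potential_continuous(2)[OF tendsto_const[of undefined] r(1) fin] by auto
  have bound: "riesz_potential s \<sigma> x \<le> ennreal (max 0 B + 1)" for x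
  proof -
    have "riesz_potential s \<sigma> x \<le> ennreal B + ennreal 1"
      using add_mono[OF B[of x] r(2)[of x]] riesz_potential_decomp[OF r(1), of x] by simp
    also have "ennreal B \<le> ennreal (max 0 B)" by (rule ennreal_leI) simp
    finally show ?thesis by (simp add: add_right_mono)
  qed
  then show "\<exists>B. \<forall>x. riesz_potential s \<sigma> x \<le> ennreal B" by blast
  assume X: "X \<longlonglongrightarrow> x"
  have "limsup (\<lambda>n. riesz_potential s \<sigma> (X n)) \<le> riesz_potential s \<sigma> x"
  proof (rule ennreal_le_epsilon)
    fix e :: real assume e: "e > 0"
    obtain r where r: "r > 0" "\<And>x. near_potential s r \<sigma> x \<le> ennreal e" using unif[OF e] by auto
    have "(\<lambda>n. sweep s r (riesz_potential s \<sigma>) (X n) + ennreal e) \<longlonglongrightarrow> sweep s r (riesz_potential s \<sigma>) x + ennreal e"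
      by (intro tendsto_intros sweep_riesz_potential_continuous X r fin) 
    then have "limsup (\<lambda>n. sweep s r (riesz_potential s \<sigma>) (X n) + ennreal e) = sweep s r (riesz_potential s \<sigma>) x + ennreal e"
      by (intro lim_imp_Limsup) auto
    moreover have "limsup (\<lambda>n. riesz_potential s \<sigma> (X n)) \<le> limsup (\<lambda>n. sweep s r (riesz_potential s \<sigma>) (X n) + ennreal e)"
      using r(2) by (intro Limsup_mono always_eventually allI) (subst riesz_potential_decomp[OF r(1)], simp add: add_left_mono)
    moreover have "sweep s r (riesz_potential s \<sigma>) x + ennreal e \<le> riesz_potential s \<sigma> x + ennreal e"
      using sweep_riesz_potential_le[OF r(1)] by (rule add_right_mono)
    ultimately show "limsup (\<lambda>n. riesz_potential s \<sigma> (X n)) \<le> riesz_potential s \<sigma> x + ennreal e" by (metis order_trans)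
  qed
  moreover note riesz_potential_lsc[OF X]
  moreover have "liminf (\<lambda>n. riesz_potential s \<sigma> (X n)) \<le> limsup (\<lambda>n. riesz_potential s \<sigma> (X n))"
    by (intro Liminf_le_Limsup) simp
  ultimately show "(\<lambda>n. riesz_potential s \<sigma> (X n)) \<longlonglongrightarrow> riesz_potential s \<sigma> x"
    by (intro Liminf_eq_Limsup) (auto intro: antisym order_trans)
qed

end

text \<open>The maximum principle: at a point \<open>x0\<close> off \<open>K\<close> where the excess of the potential of
  \<open>\<kappa>\<close> attains a positive maximum \<open>m\<close>, sweeping to level \<open>r\<close> would lose at least order
  \<open>r powr ((d - s) / 2)\<close> (the mass that it sends far away), but it can only lose the near
  potential of \<open>\<kappa>\<close>, which is of order \<open>r\<close>.\<close>

lemma no_positive_excess_off_support: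
  fixes \<kappa> \<mu> :: "'a::euclidean_space measure" and C m e :: real
  assumes \<kappa>: "riesz_measure \<kappa> s" and \<mu>: "riesz_measure \<mu> s"
    and fin: "emeasure \<kappa> (space \<kappa>) < \<infinity>" and supp: "AE t in \<kappa>. \<rho> \<le> norm (x0 - t)" and \<rho>: "\<rho> > 0"
    and le: "\<And>x. riesz_potential s \<kappa> x \<le> riesz_potential s \<mu> x + (ennreal C + ennreal m)"
    and ge: "riesz_potential s \<mu> x0 + (ennreal C + ennreal m) \<le> riesz_potential s \<kappa> x0"
    and x0: "riesz_potential s \<kappa> x0 < \<infinity>"
    and m: "m > 0" and R: "\<And>x. norm x > R \<Longrightarrow> riesz_potential s \<kappa> x \<le> ennreal (m / 2)"
  shows False
proof -
  interpret \<kappa>: riesz_measure \<kappa> s by (rule \<kappa>)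
  interpret \<mu>: riesz_measure \<mu> s by (rule \<mu>)
  let ?g = "(real DIM('a) - s) / 2"
  define F :: "'a set" where "F = - cball 0 R"
  have F [measurable]: "F \<in> sets borel" unfolding F_def by auto
  have F0: "emeasure lborel F > 0"
  proof (rule ccontr)
    assume "\<not> emeasure lborel F > 0"
    then have "emeasure lborel (F \<union> cball 0 R) \<le> 0 + emeasure lborel (cball (0::'a) R)"
      by (intro order_trans[OF emeasure_subadditive]) (auto simp: not_less)
    moreover have "F \<union> cball 0 R = UNIV" by (auto simp: F_def)
    ultimately show False using emeasure_lborel_cball_finite[of "0::'a" R] by (simp add: emeasure_lborel_UNIV top_unique)
  qed
  obtain c where c: "c > 0" "\<And>r. 0 < r \<Longrightarrow> r \<le> 1 \<Longrightarrow> ennreal (c * r powr ?g) \<le> sweep s r (indicator F) x0"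
    using sweep_indicator_lower[OF \<kappa>.s_gt \<kappa>.s_less F F0, where x=x0] by blast
  obtain D where D: "D \<ge> 0" "\<And>r. r > 0 \<Longrightarrow> near_potential s r \<kappa> x0 \<le> ennreal (D * r)"
    using \<kappa>.near_potential_le_off_support[OF \<rho> supp fin] by blast
  obtain r where r: "0 < r" "r \<le> 1" "D * r < (m / 2 * c) * r powr ?g"
    using powr_not_le_linear[of "m / 2 * c" D ?g 1] m c(1) D(1) \<kappa>.s_gt by auto
  \<comment> \<open>Far out the potential of \<kappa> is at most \<open>m / 2\<close>, so the bound
    with \<open>m\<close> has slack \<open>m / 2\<close> on \<open>F\<close>; sweeping turns this
    slack into the gain.\<close>
  have pw: "riesz_potential s \<kappa> y + ennreal (m / 2) * indicator F y \<le> riesz_potential s \<mu> y + (ennreal C + ennreal m)" for y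
  proof (cases "y \<in> F")
    case True
    then have "riesz_potential s \<kappa> y + ennreal (m / 2) \<le> ennreal (m / 2) + ennreal (m / 2)"
      by (intro add_right_mono R) (simp add: F_def)
    also have "\<dots> = ennreal m" using m by (simp flip: ennreal_plus)
    finally show ?thesis using True by (simp add: add_increasing add_increasing2 add.assoc[symmetric])
  qed (use le[of y] in simp)
  let ?S = "sweep s r (riesz_potential s \<kappa>) x0"
  have "?S + ennreal (m / 2) * sweep s r (indicator F) x0 =
      sweep s r (\<lambda>y. riesz_potential s \<kappa> y + ennreal (m / 2) * indicator F y) x0"
    by (simp add: sweep_add sweep_cmult)
  also have "\<dots> \<le> sweep s r (\<lambda>y. riesz_potential s \<mu> y + (ennreal C + ennreal m)) x0"
    by (intro sweep_mono pw)
  also have "\<dots> = sweep s r (riesz_potential s \<mu>) x0 + (ennreal C + ennreal m)"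
    using \<kappa>.s_gt \<kappa>.s_less r(1) by (simp add: sweep_add sweep_const)
  also have "\<dots> \<le> riesz_potential s \<mu> x0 + (ennreal C + ennreal m)"
    by (intro add_right_mono \<mu>.sweep_riesz_potential_le r)
  also have "\<dots> \<le> ?S + near_potential s r \<kappa> x0"
    using ge \<kappa>.riesz_potential_decomp[OF r(1), of x0] by simp
  finally have "?S + ennreal (m / 2) * sweep s r (indicator F) x0 \<le> ?S + near_potential s r \<kappa> x0" .
  moreover have "?S < \<infinity>" using \<kappa>.sweep_riesz_potential_le[OF r(1), of x0] x0 by (rule le_less_trans)
  ultimately have "ennreal (m / 2) * sweep s r (indicator F) x0 \<le> near_potential s r \<kappa> x0"
    by (auto simp: ennreal_add_left_cancel_le less_top)
  also have "\<dots> \<le> ennreal (D * r)" using D r by auto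
  finally have "ennreal (m / 2) * ennreal (c * r powr ?g) \<le> ennreal (D * r)"
    using mult_left_mono[OF c(2)[OF r(1,2)], of "ennreal (m / 2)"] by (auto intro: order_trans)
  then have "ennreal (m / 2 * c * r powr ?g) \<le> ennreal (D * r)"
    using m c(1) by (simp add: mult_ac flip: ennreal_mult)
  then show False using r D(1) by (simp add: ennreal_le_iff)
qed

text \<open>If the least uniform excess \<open>m\<close> were positive, it would be attained: a
  maximising sequence stays bounded because the potential of \<kappa> is small far out, and in the
  limit the continuity of this potential combines with the lower semicontinuity of that of \<mu>.
  The limit point lies off \<open>K\<close>, where \<open>no_positive_excess_off_support\<close>
  excludes it.\<close>

lemma domination_of_uniform:
  fixes \<kappa> \<mu> :: "'a::euclidean_space measure" and C :: real
  assumes \<kappa>: "riesz_measure \<kappa> s" and \<mu>: "riesz_measure \<mu> s"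
    and fin: "emeasure \<kappa> (space \<kappa>) < \<infinity>" and K: "compact K" and supp: "AE t in \<kappa>. t \<in> K"
    and unif: "\<And>\<tau>. \<tau> > 0 \<Longrightarrow> \<exists>r>0. \<forall>x\<in>K. near_potential s r \<kappa> x \<le> ennreal \<tau>"
    and le: "\<And>x. x \<in> K \<Longrightarrow> riesz_potential s \<kappa> x \<le> riesz_potential s \<mu> x + ennreal C"
    and C: "C \<ge> 0"
  shows "riesz_potential s \<kappa> x \<le> riesz_potential s \<mu> x + ennreal C"
proof (cases "K = {}")
  case True
  then have "riesz_potential s \<kappa> x = (\<integral>\<^sup>+t. 0 \<partial>\<kappa>)"
    unfolding riesz_potential_def using supp by (intro nn_integral_cong_AE) auto
  then show ?thesis by simp
next
  case False
  interpret \<kappa>: riesz_measure \<kappa> s by (rule \<kappa>)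
  interpret \<mu>: riesz_measure \<mu> s by (rule \<mu>)
  let ?q = "riesz_potential s \<kappa>" and ?p = "riesz_potential s \<mu>"
  have unif': "\<exists>r>0. \<forall>x. near_potential s r \<kappa> x \<le> ennreal \<tau>" if "\<tau> > 0" for \<tau>
    using K False supp unif that by (rule \<kappa>.near_potential_uniform)
  obtain B where B: "\<And>x. ?q x \<le> ennreal B"
    using \<kappa>.riesz_potential_continuous(1)[OF fin unif'] by auto
  have qfin: "?q x < \<infinity>" for x using B[of x] by (auto intro: le_less_trans)
  \<comment> \<open>The supremum of the excess is encoded as the infimum of admissible constants,
    which avoids subtracting potentials that may be infinite.\<close>
  define T where "T = {m. 0 \<le> m \<and> (\<forall>x. ?q x \<le> ?p x + (ennreal C + ennreal m))}"
  have "max 0 B \<in> T"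
  proof -
    have "?q x \<le> ?p x + (ennreal C + ennreal (max 0 B))" for x
      using order_trans[OF B ennreal_leI[of B "max 0 B"]] by (simp add: add_increasing)
    then show ?thesis by (simp add: T_def)
  qed
  have bdd: "bdd_below T" by (rule bdd_belowI[of _ 0]) (simp add: T_def)
  define m where "m = Inf T"
  have m0: "m \<ge> 0" unfolding m_def using \<open>max 0 B \<in> T\<close> by (intro cInf_greatest) (blast, simp add: T_def)
  have mT: "?q x \<le> ?p x + (ennreal C + ennreal m)" for x
  proof (rule ennreal_le_epsilon)
    fix e :: real assume "e > 0"
    then obtain m' where m': "m' \<in> T" "m' < m + e"
      using cInf_lessD[of T "m + e"] \<open>max 0 B \<in> T\<close> by (auto simp: m_def)
    have "?q x \<le> ?p x + (ennreal C + ennreal m')" using m'(1) by (simp add: T_def)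
    also have "\<dots> \<le> ?p x + (ennreal C + ennreal (m + e))"
      using m'(2) by (intro add_left_mono ennreal_leI) simp
    finally show "?q x \<le> ?p x + (ennreal C + ennreal m) + ennreal e"
      using m0 \<open>e > 0\<close> by (simp add: add_ac)
  qed
  have "m = 0"
  proof (rule ccontr)
    assume "m \<noteq> 0"
    with m0 have m: "m > 0" by simp
    \<comment> \<open>Increases to \<open>m\<close> while staying at least \<open>m / 2\<close>; the
      lower bound keeps the points \<open>X n\<close> inside the ball of radius
      \<open>R\<close>.\<close>
    define a where "a n = m - m / real (n + 2)" for n
    have a: "m / 2 \<le> a n" "a n < m" for n using m by (auto simp: a_def field_simps)
    have "\<exists>x. ?q x > ?p x + (ennreal C + ennreal (a n))" for n
    proof -
      have "a n \<notin> T" using a(2)[of n] cInf_lower[OF _ bdd, of "a n"] by (auto simp: m_def)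
      then show ?thesis using a(1)[of n] m by (auto simp: T_def not_le)
    qed
    then obtain X where X: "\<And>n. ?q (X n) > ?p (X n) + (ennreal C + ennreal (a n))" by metis
    obtain RK where RK: "\<And>t. t \<in> K \<Longrightarrow> norm t \<le> RK" using compact_imp_bounded[OF K] by (auto simp: bounded_iff)
    have "AE t in \<kappa>. norm t \<le> RK" using supp by eventually_elim (rule RK)
    then obtain R where R: "\<And>x. norm x > R \<Longrightarrow> ?q x \<le> ennreal (m / 2)"
      using \<kappa>.riesz_potential_small_at_infinity[OF fin, of RK "m / 2"] m by auto
    have "X n \<in> cball 0 R" for n
    proof (rule ccontr)
      assume "X n \<notin> cball 0 R"
      then have "?q (X n) \<le> ennreal (m / 2)" by (intro R) simp
      also have "\<dots> \<le> ennreal (a n)" using a(1) by (rule ennreal_leI)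
      also have "\<dots> \<le> ?p (X n) + (ennreal C + ennreal (a n))" by (simp add: add_increasing)
      finally show False using X[of n] by simp
    qed
    then obtain x0 \<phi> where \<phi>: "strict_mono \<phi>" "(X \<circ> \<phi>) \<longlonglongrightarrow> x0"
      using compact_cball[of "0::'a" R] unfolding compact_def by metis
    have "a \<longlonglongrightarrow> m - 0"
      unfolding a_def by (intro tendsto_intros tendsto_divide_0[OF tendsto_const]
        filterlim_at_top_imp_at_infinity filterlim_compose[OF filterlim_real_sequentially]
        filterlim_add_const_nat_at_top)
    then have aphi: "(\<lambda>n. a (\<phi> n)) \<longlonglongrightarrow> m"
      using LIMSEQ_subseq_LIMSEQ[OF _ \<phi>(1), of a m] by (simp add: comp_def)
    have qlim: "(\<lambda>n. ?q (X (\<phi> n))) \<longlonglongrightarrow> ?q x0"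
      using \<kappa>.riesz_potential_continuous(2)[OF fin unif' \<phi>(2)] by (simp add: comp_def)
    \<comment> \<open>Lower semicontinuity bounds the potential of \<mu> along the sequence only by
      numbers \<open>c\<close> strictly below its value at \<open>x0\<close>. The case
      \<open>c = 0\<close> is included separately: it gives
      \<open>ennreal C + ennreal m \<le> ?q x0\<close>, which makes the truncated subtraction in
      \<open>ge\<close> reversible.\<close>
    have low: "c + (ennreal C + ennreal m) \<le> ?q x0" if "c < ?p x0 \<or> c = 0" for c
    proof (rule LIMSEQ_le)
      show "(\<lambda>n. c + (ennreal C + ennreal (a (\<phi> n)))) \<longlonglongrightarrow> c + (ennreal C + ennreal m)"
        by (intro tendsto_intros aphi)
      have "eventually (\<lambda>n. c \<le> ?p (X (\<phi> n))) sequentially"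
      proof (cases "c = 0")
        case False
        then have "c < liminf (\<lambda>n. ?p ((X \<circ> \<phi>) n))"
          using that \<mu>.riesz_potential_lsc[OF \<phi>(2)] by auto
        then show ?thesis using less_LiminfD by (fastforce elim: eventually_mono)
      qed simp
      then show "\<exists>N. \<forall>n\<ge>N. c + (ennreal C + ennreal (a (\<phi> n))) \<le> ?q (X (\<phi> n))"
        unfolding eventually_sequentially
        by (meson X add_right_mono less_imp_le order_trans)
    qed (rule qlim)
    have ge: "?p x0 + (ennreal C + ennreal m) \<le> ?q x0"
    proof -
      have "?p x0 \<le> ?q x0 - (ennreal C + ennreal m)"
      proof (rule dense_le)
        fix c assume "c < ?p x0"
        then have "c + (ennreal C + ennreal m) \<le> ?q x0" by (intro low) simp
        then have "c + (ennreal C + ennreal m) - (ennreal C + ennreal m) \<le> ?q x0 - (ennreal C + ennreal m)"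
          by (intro ennreal_minus_mono) auto
        then show "c \<le> ?q x0 - (ennreal C + ennreal m)" by simp
      qed
      then have "?p x0 + (ennreal C + ennreal m) \<le> ?q x0 - (ennreal C + ennreal m) + (ennreal C + ennreal m)"
        by (rule add_right_mono)
      also have "\<dots> = ?q x0" using low[of 0] by (intro diff_add_cancel_ennreal) simp
      finally show ?thesis .
    qed
    \<comment> \<open>On \<open>K\<close> the excess over \<open>C\<close> is at most 0 by
      \<open>le\<close>, while at \<open>x0\<close> it is at least \<open>m > 0\<close>.\<close>
    have "x0 \<notin> K"
    proof
      assume "x0 \<in> K"
      from order_trans[OF ge le[OF this]] have "?p x0 + (ennreal C + ennreal m) \<le> ?p x0 + ennreal C" .
      moreover have "?p x0 < \<infinity>" using ge qfin[of x0] by (auto simp: top_unique less_top[symmetric])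
      ultimately show False using m C by (simp add: ennreal_add_left_cancel_le flip: ennreal_plus)
    qed
    define \<rho> where "\<rho> = infdist x0 K"
    have \<rho>: "\<rho> > 0" using \<open>x0 \<notin> K\<close> K False infdist_pos_not_in_closed compact_imp_closed
      unfolding \<rho>_def by blast
    have "AE t in \<kappa>. \<rho> \<le> norm (x0 - t)"
      using supp by eventually_elim (simp add: \<rho>_def infdist_le flip: dist_norm)
    then show False
      using no_positive_excess_off_support[OF \<kappa> \<mu> fin _ \<rho> mT ge qfin m R] by blast
  qed
  then show ?thesis using mT[of x] by simp
qed

section \<open>Egorov's theorem and the reduction to compact sets\<close>

text \<open>Inner regularity is applied to a finite measure, so \<sigma> is first cut down to
  \<open>B\<close>; in this form \<sigma> itself may be infinite.\<close>

lemma compact_approximation: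
  fixes \<sigma> :: "'a::euclidean_space measure"
  assumes sets: "sets \<sigma> = sets borel" and B: "B \<in> sets borel" "emeasure \<sigma> B < \<infinity>" and e: "e > (0::real)"
  obtains K where "compact K" "K \<subseteq> B" "emeasure \<sigma> (B - K) \<le> ennreal e"
proof -
  note [measurable_cong] = sets
  note [measurable] = B(1)
  define M where "M = density \<sigma> (indicator B)"
  have M: "emeasure M A = emeasure \<sigma> (B \<inter> A)" if "A \<in> sets borel" for A
    using that B by (simp add: M_def emeasure_density sets nn_integral_indicator flip: indicator_inter_arith)
  have "emeasure M B = (SUP K \<in> {K. K \<subseteq> B \<and> compact K}. emeasure M K)"
  proof (rule inner_regular)
    show "sets M = sets borel" by (simp add: M_def sets)
    show "emeasure M (space M) \<noteq> \<infinity>"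
      using M[of UNIV] B sets_eq_imp_space_eq[OF sets] by (simp add: M_def)
  qed (use B in simp)
  then have sup: "emeasure \<sigma> B = (SUP K \<in> {K. K \<subseteq> B \<and> compact K}. emeasure M K)"
    using B M[of B] by simp
  obtain K where K: "K \<subseteq> B" "compact K" "emeasure \<sigma> B \<le> emeasure M K + ennreal e"
  proof -
    obtain b where b: "emeasure \<sigma> B = ennreal b"
      using B(2) by (cases "emeasure \<sigma> B") auto
    show thesis
    proof (cases "b \<le> e")
      case True
      then show thesis using b by (intro that[of "{}"]) (auto intro: ennreal_leI)
    next
      case False
      with e have "ennreal (b - e) < ennreal b" by (intro ennreal_lessI) auto
      then have "ennreal (b - e) < (SUP K \<in> {K. K \<subseteq> B \<and> compact K}. emeasure M K)"
        unfolding sup[symmetric] b .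
      then obtain K where K: "K \<subseteq> B" "compact K" "ennreal (b - e) < emeasure M K"
        unfolding less_SUP_iff by blast
      have "ennreal b = ennreal (b - e) + ennreal e"
        using False e by (simp flip: ennreal_plus)
      also have "\<dots> \<le> emeasure M K + ennreal e" using K by (intro add_right_mono) auto
      finally show thesis using K b by (intro that[of K]) auto
    qed
  qed
  have Kb [measurable]: "K \<in> sets borel" using K by (auto intro: borel_compact)
  have "emeasure \<sigma> K + emeasure \<sigma> (B - K) = emeasure \<sigma> B"
    using K(1) by (subst plus_emeasure) (auto simp: sets Un_absorb1)
  also have "\<dots> \<le> emeasure \<sigma> K + ennreal e"
    using K M[OF Kb] by (simp add: Int_absorb1)
  finally have "emeasure \<sigma> K + emeasure \<sigma> (B - K) \<le> emeasure \<sigma> K + ennreal e" .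
  moreover have "emeasure \<sigma> K < \<infinity>"
    using emeasure_mono[OF K(1), of \<sigma>] B sets by (auto intro: le_less_trans)
  ultimately have "emeasure \<sigma> (B - K) \<le> ennreal e"
    by (auto simp: ennreal_add_left_cancel_le less_top)
  with K show thesis by (intro that[of K]) auto
qed

text \<open>For a decreasing sequence, smallness at one index persists. The exceptional set
  \<open>E k n\<close> therefore refers to a single index and shrinks to the empty set; the chosen
  sets have measures at most \<open>e * (1/2) ^ Suc k\<close>, which add up to
  \<open>e\<close>.\<close>

lemma egorov_decreasing:
  fixes f :: "nat \<Rightarrow> 'b \<Rightarrow> ennreal" and e :: real
  assumes [measurable]: "\<And>n. f n \<in> borel_measurable M" "A \<in> sets M"
    and fin: "emeasure M A < \<infinity>" and e: "e > 0"
    and dec: "\<And>n x. f (Suc n) x \<le> f n x" and lim: "\<And>x. x \<in> A \<Longrightarrow> (\<lambda>n. f n x) \<longlonglongrightarrow> 0"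
  obtains B where "B \<in> sets M" "B \<subseteq> A" "emeasure M (A - B) \<le> ennreal e"
    "\<And>\<tau>. \<tau> > (0::real) \<Longrightarrow> \<exists>n. \<forall>x\<in>B. f n x \<le> ennreal \<tau>"
proof -
  define E where "E k n = {x \<in> space M. x \<in> A \<and> ennreal (1 / real (Suc k)) < f n x}" for k n
  have [measurable]: "E k n \<in> sets M" for k n unfolding E_def by measurable
  have A: "A \<subseteq> space M" by (rule sets.sets_into_space) measurable
  have EA: "E k n \<subseteq> A" for k n by (auto simp: E_def)
  have "\<exists>n. emeasure M (E k n) \<le> ennreal (e * (1/2) ^ Suc k)" for k
  proof -
    have "(\<lambda>n. emeasure M (E k n)) \<longlonglongrightarrow> emeasure M (\<Inter>n. E k n)"
    proof (rule Lim_emeasure_decseq)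
      show "decseq (E k)"
        by (rule decseq_SucI) (use dec in \<open>auto simp: E_def intro: less_le_trans\<close>)
      show "emeasure M (E k n) \<noteq> \<infinity>" for n
        using le_less_trans[OF emeasure_mono[OF EA] fin, of k n] by auto
    qed auto
    moreover have "(\<Inter>n. E k n) = {}"
    proof -
      have False if x: "x \<in> (\<Inter>n. E k n)" for x
      proof -
        have "x \<in> A" using x EA by blast
        then have "eventually (\<lambda>n. f n x < ennreal (1 / real (Suc k))) sequentially"
          by (intro order_tendstoD(2)[OF lim]) auto
        then obtain n where "f n x < ennreal (1 / real (Suc k))" by (auto simp: eventually_sequentially)
        moreover have "x \<in> E k n" using x by blast
        ultimately show False by (auto simp: E_def)
      qed
      then show ?thesis by blast
    qed
    ultimately have "(\<lambda>n. emeasure M (E k n)) \<longlonglongrightarrow> 0" by simp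
    then have "eventually (\<lambda>n. emeasure M (E k n) < ennreal (e * (1/2) ^ Suc k)) sequentially"
      by (rule order_tendstoD(2)) (use e in simp)
    then show ?thesis by (auto simp: eventually_sequentially intro: less_imp_le)
  qed
  then obtain N where N: "\<And>k. emeasure M (E k (N k)) \<le> ennreal (e * (1/2) ^ Suc k)" by metis
  define B where "B = A - (\<Union>k. E k (N k))"
  have "emeasure M (A - B) \<le> emeasure M (\<Union>k. E k (N k))"
    by (intro emeasure_mono) (auto simp: B_def)
  also have "\<dots> \<le> (\<Sum>k. emeasure M (E k (N k)))"
    by (rule emeasure_subadditive_countably) auto
  also have "\<dots> \<le> (\<Sum>k. ennreal (e * (1/2) ^ Suc k))"
    using N by (intro suminf_le) auto
  also have "\<dots> = ennreal (e * 1)"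
    using e by (intro suminf_ennreal_eq sums_mult power_half_series) auto
  finally have "emeasure M (A - B) \<le> ennreal e" by simp
  moreover have "\<exists>n. \<forall>x\<in>B. f n x \<le> ennreal \<tau>" if \<tau>: "\<tau> > 0" for \<tau> :: real
  proof -
    obtain k where k: "1 / real (Suc k) < \<tau>" using reals_Archimedean[OF \<tau>] by (auto simp: inverse_eq_divide)
    have "f (N k) x \<le> ennreal \<tau>" if "x \<in> B" for x
    proof -
      have "x \<notin> E k (N k)" "x \<in> A" using that by (auto simp: B_def)
      then have "f (N k) x \<le> ennreal (1 / real (Suc k))" using A by (auto simp: E_def not_less)
      also have "\<dots> \<le> ennreal \<tau>" using k by (intro ennreal_leI) simp
      finally show ?thesis .
    qed
    then show ?thesis by blast
  qed
  moreover have "B \<in> sets M" "B \<subseteq> A" by (auto simp: B_def)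
  ultimately show thesis using that by blast
qed

context riesz_measure
begin

lemma near_potential_tendsto_zero:
  assumes "riesz_potential s \<sigma> x < \<infinity>"
  shows "(\<lambda>n. near_potential s (1 / real (Suc n)) \<sigma> x) \<longlonglongrightarrow> 0"
proof -
  have "(\<lambda>n. near_potential s (1 / real (Suc n)) \<sigma> x) \<longlonglongrightarrow> (\<integral>\<^sup>+u. 0 \<partial>(lborel :: real measure))"
    unfolding near_potential_def
  proof (rule nn_integral_dominated_convergence[where w="\<lambda>u. subord_potential s u \<sigma> x * indicator {0<..} u"])
    show "(\<integral>\<^sup>+u\<in>{0<..}. subord_potential s u \<sigma> x \<partial>lborel) < \<infinity>"
      using assms by (simp add: riesz_potential_eq)
    have "(\<lambda>n. subord_potential s u \<sigma> x * indicator {0<..1 / real (Suc n)} u) \<longlonglongrightarrow> 0" for u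
    proof (rule tendsto_eventually)
      show "\<forall>\<^sub>F n in sequentially. subord_potential s u \<sigma> x * indicator {0<..1 / real (Suc n)} u = 0"
      proof (cases "u > 0")
        case True
        then obtain N where "1 / real (Suc N) < u" using reals_Archimedean[OF True] by (auto simp: inverse_eq_divide)
        then have "\<not> u \<le> 1 / real (Suc n)" if "n \<ge> N" for n
          using that by (simp add: not_le) (rule le_less_trans, auto intro!: divide_left_mono)
        then show ?thesis unfolding eventually_sequentially by (intro exI[of _ N]) (auto simp: indicator_def)
      qed (auto simp: indicator_def)
    qed
    then show "AE u in lborel. (\<lambda>n. subord_potential s u \<sigma> x * indicator {0<..1 / real (Suc n)} u) \<longlonglongrightarrow> 0"
      by simp
  qed (auto split: split_indicator)
  then show ?thesis by simp
qed

lemma near_potential_mono: "r \<le> r' \<Longrightarrow> near_potential s r \<sigma> x \<le> near_potential s r' \<sigma> x"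
  unfolding near_potential_def by (intro nn_integral_mono) (auto split: split_indicator)

lemma restrict:
  assumes [measurable]: "K \<in> sets borel" and fin: "emeasure \<sigma> K < \<infinity>"
  defines "\<kappa> \<equiv> density \<sigma> (indicator K)"
  shows "riesz_measure \<kappa> s" "emeasure \<kappa> (space \<kappa>) < \<infinity>" "AE t in \<kappa>. t \<in> K"
    and "riesz_potential s \<kappa> x = (\<integral>\<^sup>+t. riesz_kernel s x t * indicator K t \<partial>\<sigma>)"
    and "near_potential s r \<kappa> x \<le> near_potential s r \<sigma> x"
proof -
  have K: "emeasure \<kappa> (space \<kappa>) = emeasure \<sigma> K"
    using sets_eq_imp_space_eq[OF sets_eq]
    by (simp add: \<kappa>_def emeasure_density cong: nn_integral_cong)
  then show f: "emeasure \<kappa> (space \<kappa>) < \<infinity>" using fin by simp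
  then interpret \<kappa>: finite_measure \<kappa> by (intro finite_measureI) auto
  show "riesz_measure \<kappa> s"
    using s_pos s_gt s_less sets_eq by unfold_locales (simp_all add: \<kappa>_def)
  show "AE t in \<kappa>. t \<in> K" unfolding \<kappa>_def by (subst AE_density) (auto split: split_indicator)
  show "riesz_potential s \<kappa> x = (\<integral>\<^sup>+t. riesz_kernel s x t * indicator K t \<partial>\<sigma>)"
    unfolding riesz_potential_def \<kappa>_def by (subst nn_integral_density) (simp_all add: mult.commute)
  have "subord_potential s u \<kappa> x \<le> subord_potential s u \<sigma> x" for u
    unfolding subord_potential_def \<kappa>_def
    by (subst nn_integral_density) (auto intro!: nn_integral_mono split: split_indicator)
  then show "near_potential s r \<kappa> x \<le> near_potential s r \<sigma> x"
    unfolding near_potential_def by (intro nn_integral_mono mult_right_mono) auto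
qed

end

theorem riesz_domination:
  fixes \<nu> \<mu> :: "'a::euclidean_space measure" and C :: real
  assumes \<nu>: "riesz_measure \<nu> s" and \<mu>: "riesz_measure \<mu> s"
    and fin: "\<And>K. compact K \<Longrightarrow> emeasure \<nu> K < \<infinity>"
    and fin_pot: "AE x in \<nu>. riesz_potential s \<nu> x < \<infinity>"
    and le: "AE x in \<nu>. riesz_potential s \<nu> x \<le> riesz_potential s \<mu> x + ennreal C"
    and C: "C \<ge> 0"
  shows "riesz_potential s \<nu> x \<le> riesz_potential s \<mu> x + ennreal C"
proof -
  interpret \<nu>: riesz_measure \<nu> s by (rule \<nu>)
  interpret \<mu>: riesz_measure \<mu> s by (rule \<mu>)
  have space: "space \<nu> = UNIV" using sets_eq_imp_space_eq[OF \<nu>.sets_eq] by simp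
  define G where "G = {x. riesz_potential s \<nu> x < \<infinity> \<and> riesz_potential s \<nu> x \<le> riesz_potential s \<mu> x + ennreal C}"
  have [measurable]: "G \<in> sets borel" unfolding G_def by measurable
  have AE_G: "AE x in \<nu>. x \<in> G" using fin_pot le by eventually_elim (simp add: G_def)
  define f where "f n x = near_potential s (1 / real (Suc n)) \<nu> x" for n x
  \<comment> \<open>On \<open>K\<close> the near potentials tend to 0 uniformly, as
    \<open>domination_of_uniform\<close> demands. Half of the lost mass is due to Egorov, half to
    inner regularity.\<close>
  have "\<exists>K. compact K \<and> K \<subseteq> G \<and> emeasure \<nu> (G \<inter> cball 0 (real N) - K) \<le> ennreal ((1/2) ^ N) \<and>
     (\<forall>\<tau>>0. \<exists>n. \<forall>x\<in>K. f n x \<le> ennreal \<tau>)" for N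
  proof -
    let ?A = "G \<inter> cball 0 (real N)" and ?e = "(1/2) ^ Suc N :: real"
    have A [measurable]: "?A \<in> sets \<nu>" by (simp add: \<nu>.sets_eq)
    have Afin: "emeasure \<nu> ?A < \<infinity>"
      using fin[of "cball 0 (real N)"] by (rule le_less_trans[OF emeasure_mono, rotated 2]) (auto simp: \<nu>.sets_eq)
    obtain B where B: "B \<in> sets \<nu>" "B \<subseteq> ?A" "emeasure \<nu> (?A - B) \<le> ennreal ?e"
        and unif: "\<And>\<tau>. \<tau> > (0::real) \<Longrightarrow> \<exists>n. \<forall>x\<in>B. f n x \<le> ennreal \<tau>"
    proof (rule egorov_decreasing[of f \<nu> ?A ?e])
      show "f (Suc n) x \<le> f n x" for n x unfolding f_def
        by (intro \<nu>.near_potential_mono) (auto intro!: divide_left_mono)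
      show "(\<lambda>n. f n x) \<longlonglongrightarrow> 0" if "x \<in> ?A" for x unfolding f_def
        using that by (intro \<nu>.near_potential_tendsto_zero) (simp add: G_def)
      show "f n \<in> borel_measurable \<nu>" for n unfolding f_def by measurable
    qed (use A Afin in auto)
    have Bb: "B \<in> sets borel" using B \<nu>.sets_eq by simp
    obtain K where K: "compact K" "K \<subseteq> B" "emeasure \<nu> (B - K) \<le> ennreal ?e"
    proof (rule compact_approximation[OF \<nu>.sets_eq Bb])
      show "emeasure \<nu> B < \<infinity>" using emeasure_mono[OF B(2) A] Afin by (rule le_less_trans)
    qed auto
    have Kb: "K \<in> sets borel" using K by (auto intro: borel_compact)
    have "emeasure \<nu> (?A - K) \<le> emeasure \<nu> ((?A - B) \<union> (B - K))"
      using A Bb Kb by (intro emeasure_mono) (auto simp: \<nu>.sets_eq)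
    also have "\<dots> \<le> emeasure \<nu> (?A - B) + emeasure \<nu> (B - K)"
      using A Bb Kb by (intro emeasure_subadditive) (auto simp: \<nu>.sets_eq)
    also have "\<dots> \<le> ennreal ?e + ennreal ?e" by (intro add_mono B K)
    also have "\<dots> = ennreal ((1/2) ^ N)" by (subst ennreal_plus[symmetric]) auto
    finally have "emeasure \<nu> (?A - K) \<le> ennreal ((1/2) ^ N)" .
    moreover have "\<forall>\<tau>>0. \<exists>n. \<forall>x\<in>K. f n x \<le> ennreal \<tau>" using unif K(2) by blast
    ultimately show ?thesis using K B by (intro exI[of _ K]) auto
  qed
  then obtain K where K: "\<And>N. compact (K N)" "\<And>N. K N \<subseteq> G"
      "\<And>N. emeasure \<nu> (G \<inter> cball 0 (real N) - K N) \<le> ennreal ((1/2) ^ N)"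
      "\<And>N \<tau>. \<tau> > 0 \<Longrightarrow> \<exists>n. \<forall>x\<in>K N. f n x \<le> ennreal \<tau>" by metis
  have Kb [measurable]: "K N \<in> sets borel" for N using K(1) by (auto intro: borel_compact)
  \<comment> \<open>The sets \<open>K N\<close> need not increase. Their finite unions do, as
    monotone convergence requires, and uniform smallness survives finite unions.\<close>
  define L where "L N = (\<Union>i\<le>N. K i)" for N
  have Lc: "compact (L N)" for N unfolding L_def using K(1) by (intro compact_UN) auto
  have Lb [measurable]: "L N \<in> sets borel" for N unfolding L_def by measurable
  have Lu: "\<exists>r>0. \<forall>x\<in>L N. near_potential s r \<nu> x \<le> ennreal \<tau>" if tau: "\<tau> > 0" for N \<tau>
  proof (induction N)
    case 0
    obtain n where "\<And>x. x \<in> K 0 \<Longrightarrow> near_potential s (1 / real (Suc n)) \<nu> x \<le> ennreal \<tau>"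
      using K(4)[OF tau, of 0] unfolding f_def by blast
    then show ?case by (intro exI[of _ "1 / real (Suc n)"]) (simp add: L_def)
  next
    case (Suc N)
    then obtain r where r: "r > 0" "\<And>x. x \<in> L N \<Longrightarrow> near_potential s r \<nu> x \<le> ennreal \<tau>" by blast
    obtain n where n: "\<And>x. x \<in> K (Suc N) \<Longrightarrow> near_potential s (1 / real (Suc n)) \<nu> x \<le> ennreal \<tau>"
      using K(4)[OF tau, of "Suc N"] unfolding f_def by blast
    show ?case
    proof (intro exI conjI ballI)
      show "min r (1 / real (Suc n)) > 0" using r by simp
      fix x assume "x \<in> L (Suc N)"
      moreover have "L (Suc N) = K (Suc N) \<union> L N" by (simp add: L_def atMost_Suc)
      ultimately have "x \<in> L N \<or> x \<in> K (Suc N)" by blast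
      then show "near_potential s (min r (1 / real (Suc n))) \<nu> x \<le> ennreal \<tau>"
        using r(2)[of x] n[of x] \<nu>.near_potential_mono[of "min r (1 / real (Suc n))" r x]
          \<nu>.near_potential_mono[of "min r (1 / real (Suc n))" "1 / real (Suc n)" x]
        by (meson min.cobounded1 min.cobounded2 order_trans)
    qed
  qed
  have dom: "(\<integral>\<^sup>+t. riesz_kernel s x t * indicator (L N) t \<partial>\<nu>) \<le> riesz_potential s \<mu> x + ennreal C" for N
  proof -
    define \<kappa> where "\<kappa> = density \<nu> (indicator (L N))"
    note r = \<nu>.restrict[OF Lb[of N] fin[OF Lc[of N]], folded \<kappa>_def]
    have le_\<nu>: "riesz_potential s \<kappa> y \<le> riesz_potential s \<nu> y" for y
      unfolding r(4) unfolding riesz_potential_def by (intro nn_integral_mono) (auto split: split_indicator)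
    have "riesz_potential s \<kappa> x \<le> riesz_potential s \<mu> x + ennreal C"
    proof (rule domination_of_uniform[OF r(1) \<mu> r(2) Lc r(3) _ _ C])
      show "\<exists>r>0. \<forall>y\<in>L N. near_potential s r \<kappa> y \<le> ennreal \<tau>" if "\<tau> > 0" for \<tau>
        using Lu[OF that, of N] r(5) by (meson order_trans)
      show "riesz_potential s \<kappa> y \<le> riesz_potential s \<mu> y + ennreal C" if "y \<in> L N" for y
      proof -
        have "y \<in> G" using that K(2) by (auto simp: L_def)
        then show ?thesis using le_\<nu>[of y] by (auto simp: G_def intro: order_trans)
      qed
    qed
    then show ?thesis by (simp add: r(4))
  qed
  \<comment> \<open>For every \<open>N \<ge> M\<close> the uncovered part of the ball lies in what
    \<open>K N\<close> leaves out, of mass at most \<open>(1/2) ^ N\<close>.\<close>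
  have null: "emeasure \<nu> (G \<inter> cball 0 (real M) - (\<Union>N. K N)) = 0" for M
  proof -
    have "emeasure \<nu> (G \<inter> cball 0 (real M) - (\<Union>N. K N)) \<le> ennreal ((1/2) ^ N)" if "N \<ge> M" for N
      using that by (intro order_trans[OF emeasure_mono K(3)[of N]]) (auto simp: \<nu>.sets_eq)
    then have "emeasure \<nu> (G \<inter> cball 0 (real M) - (\<Union>N. K N)) \<le> ennreal 0"
      by (intro LIMSEQ_le_const[of "\<lambda>N. ennreal ((1/2) ^ N)"] tendsto_ennrealI LIMSEQ_power_zero) auto
    then show ?thesis by simp
  qed
  have "AE t in \<nu>. \<forall>M. t \<notin> G \<inter> cball 0 (real M) - (\<Union>N. K N)"
    unfolding AE_all_countable using null
    by (auto intro!: AE_not_in simp: null_sets_def \<nu>.sets_eq simp del: Diff_iff)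
  with AE_G have AE_K: "AE t in \<nu>. t \<in> (\<Union>N. K N)"
  proof eventually_elim
    case (elim t)
    obtain M :: nat where "norm t \<le> real M" using real_arch_simple by blast
    then show ?case using elim by auto
  qed
  have "riesz_potential s \<nu> x = (\<integral>\<^sup>+t. (SUP N. riesz_kernel s x t * indicator (L N) t) \<partial>\<nu>)"
    unfolding riesz_potential_def using AE_K
  proof (intro nn_integral_cong_AE, eventually_elim)
    case (elim t)
    then obtain N where "t \<in> L N" by (auto simp: L_def)
    then have "riesz_kernel s x t \<le> (SUP N. riesz_kernel s x t * indicator (L N) t)"
      by (intro SUP_upper2[of N]) auto
    then show ?case
      by (intro antisym SUP_least) (auto split: split_indicator)
  qed
  also have "\<dots> = (SUP N. \<integral>\<^sup>+t. riesz_kernel s x t * indicator (L N) t \<partial>\<nu>)"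
  proof (rule nn_integral_monotone_convergence_SUP)
    show "incseq (\<lambda>N t. riesz_kernel s x t * indicator (L N) t)"
      by (rule incseq_SucI) (auto simp: le_fun_def L_def split: split_indicator)
  qed measurable
  also have "\<dots> \<le> riesz_potential s \<mu> x + ennreal C" by (intro SUP_least dom)
  finally show ?thesis .
qed

section \<open>Comparison of small balls\<close>

text \<open>Joint in centre and radius: the layer cake integrals vary the radius, the sets of points
  with good balls vary the centre.\<close>

lemma emeasure_ball_measurable:
  fixes M :: "'a::euclidean_space measure"
  assumes "sigma_finite_measure M" and sets: "sets M = sets borel"
    and [measurable]: "f \<in> borel_measurable N" "g \<in> borel_measurable N"
  shows "(\<lambda>x. emeasure M (ball (f x) (g x))) \<in> borel_measurable N"
proof -
  interpret sigma_finite_measure M by fact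
  note [measurable_cong] = sets
  have "emeasure M (ball y \<rho>) = (\<integral>\<^sup>+t. (if dist y t < \<rho> then 1 else 0) \<partial>M)" for y \<rho>
  proof -
    have "(\<lambda>t. if dist y t < \<rho> then 1 else 0 :: ennreal) = indicator (ball y \<rho>)"
      by (auto simp: fun_eq_iff indicator_def)
    then show ?thesis by (simp add: sets)
  qed
  then show ?thesis by simp
qed

text \<open>The difference of exponentials is the integral of a derivative from
  \<open>norm (x - t)\<close> to \<delta>, followed by Fubini. For points beyond \<delta> the
  difference is negative and \<open>ennreal\<close> sends it to 0, in accordance with an empty
  interval of radii.\<close>

lemma gaussian_layer_cake:
  fixes \<sigma> :: "'a::euclidean_space measure" and u \<delta> :: real
  assumes "sigma_finite_measure \<sigma>" and sets: "sets \<sigma> = sets borel" and u: "u > 0" and \<delta>: "\<delta> > 0"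
  shows "(\<integral>\<^sup>+t. ennreal (exp (- (norm (x - t))\<^sup>2 / u) - exp (- \<delta>\<^sup>2 / u)) \<partial>\<sigma>) =
    (\<integral>\<^sup>+\<rho>\<in>{0<..<\<delta>}. (ennreal (2 * \<rho> / u * exp (- \<rho>\<^sup>2 / u)) * emeasure \<sigma> (ball x \<rho>)) \<partial>lborel)"
proof -
  interpret sigma_finite_measure \<sigma> by fact
  interpret pair_sigma_finite lborel \<sigma> ..
  note [measurable_cong] = sets
  have *: "(\<integral>\<^sup>+\<rho>\<in>{a<..<\<delta>}. ennreal (2 * \<rho> / u * exp (- \<rho>\<^sup>2 / u)) \<partial>lborel) =
      ennreal (exp (- a\<^sup>2 / u) - exp (- \<delta>\<^sup>2 / u))" if a: "a \<ge> 0" for a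
  proof (cases "a < \<delta>")
    case True
    have "(\<integral>\<^sup>+\<rho>\<in>{a<..<\<delta>}. ennreal (2 * \<rho> / u * exp (- \<rho>\<^sup>2 / u)) \<partial>lborel) =
        (\<integral>\<^sup>+\<rho>. ennreal (2 * \<rho> / u * exp (- \<rho>\<^sup>2 / u)) * indicator {a..\<delta>} \<rho> \<partial>lborel)"
    proof (rule nn_integral_cong_AE)
      show "AE \<rho> in lborel. ennreal (2 * \<rho> / u * exp (- \<rho>\<^sup>2 / u)) * indicator {a<..<\<delta>} \<rho> =
          ennreal (2 * \<rho> / u * exp (- \<rho>\<^sup>2 / u)) * indicator {a..\<delta>} \<rho>"
        using AE_lborel_singleton[of a] AE_lborel_singleton[of \<delta>]
        by eventually_elim (auto split: split_indicator)
    qed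
    also have "\<dots> = ennreal ((- exp (- \<delta>\<^sup>2 / u)) - (- exp (- a\<^sup>2 / u)))"
      using u a True
      by (intro nn_integral_FTC_Icc) (auto intro!: derivative_eq_intros)
    finally show ?thesis by (simp add: algebra_simps)
  next
    case False
    then have "\<delta>\<^sup>2 \<le> a\<^sup>2" using \<delta> by (intro power_mono) auto
    then have "exp (- a\<^sup>2 / u) \<le> exp (- \<delta>\<^sup>2 / u)" using u by (simp add: divide_right_mono)
    moreover have "{a<..<\<delta>} = {}" using False by auto
    ultimately show ?thesis by (simp add: ennreal_neg)
  qed
  have "(\<integral>\<^sup>+t. ennreal (exp (- (norm (x - t))\<^sup>2 / u) - exp (- \<delta>\<^sup>2 / u)) \<partial>\<sigma>) =
    (\<integral>\<^sup>+t. \<integral>\<^sup>+\<rho>. ennreal (2 * \<rho> / u * exp (- \<rho>\<^sup>2 / u)) * indicator {0<..<\<delta>} \<rho> * indicator {\<rho>. norm (x - t) < \<rho>} \<rho> \<partial>lborel \<partial>\<sigma>)"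
    by (intro nn_integral_cong, subst *[symmetric])
      (auto intro!: nn_integral_cong split: split_indicator dest: le_less_trans[OF norm_ge_zero])
  also have "\<dots> = (\<integral>\<^sup>+\<rho>. \<integral>\<^sup>+t. ennreal (2 * \<rho> / u * exp (- \<rho>\<^sup>2 / u)) * indicator {0<..<\<delta>} \<rho> * indicator {\<rho>. norm (x - t) < \<rho>} \<rho> \<partial>\<sigma> \<partial>lborel)"
    by (rule Fubini') measurable
  also have "\<dots> = (\<integral>\<^sup>+\<rho>\<in>{0<..<\<delta>}. (ennreal (2 * \<rho> / u * exp (- \<rho>\<^sup>2 / u)) * emeasure \<sigma> (ball x \<rho>)) \<partial>lborel)"
  proof (rule nn_integral_cong)
    fix \<rho> :: real
    have "(\<lambda>t. indicator {\<rho>. norm (x - t) < \<rho>} \<rho> :: ennreal) = indicator (ball x \<rho>)"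
      by (auto simp: fun_eq_iff indicator_def dist_norm)
    then have "(\<integral>\<^sup>+t. ennreal (2 * \<rho> / u * exp (- \<rho>\<^sup>2 / u)) * indicator {0<..<\<delta>} \<rho> * indicator {\<rho>. norm (x - t) < \<rho>} \<rho> \<partial>\<sigma>) =
      (\<integral>\<^sup>+t. ennreal (2 * \<rho> / u * exp (- \<rho>\<^sup>2 / u)) * indicator {0<..<\<delta>} \<rho> * indicator (ball x \<rho>) t \<partial>\<sigma>)"
      by (metis (no_types))
    also have "\<dots> = ennreal (2 * \<rho> / u * exp (- \<rho>\<^sup>2 / u)) * indicator {0<..<\<delta>} \<rho> * emeasure \<sigma> (ball x \<rho>)"
      by (rule nn_integral_cmult_indicator) (simp add: sets)
    finally show "(\<integral>\<^sup>+t. ennreal (2 * \<rho> / u * exp (- \<rho>\<^sup>2 / u)) * indicator {0<..<\<delta>} \<rho> * indicator {\<rho>. norm (x - t) < \<rho>} \<rho> \<partial>\<sigma>) =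
      ennreal (2 * \<rho> / u * exp (- \<rho>\<^sup>2 / u)) * emeasure \<sigma> (ball x \<rho>) * indicator {0<..<\<delta>} \<rho>"
      by (simp add: mult_ac)
  qed
  finally show ?thesis .
qed

text \<open>Near potential of the kernel truncated at distance \<open>\<delta>\<close>, where it is continued by a constant
  that is then subtracted; unlike the near potential itself it only sees the balls of radius less
  than \<open>\<delta>\<close>.\<close>

definition truncated_potential :: "real \<Rightarrow> real \<Rightarrow> real \<Rightarrow> 'a::euclidean_space measure \<Rightarrow> 'a \<Rightarrow> ennreal" where
  "truncated_potential s \<delta> r \<sigma> x = (\<integral>\<^sup>+u\<in>{0<..r}. (ennreal (u powr (-s/2-1) / riesz_const s) *
     (\<integral>\<^sup>+t. ennreal (exp (- (norm (x - t))\<^sup>2 / u) - exp (- \<delta>\<^sup>2 / u)) \<partial>\<sigma>)) \<partial>lborel)"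

text \<open>By the layer cake formula a truncated potential is a positive mixture of masses of balls
  of radius below \<delta>, so it inherits their inequalities.\<close>

lemma truncated_potential_mono:
  fixes \<sigma> \<sigma>' :: "'a::euclidean_space measure" and \<tau> :: real
  assumes \<sigma>: "sigma_finite_measure \<sigma>" "sets \<sigma> = sets borel"
    and \<sigma>': "sigma_finite_measure \<sigma>'" "sets \<sigma>' = sets borel" and \<delta>: "\<delta> > 0"
    and le: "\<And>\<rho>. 0 < \<rho> \<Longrightarrow> \<rho> < \<delta> \<Longrightarrow>
      emeasure \<sigma> (ball x \<rho>) + ennreal \<tau> * emeasure lborel (ball x \<rho>) \<le> emeasure \<sigma>' (ball x \<rho>)"
  shows "truncated_potential s \<delta> r \<sigma> x + ennreal \<tau> * truncated_potential s \<delta> r lborel x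
    \<le> truncated_potential s \<delta> r \<sigma>' x"
proof -
  interpret \<sigma>: sigma_finite_measure \<sigma> by fact
  interpret \<sigma>': sigma_finite_measure \<sigma>' by fact
  note [measurable_cong] = \<sigma>(2) \<sigma>'(2)
  have meas: "(\<lambda>\<rho>. emeasure M (ball x \<rho>)) \<in> borel_measurable borel"
    if "sigma_finite_measure M" "sets M = sets borel" for M :: "'a measure"
    using that by (rule emeasure_ball_measurable) simp_all
  note [measurable] = meas[OF \<sigma>] meas[OF \<sigma>'] meas[OF lborel.sigma_finite_measure_axioms sets_lborel]
  let ?I = "\<lambda>\<sigma> u. \<integral>\<^sup>+t. ennreal (exp (- (norm (x - t))\<^sup>2 / u) - exp (- \<delta>\<^sup>2 / u)) \<partial>\<sigma>"
  let ?b = "\<lambda>u. ennreal (u powr (-s/2-1) / riesz_const s)"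
  have I: "?I \<sigma> u + ennreal \<tau> * ?I lborel u \<le> ?I \<sigma>' u" if u: "u > 0" for u
  proof -
    let ?h = "\<lambda>\<rho>. ennreal (2 * \<rho> / u * exp (- \<rho>\<^sup>2 / u))"
    note lc = gaussian_layer_cake[OF \<sigma> u \<delta>] gaussian_layer_cake[OF \<sigma>' u \<delta>]
      gaussian_layer_cake[OF lborel.sigma_finite_measure_axioms sets_lborel u \<delta>]
    have "?I \<sigma> u + ennreal \<tau> * ?I lborel u = (\<integral>\<^sup>+\<rho>. ?h \<rho> * emeasure \<sigma> (ball x \<rho>) * indicator {0<..<\<delta>} \<rho> +
        ennreal \<tau> * (?h \<rho> * emeasure lborel (ball x \<rho>) * indicator {0<..<\<delta>} \<rho>) \<partial>lborel)"
      unfolding lc by (simp add: nn_integral_add nn_integral_cmult)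
    also have "\<dots> \<le> ?I \<sigma>' u"
      unfolding lc
    proof (intro nn_integral_mono)
      fix \<rho>
      have "?h \<rho> * emeasure \<sigma> (ball x \<rho>) + ennreal \<tau> * (?h \<rho> * emeasure lborel (ball x \<rho>)) =
         ?h \<rho> * (emeasure \<sigma> (ball x \<rho>) + ennreal \<tau> * emeasure lborel (ball x \<rho>))"
        by (simp only: distrib_left mult.left_commute[of "ennreal \<tau>"])
      also have "\<dots> \<le> ?h \<rho> * emeasure \<sigma>' (ball x \<rho>)" if "\<rho> \<in> {0<..<\<delta>}"
        using that le[of \<rho>] by (intro mult_left_mono) auto
      finally show "?h \<rho> * emeasure \<sigma> (ball x \<rho>) * indicator {0<..<\<delta>} \<rho> +
        ennreal \<tau> * (?h \<rho> * emeasure lborel (ball x \<rho>) * indicator {0<..<\<delta>} \<rho>) \<le>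
        ?h \<rho> * emeasure \<sigma>' (ball x \<rho>) * indicator {0<..<\<delta>} \<rho>"
        by (auto split: split_indicator)
    qed
    finally show ?thesis .
  qed
  have "truncated_potential s \<delta> r \<sigma> x + ennreal \<tau> * truncated_potential s \<delta> r lborel x =
     (\<integral>\<^sup>+u. ?b u * ?I \<sigma> u * indicator {0<..r} u + ennreal \<tau> * (?b u * ?I lborel u * indicator {0<..r} u) \<partial>lborel)"
    unfolding truncated_potential_def by (simp add: nn_integral_add nn_integral_cmult)
  also have "\<dots> \<le> truncated_potential s \<delta> r \<sigma>' x"
    unfolding truncated_potential_def
  proof (intro nn_integral_mono)
    fix u
    have "?b u * ?I \<sigma> u + ennreal \<tau> * (?b u * ?I lborel u) = ?b u * (?I \<sigma> u + ennreal \<tau> * ?I lborel u)"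
      by (simp only: distrib_left mult.left_commute[of "ennreal \<tau>"])
    also have "\<dots> \<le> ?b u * ?I \<sigma>' u" if "u \<in> {0<..r}"
      using that I by (intro mult_left_mono) auto
    finally show "?b u * ?I \<sigma> u * indicator {0<..r} u + ennreal \<tau> * (?b u * ?I lborel u * indicator {0<..r} u)
       \<le> ?b u * ?I \<sigma>' u * indicator {0<..r} u"
      by (auto split: split_indicator)
  qed
  finally show ?thesis .
qed

context riesz_measure
begin

lemma truncated_potential_le: "truncated_potential s \<delta> r \<sigma> x \<le> near_potential s r \<sigma> x"
proof -
  have "ennreal (u powr (-s/2-1) / riesz_const s) * (\<integral>\<^sup>+t. ennreal (exp (- (norm (x - t))\<^sup>2 / u) - exp (- \<delta>\<^sup>2 / u)) \<partial>\<sigma>)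
    \<le> subord_potential s u \<sigma> x" for u
  proof -
    have "ennreal (u powr (-s/2-1) / riesz_const s) * (\<integral>\<^sup>+t. ennreal (exp (- (norm (x - t))\<^sup>2 / u) - exp (- \<delta>\<^sup>2 / u)) \<partial>\<sigma>)
      = (\<integral>\<^sup>+t. ennreal (u powr (-s/2-1) / riesz_const s) * ennreal (exp (- (norm (x - t))\<^sup>2 / u) - exp (- \<delta>\<^sup>2 / u)) \<partial>\<sigma>)"
      by (rule nn_integral_cmult[symmetric]) measurable
    also have "\<dots> \<le> subord_potential s u \<sigma> x"
      unfolding subord_potential_def
    proof (intro nn_integral_mono)
      fix t
      have "ennreal (u powr (-s/2-1) / riesz_const s) * ennreal (exp (- (norm (x - t))\<^sup>2 / u) - exp (- \<delta>\<^sup>2 / u))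
        \<le> ennreal (u powr (-s/2-1) / riesz_const s) * ennreal (exp (- (norm (x - t))\<^sup>2 / u))"
        by (intro mult_left_mono ennreal_leI) auto
      also have "\<dots> = ennreal (subord s u (x - t))"
        using riesz_const(2)[OF s_pos] by (simp add: subord_def flip: ennreal_mult)
      finally show "ennreal (u powr (-s/2-1) / riesz_const s) * ennreal (exp (- (norm (x - t))\<^sup>2 / u) - exp (- \<delta>\<^sup>2 / u))
        \<le> ennreal (subord s u (x - t))" .
    qed
    finally show ?thesis .
  qed
  then show ?thesis unfolding truncated_potential_def near_potential_def
    by (intro nn_integral_mono mult_right_mono) auto
qed

text \<open>Truncation takes from each layer at most \<open>M / \<delta>^2\<close> times the Riesz
  kernel: beyond \<delta> by \<open>subord_le\<close> at the distance itself, within \<delta>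
  because the subtracted constant obeys the bound at distance \<delta>. Measured against the kernel,
  the loss is integrable by \<open>fin\<close> even if \<sigma> has infinite mass.\<close>

lemma near_potential_le_truncated:
  assumes \<delta>: "\<delta> > 0" and fin: "riesz_potential s \<sigma> x < \<infinity>"
  obtains D where "D \<ge> 0"
    "\<And>r. r > 0 \<Longrightarrow> near_potential s r \<sigma> x \<le> truncated_potential s \<delta> r \<sigma> x + ennreal (D * r)"
proof -
  obtain M where M: "M > 0" "\<And>u (z::'a) \<rho>. u > 0 \<Longrightarrow> \<rho> > 0 \<Longrightarrow> \<rho> \<le> norm z \<Longrightarrow> subord s u z \<le> M * \<rho> powr (-s-2)"
    using subord_le[OF s_pos] by metis
  note R = riesz_const(2)[OF s_pos]
  \<comment> \<open>An arbitrary vector of this norm, used to read the bound for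
    \<open>subord\<close> as one in the scalar \<delta>.\<close>
  obtain e :: 'a where e: "norm e = \<delta>" using vector_choose_size[of \<delta>] \<delta> by auto
  have M\<delta>: "u powr (-s/2-1) / riesz_const s * exp (- \<delta>\<^sup>2 / u) \<le> M * \<delta> powr (-s-2)" if "u > 0" for u
    using M(2)[of u \<delta> e] that \<delta> e by (simp add: subord_def)
  have pt: "ennreal (subord s u (x - t)) \<le>
      ennreal (u powr (-s/2-1) / riesz_const s) * ennreal (exp (- (norm (x - t))\<^sup>2 / u) - exp (- \<delta>\<^sup>2 / u))
      + ennreal (M / \<delta>\<^sup>2) * riesz_kernel s x t" if u: "u > 0" for u t
  proof (cases "x = t")
    case True
    then show ?thesis using M \<delta> by (simp add: riesz_kernel_def ennreal_mult_top)
  next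
    case False
    define n where "n = norm (x - t)"
    have n: "n > 0" using False by (simp add: n_def)
    have sub: "subord s u (x - t) = u powr (-s/2-1) / riesz_const s * exp (- n\<^sup>2 / u)"
      by (simp add: subord_def n_def)
    have rk: "riesz_kernel s x t = ennreal (n powr (-s))" using False by (simp add: riesz_kernel_def n_def)
    have p2: "c powr (-s-2) = c powr (-s) / c\<^sup>2" if "c > 0" for c :: real
      using that by (simp add: powr_diff powr_numeral)
    show ?thesis
    proof (cases "n < \<delta>")
      case True
      have "n\<^sup>2 \<le> \<delta>\<^sup>2" using True n by (intro power_mono) auto
      then have d: "exp (- n\<^sup>2 / u) - exp (- \<delta>\<^sup>2 / u) \<ge> 0" using u by (simp add: divide_right_mono)
      have "\<delta> powr (-s) \<le> n powr (-s)" using True n s_pos by (intro powr_mono2') auto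
      then have "M * \<delta> powr (-s-2) \<le> M / \<delta>\<^sup>2 * n powr (-s)"
        using M(1) p2[OF \<delta>] \<delta> by (simp add: field_simps)
      with M\<delta>[OF u] have "subord s u (x - t) \<le>
          u powr (-s/2-1) / riesz_const s * (exp (- n\<^sup>2 / u) - exp (- \<delta>\<^sup>2 / u)) + M / \<delta>\<^sup>2 * n powr (-s)"
        unfolding sub right_diff_distrib by linarith
      then have "ennreal (subord s u (x - t)) \<le> ennreal (u powr (-s/2-1) / riesz_const s *
          (exp (- n\<^sup>2 / u) - exp (- \<delta>\<^sup>2 / u)) + M / \<delta>\<^sup>2 * n powr (-s))" by (rule ennreal_leI)
      also have "\<dots> = ennreal (u powr (-s/2-1) / riesz_const s) * ennreal (exp (- n\<^sup>2 / u) - exp (- \<delta>\<^sup>2 / u))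
          + ennreal (M / \<delta>\<^sup>2) * ennreal (n powr (-s))"
      proof -
        have b: "u powr (-s/2-1) / riesz_const s \<ge> 0" using R by simp
        show ?thesis
          using d M(1) b by (simp only: ennreal_plus ennreal_mult mult_nonneg_nonneg divide_nonneg_nonneg
            powr_ge_zero zero_le_power2 less_imp_le)
      qed
      finally show ?thesis by (simp add: rk n_def)
    next
      case False
      then have "n\<^sup>2 \<ge> \<delta>\<^sup>2" using \<delta> by (intro power_mono) auto
      have "subord s u (x - t) \<le> M * n powr (-s-2)" using M(2)[OF u n] by (simp add: n_def)
      also have "\<dots> = M / n\<^sup>2 * n powr (-s)" using p2[OF n] by simp
      also have "\<dots> \<le> M / \<delta>\<^sup>2 * n powr (-s)"
        using \<open>n\<^sup>2 \<ge> \<delta>\<^sup>2\<close> M(1) \<delta> n by (intro mult_right_mono divide_left_mono) auto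
      finally have "ennreal (subord s u (x - t)) \<le> ennreal (M / \<delta>\<^sup>2) * ennreal (n powr (-s))"
        using M(1) by (subst ennreal_mult[symmetric]) (auto intro: ennreal_leI)
      then show ?thesis unfolding rk by (rule add_increasing[OF zero_le])
    qed
  qed
  define D where "D = M / \<delta>\<^sup>2 * enn2real (riesz_potential s \<sigma> x)"
  have D: "ennreal (M / \<delta>\<^sup>2) * riesz_potential s \<sigma> x = ennreal D" "D \<ge> 0"
    unfolding D_def using fin M(1) by (subst ennreal_mult, auto)
  have "near_potential s r \<sigma> x \<le> truncated_potential s \<delta> r \<sigma> x + ennreal (D * r)" if r: "r > 0" for r
  proof -
    have "subord_potential s u \<sigma> x \<le> ennreal (u powr (-s/2-1) / riesz_const s) *
        (\<integral>\<^sup>+t. ennreal (exp (- (norm (x - t))\<^sup>2 / u) - exp (- \<delta>\<^sup>2 / u)) \<partial>\<sigma>) + ennreal D" if "u > 0" for u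
    proof -
      have "subord_potential s u \<sigma> x \<le> (\<integral>\<^sup>+t. ennreal (u powr (-s/2-1) / riesz_const s) * ennreal (exp (- (norm (x - t))\<^sup>2 / u) - exp (- \<delta>\<^sup>2 / u))
          + ennreal (M / \<delta>\<^sup>2) * riesz_kernel s x t \<partial>\<sigma>)"
        unfolding subord_potential_def using pt[OF that] by (intro nn_integral_mono)
      then show ?thesis
        by (simp add: nn_integral_add nn_integral_cmult riesz_potential_def[symmetric] D)
    qed
    then have "near_potential s r \<sigma> x \<le> (\<integral>\<^sup>+u. ennreal (u powr (-s/2-1) / riesz_const s) *
        (\<integral>\<^sup>+t. ennreal (exp (- (norm (x - t))\<^sup>2 / u) - exp (- \<delta>\<^sup>2 / u)) \<partial>\<sigma>) * indicator {0<..r} u + ennreal D * indicator {0<..r} u \<partial>lborel)"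
      unfolding near_potential_def by (intro nn_integral_mono) (auto split: split_indicator)
    also have "\<dots> = truncated_potential s \<delta> r \<sigma> x + (\<integral>\<^sup>+u. ennreal D * indicator {0<..r} u \<partial>lborel)"
      unfolding truncated_potential_def by (rule nn_integral_add) measurable
    also have "(\<integral>\<^sup>+u. ennreal D * indicator {0<..r} u \<partial>lborel) = ennreal (D * r)"
      using r D(2) by (simp add: nn_integral_cmult_indicator flip: ennreal_mult)
    finally show ?thesis .
  qed
  with D(2) show thesis by (rule that)
qed

end

text \<open>It suffices to keep the layers \<open>r / 2 < u \<le> r\<close> and the ball of radius
  \<open>sqrt r\<close>. There the Gaussian is at least \<open>exp (-2) = 2 * A\<close>, the volume
  is of order \<open>r powr (d / 2)\<close>, and the powers of \<open>r\<close> combine to the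
  exponent claimed.\<close>

lemma truncated_potential_lborel_lower:
  assumes s: "s > 0" and \<delta>: "\<delta> > 0"
  obtains c r0 where "c > 0" "r0 > 0" "\<And>r. 0 < r \<Longrightarrow> r \<le> r0 \<Longrightarrow>
    ennreal (c * r powr ((real DIM('a) - s) / 2)) \<le> truncated_potential s \<delta> r lborel (x::'a::euclidean_space)"
proof -
  note R = riesz_const(2)[OF s]
  define A where "A = (exp (-2) / 2 :: real)"
  define V where "V = unit_ball_vol (real DIM('a))"
  have V: "V > 0" by (simp add: V_def unit_ball_vol_pos)
  define c where "c = A / riesz_const s * V / 2"
  \<comment> \<open>For \<open>u \<le> r0\<close> the subtracted constant is at most
    \<open>exp (- 2 - ln 2) = A\<close>, half of the lower bound for the Gaussian.\<close>
  define r0 where "r0 = min 1 (\<delta>\<^sup>2 / (2 + ln 2))"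
  have l2: "2 + ln 2 > (0::real)" by (simp add: add_pos_pos)
  have r0: "r0 > 0" using \<delta> l2 by (simp add: r0_def)
  have "ennreal (c * r powr ((real DIM('a) - s) / 2)) \<le> truncated_potential s \<delta> r lborel x" if r: "0 < r" "r \<le> r0" for r
  proof -
    have I: "ennreal (A * (V * sqrt r ^ DIM('a))) \<le>
        (\<integral>\<^sup>+t. ennreal (exp (- (norm (x - t))\<^sup>2 / u) - exp (- \<delta>\<^sup>2 / u)) \<partial>lborel)" if u: "r / 2 < u" "u \<le> r" for u
    proof -
      have u0: "u > 0" using u r by simp
      have "u * (2 + ln 2) \<le> \<delta>\<^sup>2"
      proof -
        have "u \<le> \<delta>\<^sup>2 / (2 + ln 2)" using u r by (simp add: r0_def)
        then show ?thesis using l2 by (simp add: field_simps)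
      qed
      then have "- \<delta>\<^sup>2 / u \<le> - 2 - ln 2" using u0 by (simp add: field_simps)
      then have "exp (- \<delta>\<^sup>2 / u) \<le> exp (- 2 - ln 2)" by simp
      also have "\<dots> = A" by (simp add: A_def exp_diff)
      finally have e1: "exp (- \<delta>\<^sup>2 / u) \<le> A" .
      have e2: "2 * A \<le> exp (- (norm (x - t))\<^sup>2 / u)" if "t \<in> ball x (sqrt r)" for t
      proof -
        have "(norm (x - t))\<^sup>2 \<le> (sqrt r)\<^sup>2"
          using that by (intro power_mono) (auto simp: dist_norm)
        also have "\<dots> \<le> 2 * u" using u r by simp
        finally have "- 2 \<le> - (norm (x - t))\<^sup>2 / u" using u0 by (simp add: field_simps)
        then show ?thesis by (simp add: A_def)
      qed
      have "ennreal (A * (V * sqrt r ^ DIM('a))) = ennreal A * emeasure lborel (ball x (sqrt r))"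
        using r V by (subst emeasure_ball) (auto simp: V_def A_def simp flip: ennreal_mult)
      also have "\<dots> = (\<integral>\<^sup>+t. ennreal A * indicator (ball x (sqrt r)) t \<partial>lborel)"
        by (simp add: nn_integral_cmult_indicator)
      also have "\<dots> \<le> (\<integral>\<^sup>+t. ennreal (exp (- (norm (x - t))\<^sup>2 / u) - exp (- \<delta>\<^sup>2 / u)) \<partial>lborel)"
      proof (intro nn_integral_mono)
        fix t
        show "ennreal A * indicator (ball x (sqrt r)) t \<le> ennreal (exp (- (norm (x - t))\<^sup>2 / u) - exp (- \<delta>\<^sup>2 / u))"
        proof (cases "t \<in> ball x (sqrt r)")
          case True
          have "A \<le> exp (- (norm (x - t))\<^sup>2 / u) - exp (- \<delta>\<^sup>2 / u)" using e1 e2[OF True] by linarith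
          then show ?thesis using True by (auto intro: ennreal_leI)
        qed simp
      qed
      finally show ?thesis .
    qed
    have "c * r powr ((real DIM('a) - s) / 2) = (r powr (-s/2-1) / riesz_const s * (A * (V * sqrt r ^ DIM('a)))) * (r / 2)"
    proof -
      have "sqrt r ^ DIM('a) = r powr (real DIM('a) / 2)"
        using r by (simp add: powr_half_sqrt[symmetric] powr_powr flip: powr_realpow)
      then have "r powr (-s/2-1) * sqrt r ^ DIM('a) * r = r powr (-s/2-1) * r powr (real DIM('a) / 2) * r powr 1"
        using r by simp
      also have "\<dots> = r powr ((real DIM('a) - s) / 2)"
        unfolding powr_add[symmetric] by (rule arg_cong[where f="\<lambda>a. r powr a"]) (simp add: diff_divide_distrib)
      finally show ?thesis by (simp add: c_def)
    qed
    then have "ennreal (c * r powr ((real DIM('a) - s) / 2)) =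
        (\<integral>\<^sup>+u. ennreal (r powr (-s/2-1) / riesz_const s * (A * (V * sqrt r ^ DIM('a)))) * indicator {r/2<..r} u \<partial>lborel)"
      using r R V by (simp add: nn_integral_cmult_indicator A_def flip: ennreal_mult)
    also have "\<dots> \<le> truncated_potential s \<delta> r lborel x"
      unfolding truncated_potential_def
    proof (intro nn_integral_mono)
      fix u
      have "ennreal (r powr (-s/2-1) / riesz_const s * (A * (V * sqrt r ^ DIM('a)))) \<le>
        ennreal (u powr (-s/2-1) / riesz_const s) *
           (\<integral>\<^sup>+t. ennreal (exp (- (norm (x - t))\<^sup>2 / u) - exp (- \<delta>\<^sup>2 / u)) \<partial>lborel)" if u: "r / 2 < u" "u \<le> r"
      proof -
        have "r powr (-s/2-1) \<le> u powr (-s/2-1)" using u r s by (intro powr_mono2') auto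
        then have "r powr (-s/2-1) / riesz_const s \<le> u powr (-s/2-1) / riesz_const s"
          using R by (simp add: divide_right_mono)
        then have "ennreal (r powr (-s/2-1) / riesz_const s) * ennreal (A * (V * sqrt r ^ DIM('a))) \<le>
          ennreal (u powr (-s/2-1) / riesz_const s) *
           (\<integral>\<^sup>+t. ennreal (exp (- (norm (x - t))\<^sup>2 / u) - exp (- \<delta>\<^sup>2 / u)) \<partial>lborel)"
          using I[OF u] by (intro mult_mono ennreal_leI) auto
        then show ?thesis using R V r by (subst ennreal_mult) (auto simp: A_def)
      qed
      then show "ennreal (r powr (-s/2-1) / riesz_const s * (A * (V * sqrt r ^ DIM('a)))) * indicator {r/2<..r} u \<le>
        ennreal (u powr (-s/2-1) / riesz_const s) *
           (\<integral>\<^sup>+t. ennreal (exp (- (norm (x - t))\<^sup>2 / u) - exp (- \<delta>\<^sup>2 / u)) \<partial>lborel) * indicator {0<..r} u"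
        using r by (auto split: split_indicator)
    qed
    finally show ?thesis .
  qed
  moreover have "c > 0" using R V by (simp add: c_def A_def)
  ultimately show thesis using r0 that by blast
qed

section \<open>Potentials and balls at a point of contact\<close>

text \<open>Sweeping respects \<open>dom\<close> and keeps the constant, so the swept parts are
  ordered; as the totals agree at \<open>x\<close>, the near parts must be ordered the other
  way.\<close>

lemma near_potential_comparison:
  fixes \<nu> \<mu> :: "'a::euclidean_space measure" and C :: real
  assumes \<nu>: "riesz_measure \<nu> s" and \<mu>: "riesz_measure \<mu> s"
    and dom: "\<And>y. riesz_potential s \<nu> y \<le> riesz_potential s \<mu> y + ennreal C"
    and x: "riesz_potential s \<nu> x = riesz_potential s \<mu> x + ennreal C" "riesz_potential s \<mu> x < \<infinity>"
    and r: "r > 0"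
  shows "near_potential s r \<mu> x \<le> near_potential s r \<nu> x"
proof -
  interpret \<nu>: riesz_measure \<nu> s by (rule \<nu>)
  interpret \<mu>: riesz_measure \<mu> s by (rule \<mu>)
  let ?S = "sweep s r (riesz_potential s \<mu>) x"
  have "?S + ennreal C + near_potential s r \<mu> x = riesz_potential s \<nu> x"
    unfolding x(1) \<mu>.riesz_potential_decomp[OF r, of x] by (simp add: add_ac)
  also have "\<dots> = sweep s r (riesz_potential s \<nu>) x + near_potential s r \<nu> x"
    by (rule \<nu>.riesz_potential_decomp[OF r])
  also have "\<dots> \<le> sweep s r (\<lambda>y. riesz_potential s \<mu> y + ennreal C) x + near_potential s r \<nu> x"
    by (intro add_right_mono sweep_mono dom)
  also have "sweep s r (\<lambda>y. riesz_potential s \<mu> y + ennreal C) x = ?S + ennreal C"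
    using r \<mu>.s_gt \<mu>.s_less by (simp add: sweep_add sweep_const)
  finally have "?S + ennreal C + near_potential s r \<mu> x \<le> ?S + ennreal C + near_potential s r \<nu> x" .
  moreover have "?S + ennreal C < \<infinity>"
    using le_less_trans[OF \<mu>.sweep_riesz_potential_le[OF r] x(2)] by simp
  ultimately show ?thesis by (subst (asm) ennreal_add_left_cancel_le) (auto simp: less_top)
qed

text \<open>If every radius below \<delta> failed, the truncated potential of \<mu> would exceed
  that of \<nu> by \<tau> times that of Lebesgue measure, a gap of order at least
  \<open>r powr ((d - s) / 2)\<close>. The comparison of near potentials and the truncation error
  leave room only for order \<open>r\<close>. Rational radii keep the candidates countable for the
  covering.\<close>

lemma small_ball_comparison:
  fixes \<nu> \<mu> :: "'a::euclidean_space measure" and C \<delta> \<tau> :: real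
  assumes \<nu>: "riesz_measure \<nu> s" and \<mu>: "riesz_measure \<mu> s"
    and dom: "\<And>y. riesz_potential s \<nu> y \<le> riesz_potential s \<mu> y + ennreal C"
    and x: "riesz_potential s \<nu> x = riesz_potential s \<mu> x + ennreal C" "riesz_potential s \<mu> x < \<infinity>"
    and \<delta>: "\<delta> > 0" and \<tau>: "\<tau> > 0"
  obtains \<rho> where "\<rho> \<in> \<rat>" "0 < \<rho>" "\<rho> < \<delta>"
    "emeasure \<mu> (ball x \<rho>) \<le> emeasure \<nu> (ball x \<rho>) + ennreal \<tau> * emeasure lborel (ball x \<rho>)"
proof (rule ccontr)
  note obt = that
  assume no: "\<not> thesis"
  interpret \<nu>: riesz_measure \<nu> s by (rule \<nu>)
  interpret \<mu>: riesz_measure \<mu> s by (rule \<mu>)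
  have rat: "emeasure \<nu> (ball x q) + ennreal \<tau> * emeasure lborel (ball x q) \<le> emeasure \<mu> (ball x q)"
    if "q \<in> \<rat>" "0 < q" "q < \<delta>" for q
    by (rule ccontr) (use that obt[of q] no in \<open>auto simp: not_le intro: less_imp_le\<close>)
  \<comment> \<open>Open balls are increasing unions of smaller concentric ones, so failure at
    rational radii in between passes to every radius. The \<open>n + 2\<close> in \<open>a\<close>
    makes already \<open>a 0\<close> positive.\<close>
  have le: "emeasure \<nu> (ball x \<rho>) + ennreal \<tau> * emeasure lborel (ball x \<rho>) \<le> emeasure \<mu> (ball x \<rho>)"
    if \<rho>: "0 < \<rho>" "\<rho> < \<delta>" for \<rho>
  proof -
    define a where "a n = \<rho> - \<rho> / real (n + 2)" for n
    have "a n < \<rho>" "0 < a n" for n using \<rho> by (auto simp: a_def field_simps intro: add_pos_nonneg)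
    have inc: "incseq (\<lambda>n. ball x (a n))"
      using \<rho> by (intro incseq_SucI subset_ball) (auto simp: a_def intro!: divide_left_mono)
    have "a \<longlonglongrightarrow> \<rho> - 0"
      unfolding a_def by (intro tendsto_intros tendsto_divide_0[OF tendsto_const]
        filterlim_at_top_imp_at_infinity filterlim_compose[OF filterlim_real_sequentially]
        filterlim_add_const_nat_at_top)
    then have lim: "a \<longlonglongrightarrow> \<rho>" by simp
    have un: "(\<Union>n. ball x (a n)) = ball x \<rho>"
    proof
      show "ball x \<rho> \<subseteq> (\<Union>n. ball x (a n))"
      proof
        fix y assume "y \<in> ball x \<rho>"
        then have "eventually (\<lambda>n. dist x y < a n) sequentially" by (intro order_tendstoD(1)[OF lim]) simp
        then show "y \<in> (\<Union>n. ball x (a n))" by (auto simp: eventually_sequentially)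
      qed
    qed (use \<open>\<And>n. a n < \<rho>\<close> in \<open>force intro: less_trans\<close>)
    have conv: "(\<lambda>n. emeasure M (ball x (a n))) \<longlonglongrightarrow> emeasure M (ball x \<rho>)" if "sets M = sets borel" for M :: "'a measure"
    proof -
      have "range (\<lambda>n. ball x (a n)) \<subseteq> sets M" by (auto simp: that)
      from Lim_emeasure_incseq[OF this inc] show ?thesis unfolding un .
    qed
    show ?thesis
    proof (rule LIMSEQ_le_const2)
      show "(\<lambda>n. emeasure \<nu> (ball x (a n)) + ennreal \<tau> * emeasure lborel (ball x (a n))) \<longlonglongrightarrow>
          emeasure \<nu> (ball x \<rho>) + ennreal \<tau> * emeasure lborel (ball x \<rho>)"
        by (intro tendsto_add ennreal_tendsto_cmult conv \<nu>.sets_eq sets_lborel) simp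
      show "\<exists>N. \<forall>n\<ge>N. emeasure \<nu> (ball x (a n)) + ennreal \<tau> * emeasure lborel (ball x (a n)) \<le> emeasure \<mu> (ball x \<rho>)"
      proof (intro exI allI impI)
        fix n
        obtain q where q: "q \<in> \<rat>" "a n < q" "q < \<rho>" using Rats_dense_in_real[OF \<open>a n < \<rho>\<close>] by auto
        have sub: "ball x (a n) \<subseteq> ball x q" "ball x q \<subseteq> ball x \<rho>" using q by (auto intro: subset_ball)
        have "emeasure \<nu> (ball x (a n)) + ennreal \<tau> * emeasure lborel (ball x (a n)) \<le>
            emeasure \<nu> (ball x q) + ennreal \<tau> * emeasure lborel (ball x q)"
          using sub by (intro add_mono mult_left_mono emeasure_mono) (auto simp: \<nu>.sets_eq)
        also have "\<dots> \<le> emeasure \<mu> (ball x q)"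
          using q \<open>0 < a n\<close> \<rho> by (intro rat) auto
        also have "\<dots> \<le> emeasure \<mu> (ball x \<rho>)" using sub by (intro emeasure_mono) (auto simp: \<mu>.sets_eq)
        finally show "emeasure \<nu> (ball x (a n)) + ennreal \<tau> * emeasure lborel (ball x (a n)) \<le> emeasure \<mu> (ball x \<rho>)" .
      qed
    qed
  qed
  have Un: "riesz_potential s \<nu> x < \<infinity>" using x by simp
  obtain D where D: "D \<ge> 0" "\<And>r. r > 0 \<Longrightarrow> near_potential s r \<nu> x \<le> truncated_potential s \<delta> r \<nu> x + ennreal (D * r)"
    using \<nu>.near_potential_le_truncated[OF \<delta> Un] by blast
  obtain c r0 where c: "c > 0" "r0 > 0" "\<And>r. 0 < r \<Longrightarrow> r \<le> r0 \<Longrightarrow>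
    ennreal (c * r powr ((real DIM('a) - s) / 2)) \<le> truncated_potential s \<delta> r lborel x"
    using truncated_potential_lborel_lower[OF \<nu>.s_pos \<delta>, where x=x] by blast
  obtain r where r: "0 < r" "r \<le> r0" "D * r < (\<tau> * c) * r powr ((real DIM('a) - s) / 2)"
    using powr_not_le_linear[of "\<tau> * c" D "(real DIM('a) - s) / 2" r0] \<tau> c D(1) \<nu>.s_gt by auto
  let ?W = "truncated_potential s \<delta> r \<nu> x"
  have "?W + ennreal \<tau> * truncated_potential s \<delta> r lborel x \<le> truncated_potential s \<delta> r \<mu> x"
    by (rule truncated_potential_mono[OF \<nu>.sigma_finite_measure_axioms \<nu>.sets_eq
          \<mu>.sigma_finite_measure_axioms \<mu>.sets_eq \<delta> le])
  also have "\<dots> \<le> near_potential s r \<mu> x" by (rule \<mu>.truncated_potential_le)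
  also have "\<dots> \<le> near_potential s r \<nu> x" by (rule near_potential_comparison[OF \<nu> \<mu> dom x r(1)])
  also have "\<dots> \<le> ?W + ennreal (D * r)" by (rule D(2)[OF r(1)])
  finally have "?W + ennreal \<tau> * truncated_potential s \<delta> r lborel x \<le> ?W + ennreal (D * r)" .
  moreover have "?W < \<infinity>"
    using \<nu>.truncated_potential_le \<nu>.near_potential_le Un by (meson le_less_trans)
  ultimately have "ennreal \<tau> * truncated_potential s \<delta> r lborel x \<le> ennreal (D * r)"
    by (subst (asm) ennreal_add_left_cancel_le) (auto simp: less_top)
  then have "ennreal \<tau> * ennreal (c * r powr ((real DIM('a) - s) / 2)) \<le> ennreal (D * r)"
    using mult_left_mono[OF c(3)[OF r(1,2)], of "ennreal \<tau>"] by (auto intro: order_trans)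
  then have "ennreal (\<tau> * c * r powr ((real DIM('a) - s) / 2)) \<le> ennreal (D * r)"
    using \<tau> c(1) by (simp add: mult.assoc flip: ennreal_mult)
  then show False using r D(1) by (simp add: ennreal_le_iff)
qed

section \<open>Covering by small balls\<close>

lemma separated_card_bound:
  fixes X :: "'a::euclidean_space set"
  assumes X: "bounded X" and e: "e > 0"
  obtains N where "\<forall>A\<subseteq>X. (\<forall>x\<in>A. \<forall>y\<in>A. x \<noteq> y \<longrightarrow> e \<le> dist x y) \<longrightarrow> finite A \<and> card A \<le> N"
proof -
  have "compact (closure X)" using X by (simp add: compact_closure)
  then have "\<forall>e>0. \<exists>T. finite T \<and> closure X \<subseteq> (\<Union>t\<in>T. ball t e)"
    by (simp add: compact_eq_totally_bounded)
  then obtain T where T: "finite T" "closure X \<subseteq> (\<Union>t\<in>T. ball t (e/2))"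
    using e half_gt_zero by blast
  have "finite A \<and> card A \<le> card T"
    if A: "A \<subseteq> X" and sep: "\<And>x y. x \<in> A \<Longrightarrow> y \<in> A \<Longrightarrow> x \<noteq> y \<Longrightarrow> e \<le> dist x y" for A
  proof -
    have "\<exists>t\<in>T. dist t x < e/2" if "x \<in> A" for x
    proof -
      have "x \<in> closure X" using that A closure_subset[of X] by blast
      then have "x \<in> (\<Union>t\<in>T. ball t (e/2))" using T(2) by blast
      then show ?thesis by simp
    qed
    then obtain f where f: "\<And>x. x \<in> A \<Longrightarrow> f x \<in> T" "\<And>x. x \<in> A \<Longrightarrow> dist (f x) x < e/2" by metis
    have "inj_on f A"
    proof (rule inj_onI, rule ccontr)
      fix x y assume xy: "x \<in> A" "y \<in> A" "f x = f y" "x \<noteq> y"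
      have "dist x y \<le> dist (f x) x + dist (f y) y" using dist_triangle3[of x y "f x"] xy(3) by simp
      then show False using f(2)[OF xy(1)] f(2)[OF xy(2)] sep[OF xy(1,2,4)] by linarith
    qed
    then show ?thesis using T(1) f(1) by (auto intro: inj_on_finite card_inj_on_le)
  qed
  then show thesis by (intro that[of "card T"]) blast
qed

lemma maximal_separated_subset:
  fixes X :: "'a::euclidean_space set"
  assumes X: "bounded X" and e: "e > 0"
  obtains A where "finite A" "A \<subseteq> X" "\<And>x y. x \<in> A \<Longrightarrow> y \<in> A \<Longrightarrow> x \<noteq> y \<Longrightarrow> e \<le> dist x y"
    "\<And>x. x \<in> X \<Longrightarrow> \<exists>y\<in>A. dist y x < e"
proof -
  define S where "S A \<longleftrightarrow> A \<subseteq> X \<and> (\<forall>x\<in>A. \<forall>y\<in>A. x \<noteq> y \<longrightarrow> e \<le> dist x y)" for A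
  obtain N where N: "\<And>A. S A \<Longrightarrow> finite A \<and> card A \<le> N"
    using separated_card_bound[OF X e] unfolding S_def by metis
  have "\<exists>A. S A \<and> (\<forall>B. S B \<longrightarrow> card B \<le> card A)"
    by (rule ex_has_greatest_nat[where b="Suc N" and k="{}"]) (use N in \<open>simp add: S_def, auto simp: less_Suc_eq_le\<close>)
  then obtain A where A: "S A" "\<And>B. S B \<Longrightarrow> card B \<le> card A" by blast
  show thesis
  proof (rule that[of A])
    show "finite A" using A N by blast
    fix x assume x: "x \<in> X"
    show "\<exists>y\<in>A. dist y x < e"
    proof (rule ccontr)
      assume no: "\<not> (\<exists>y\<in>A. dist y x < e)"
      then have "x \<notin> A" using e by auto
      moreover have "S (insert x A)" using no x A(1) by (auto simp: S_def dist_commute not_less)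
      then have "card (insert x A) \<le> card A" by (rule A(2))
      ultimately show False using \<open>finite A\<close> by simp
    qed
  qed (use A(1) in \<open>auto simp: S_def\<close>)
qed

text \<open>The selection step of Besicovitch's covering theorem, for finitely many radii: balls are
  chosen greedily by decreasing radius, so no chosen centre lies in another chosen ball.\<close>

lemma besicovitch_selection:
  fixes X :: "'a::euclidean_space set" and \<rho> :: "'a \<Rightarrow> real"
  assumes "finite F" "bounded X" "\<rho> ` X \<subseteq> F" "\<And>r. r \<in> F \<Longrightarrow> r > 0"
  shows "\<exists>A. finite A \<and> A \<subseteq> X \<and> (\<forall>x\<in>A. \<forall>y\<in>A. x \<noteq> y \<longrightarrow> \<rho> x \<le> dist x y \<and> \<rho> y \<le> dist x y) \<and>
    X \<subseteq> (\<Union>x\<in>A. ball x (\<rho> x))"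
  using assms
proof (induction F arbitrary: X rule: finite_psubset_induct)
  case (psubset F)
  show ?case
  proof (cases "F = {}")
    case True
    then show ?thesis using psubset by (intro exI[of _ "{}"]) auto
  next
    case False
    define b where "b = Max F"
    have b: "b \<in> F" "\<And>r. r \<in> F \<Longrightarrow> r \<le> b" using False psubset.hyps by (auto simp: b_def)
    define X1 where "X1 = {x\<in>X. \<rho> x = b}"
    have "bounded X1" using psubset.prems(1) by (rule bounded_subset) (auto simp: X1_def)
    moreover have "b > 0" using b psubset.prems(3) by blast
    ultimately obtain A1 where A1: "finite A1" "A1 \<subseteq> X1"
      "\<And>x y. x \<in> A1 \<Longrightarrow> y \<in> A1 \<Longrightarrow> x \<noteq> y \<Longrightarrow> b \<le> dist x y" "\<And>x. x \<in> X1 \<Longrightarrow> \<exists>y\<in>A1. dist y x < b"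
      using maximal_separated_subset[of X1 b] by metis
    \<comment> \<open>What is left has radii at most \<open>b\<close> and distance at least
      \<open>b\<close> from the centres in \<open>A1\<close>, so both separation conditions between
      the two stages hold.\<close>
    define X2 where "X2 = X - X1 - (\<Union>x\<in>A1. ball x b)"
    have "\<exists>A. finite A \<and> A \<subseteq> X2 \<and> (\<forall>x\<in>A. \<forall>y\<in>A. x \<noteq> y \<longrightarrow> \<rho> x \<le> dist x y \<and> \<rho> y \<le> dist x y) \<and>
      X2 \<subseteq> (\<Union>x\<in>A. ball x (\<rho> x))"
    proof (rule psubset.IH[of "F - {b}"])
      show "bounded X2" using psubset.prems(1) by (rule bounded_subset) (auto simp: X2_def)
      show "\<rho> ` X2 \<subseteq> F - {b}" using psubset.prems(2) by (auto simp: X2_def X1_def)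
    qed (use b psubset.prems(3) in auto)
    then obtain A2 where A2: "finite A2" "A2 \<subseteq> X2"
      "\<And>x y. x \<in> A2 \<Longrightarrow> y \<in> A2 \<Longrightarrow> x \<noteq> y \<Longrightarrow> \<rho> x \<le> dist x y \<and> \<rho> y \<le> dist x y"
      "X2 \<subseteq> (\<Union>x\<in>A2. ball x (\<rho> x))" by metis
    have r1: "\<rho> x = b" if "x \<in> A1" for x using that A1(2) by (auto simp: X1_def)
    have r2: "\<rho> y \<le> b" if "y \<in> A2" for y using that A2(2) b(2)[of "\<rho> y"] psubset.prems(2) unfolding X2_def by blast
    have cross: "b \<le> dist x y" if "x \<in> A1" "y \<in> A2" for x y
      using that A2(2) by (auto simp: X2_def not_less)
    show ?thesis
    proof (intro exI[of _ "A1 \<union> A2"] conjI ballI impI)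
      show "finite (A1 \<union> A2)" using A1 A2 by simp
      show "A1 \<union> A2 \<subseteq> X" using A1(2) A2(2) by (auto simp: X1_def X2_def)
      show "X \<subseteq> (\<Union>x\<in>A1 \<union> A2. ball x (\<rho> x))"
      proof
        fix x assume x: "x \<in> X"
        consider "x \<in> X1" | "x \<in> (\<Union>x\<in>A1. ball x b)" | "x \<in> X2" using x by (auto simp: X2_def)
        then show "x \<in> (\<Union>x\<in>A1 \<union> A2. ball x (\<rho> x))"
          by cases (use A1(4) A2(4) r1 in fastforce)+
      qed
      fix x y assume "x \<in> A1 \<union> A2" "y \<in> A1 \<union> A2" "x \<noteq> y"
      then have "\<rho> x \<le> dist x y \<and> \<rho> y \<le> dist x y"
        using A1(3)[of x y] A2(3)[of x y] cross[of x y] cross[of y x] r1[of x] r1[of y] r2[of x] r2[of y]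
        by (auto simp: dist_commute)
      then show "\<rho> x \<le> dist x y" "\<rho> y \<le> dist x y" by auto
    qed
  qed
qed

text \<open>In the triangle with vertices 0, \<open>a\<close>, \<open>b\<close> the side opposite 0
  is a longest one, so the angle at 0 is at least 60 degrees and the chord between the directions
  has length at least 1.\<close>

lemma unit_vectors_separated:
  fixes a b :: "'a::real_inner"
  assumes "a \<noteq> 0" "b \<noteq> 0" "norm a \<le> norm (a - b)" "norm b \<le> norm (a - b)"
  shows "1 \<le> dist (a /\<^sub>R norm a) (b /\<^sub>R norm b)"
proof -
  have a: "norm a > 0" "norm b > 0" using assms by auto
  have sq: "(norm (a - b))\<^sup>2 = (norm a)\<^sup>2 + (norm b)\<^sup>2 - 2 * (a \<bullet> b)"
    unfolding power2_norm_eq_inner by (simp add: inner_diff_left inner_diff_right inner_commute)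
  have ab: "2 * (a \<bullet> b) \<le> norm a * norm b"
  proof (cases "norm a \<le> norm b")
    case True
    have "(norm b)\<^sup>2 \<le> (norm (a - b))\<^sup>2" using assms by (intro power_mono) auto
    then have "2 * (a \<bullet> b) \<le> (norm a)\<^sup>2" using sq by simp
    also have "\<dots> \<le> norm a * norm b" using True by (simp add: power2_eq_square mult_left_mono)
    finally show ?thesis .
  next
    case False
    have "(norm a)\<^sup>2 \<le> (norm (a - b))\<^sup>2" using assms by (intro power_mono) auto
    then have "2 * (a \<bullet> b) \<le> (norm b)\<^sup>2" using sq by simp
    also have "\<dots> \<le> norm a * norm b" using False by (simp add: power2_eq_square mult_right_mono)
    finally show ?thesis .
  qed
  have "(norm (a /\<^sub>R norm a - b /\<^sub>R norm b))\<^sup>2 = 2 - 2 * (a \<bullet> b) / (norm a * norm b)"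
    using a unfolding power2_norm_eq_inner
    by (simp add: inner_diff_left inner_diff_right inner_commute field_simps)
      (simp add: power2_norm_eq_inner[symmetric] power2_eq_square field_simps)
  also have "\<dots> \<ge> 1" using ab a by (simp add: field_simps)
  finally have "1\<^sup>2 \<le> (norm (a /\<^sub>R norm a - b /\<^sub>R norm b))\<^sup>2" by simp
  then show ?thesis unfolding dist_norm by (rule power2_le_imp_le) simp
qed

text \<open>Seen from a common point \<open>t\<close> of several balls, the centres lie in
  directions at least 60 degrees apart, and only boundedly many unit vectors are that far
  apart.\<close>

lemma besicovitch_overlap:
  obtains N :: nat where "\<And>(A :: 'a::euclidean_space set) \<rho> t. finite A \<Longrightarrow>
    (\<forall>x\<in>A. \<forall>y\<in>A. x \<noteq> y \<longrightarrow> \<rho> x \<le> dist x y \<and> \<rho> y \<le> dist x y) \<Longrightarrow> card {x\<in>A. t \<in> ball x (\<rho> x)} \<le> N"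
proof -
  obtain N where N: "\<forall>A\<subseteq>sphere (0::'a) 1. (\<forall>x\<in>A. \<forall>y\<in>A. x \<noteq> y \<longrightarrow> 1 \<le> dist x y) \<longrightarrow> finite A \<and> card A \<le> N"
    by (rule separated_card_bound[OF compact_imp_bounded[OF compact_sphere[of "0::'a" 1]] zero_less_one])
  have "card {x\<in>A. t \<in> ball x (\<rho> x)} \<le> max N 1"
    if "finite A" and sep: "\<forall>x\<in>A. \<forall>y\<in>A. x \<noteq> y \<longrightarrow> \<rho> x \<le> dist x y \<and> \<rho> y \<le> dist x y"
    for A :: "'a set" and \<rho> t
  proof -
    let ?S = "{x\<in>A. t \<in> ball x (\<rho> x)}"
    show ?thesis
    \<comment> \<open>A centre \<open>t\<close> has no direction from itself, but it lies in no
      other ball of the family; this case accounts for the 1 in \<open>max N 1\<close>.\<close>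
    proof (cases "t \<in> ?S")
      case True
      then have "?S \<subseteq> {t}" using sep by fastforce
      then have "card ?S \<le> card {t}" by (intro card_mono) auto
      then show ?thesis by simp
    next
      case False
      let ?u = "\<lambda>x. (x - t) /\<^sub>R norm (x - t)"
      have ne: "x \<noteq> t" if "x \<in> ?S" for x using that False by blast
      have sepu: "1 \<le> dist (?u x) (?u y)" if "x \<in> ?S" "y \<in> ?S" "x \<noteq> y" for x y
      proof -
        have "norm (x - t) < \<rho> x" "norm (y - t) < \<rho> y" "\<rho> x \<le> dist x y" "\<rho> y \<le> dist x y"
          using that sep by (auto simp: dist_norm norm_minus_commute)
        then show ?thesis using ne[OF that(1)] ne[OF that(2)]
          by (intro unit_vectors_separated) (auto simp: dist_norm)
      qed
      have inj: "inj_on ?u ?S"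
      proof (rule inj_onI, rule ccontr)
        fix x y assume "x \<in> ?S" "y \<in> ?S" and eq: "?u x = ?u y" and "x \<noteq> y"
        then have "1 \<le> dist (?u x) (?u y)" by (intro sepu)
        then show False unfolding eq by simp
      qed
      have "?u ` ?S \<subseteq> sphere 0 1" using ne by auto
      moreover have "\<forall>p\<in>?u ` ?S. \<forall>q\<in>?u ` ?S. p \<noteq> q \<longrightarrow> 1 \<le> dist p q" using sepu by blast
      ultimately have "finite (?u ` ?S) \<and> card (?u ` ?S) \<le> N" using N by blast
      then show ?thesis using card_image[OF inj] by (simp add: le_max_iff_disj)
    qed
  qed
  then show thesis by (rule that)
qed

lemma sum_emeasure_le_overlap:
  assumes "finite A" and B: "\<And>x. x \<in> A \<Longrightarrow> B x \<in> sets M" "\<And>x. x \<in> A \<Longrightarrow> B x \<subseteq> V" and V: "V \<in> sets M"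
    and N: "\<And>t. card {x\<in>A. t \<in> B x} \<le> N"
  shows "(\<Sum>x\<in>A. emeasure M (B x)) \<le> of_nat N * emeasure M V"
proof -
  have "(\<Sum>x\<in>A. emeasure M (B x)) = (\<integral>\<^sup>+t. (\<Sum>x\<in>A. indicator (B x) t) \<partial>M)"
    using B by (subst nn_integral_sum) auto
  also have "\<dots> \<le> (\<integral>\<^sup>+t. of_nat N * indicator V t \<partial>M)"
  proof (intro nn_integral_mono)
    fix t
    show "(\<Sum>x\<in>A. indicator (B x) t) \<le> (of_nat N * indicator V t :: ennreal)"
    proof (cases "t \<in> V")
      case True
      have "(\<Sum>x\<in>A. indicator (B x) t) = (of_nat (card {x\<in>A. t \<in> B x}) :: ennreal)"
        using \<open>finite A\<close> by (simp add: indicator_def sum.If_cases Int_def)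
      then show ?thesis using True N[of t] by simp
    next
      case False
      then have "(\<Sum>x\<in>A. indicator (B x) t) = (0::ennreal)" using B(2) by (intro sum.neutral ballI) (auto simp: indicator_def)
      then show ?thesis by simp
    qed
  qed
  also have "\<dots> = of_nat N * emeasure M V" using V by (simp add: nn_integral_cmult_indicator)
  finally show ?thesis .
qed

text \<open>Subadditivity of the positive measure \<open>\<mu> - \<nu>\<close>, with both sides moved so that no
  subtraction occurs.\<close>

lemma emeasure_excess_subadditive:
  assumes sets: "sets \<nu> = sets \<mu>" and "finite A" "X \<in> sets \<mu>" "\<And>x. x \<in> A \<Longrightarrow> D x \<in> sets \<mu>" "X \<subseteq> (\<Union>x\<in>A. D x)"
    and "\<And>x Z. x \<in> A \<Longrightarrow> Z \<in> sets \<mu> \<Longrightarrow> Z \<subseteq> D x \<Longrightarrow> emeasure \<nu> Z \<le> emeasure \<mu> Z"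
  shows "emeasure \<mu> X + (\<Sum>x\<in>A. emeasure \<nu> (D x)) \<le> emeasure \<nu> X + (\<Sum>x\<in>A. emeasure \<mu> (D x))"
  using assms(2-)
proof (induction A arbitrary: X rule: finite_induct)
  case empty
  then show ?case by simp
next
  case (insert a A)
  have X: "X \<in> sets \<mu>" and D: "D a \<in> sets \<mu>" using insert.prems by auto
  have split: "emeasure M P = emeasure M (P \<inter> Q) + emeasure M (P - Q)"
    if "sets M = sets \<mu>" "P \<in> sets \<mu>" "Q \<in> sets \<mu>" for M P Q
    using that by (subst plus_emeasure) (auto simp: Int_Diff_Un)
  have IH: "emeasure \<mu> (X - D a) + (\<Sum>x\<in>A. emeasure \<nu> (D x)) \<le> emeasure \<nu> (X - D a) + (\<Sum>x\<in>A. emeasure \<mu> (D x))"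
    using insert.prems by (intro insert.IH) auto
  \<comment> \<open>Both measures of \<open>X \<inter> D a\<close> will occur on both sides; the
    inequality comes from \<open>D a - X\<close> alone.\<close>
  have "emeasure \<nu> (D a - X) \<le> emeasure \<mu> (D a - X)"
    using X D by (intro insert.prems(4)[of a]) auto
  then have "emeasure \<mu> (X \<inter> D a) + (emeasure \<nu> (X \<inter> D a) + emeasure \<nu> (D a - X)) \<le>
      emeasure \<nu> (X \<inter> D a) + (emeasure \<mu> (X \<inter> D a) + emeasure \<mu> (D a - X))"
    by (simp add: add_left_mono add.left_commute)
  then have "emeasure \<mu> (X \<inter> D a) + emeasure \<nu> (D a) \<le> emeasure \<nu> (X \<inter> D a) + emeasure \<mu> (D a)"
    using split[of \<nu> "D a" X] split[of \<mu> "D a" X] X D sets by (simp add: Int_commute)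
  from add_mono[OF this IH] show ?case
    using insert.hyps split[of \<nu> X "D a"] split[of \<mu> X "D a"] X D sets by (simp add: add_ac)
qed

text \<open>As \<mu> dominates \<nu> inside \<open>K\<close>, the excess of \<mu> on
  \<open>K\<close> is at most the sum of its excesses on the traces of the covering balls. Each of
  these is at most the \<nu>-mass of the ball outside \<open>K\<close> plus \<tau> times its volume;
  with overlap at most \<open>N\<close> the totals become small on letting first \<delta> and then
  \<tau> be small.\<close>

lemma emeasure_le_of_small_balls:
  fixes \<mu> \<nu> :: "'a::euclidean_space measure"
  assumes \<mu>: "sigma_finite_measure \<mu>" "sets \<mu> = sets borel" and \<nu>: "sigma_finite_measure \<nu>" "sets \<nu> = sets borel"
    and fin: "\<And>B. bounded B \<Longrightarrow> B \<in> sets borel \<Longrightarrow> emeasure \<nu> B < \<infinity>"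
    and K: "compact K"
    and le: "\<And>Z. Z \<in> sets borel \<Longrightarrow> Z \<subseteq> K \<Longrightarrow> emeasure \<nu> Z \<le> emeasure \<mu> Z"
    and balls: "\<And>x \<delta> \<tau>. x \<in> K \<Longrightarrow> \<delta> > 0 \<Longrightarrow> \<tau> > 0 \<Longrightarrow> \<exists>\<rho>\<in>\<rat>. 0 < \<rho> \<and> \<rho> < \<delta> \<and>
      emeasure \<mu> (ball x \<rho>) \<le> emeasure \<nu> (ball x \<rho>) + ennreal \<tau> * emeasure lborel (ball x \<rho>)"
  shows "emeasure \<mu> K \<le> emeasure \<nu> K"
proof (cases "K = {}")
  case False
  have Kb [measurable]: "K \<in> sets borel" using K by (rule borel_compact)
  obtain N :: nat where N: "\<And>(A :: 'a set) \<rho> t. finite A \<Longrightarrow>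
    (\<forall>x\<in>A. \<forall>y\<in>A. x \<noteq> y \<longrightarrow> \<rho> x \<le> dist x y \<and> \<rho> y \<le> dist x y) \<Longrightarrow> card {x\<in>A. t \<in> ball x (\<rho> x)} \<le> N"
    using besicovitch_overlap by blast
  define V where "V \<delta> = {x. infdist x K < \<delta>}" for \<delta>
  have Vb [measurable]: "V \<delta> \<in> sets borel" for \<delta>
    unfolding V_def by (intro borel_open open_Collect_less continuous_intros)
  have Vbd: "bounded (V \<delta>)" if "\<delta> \<le> 1" for \<delta>
  proof -
    obtain R where R: "\<And>y. y \<in> K \<Longrightarrow> norm y \<le> R" using compact_imp_bounded[OF K] by (auto simp: bounded_iff)
    have "norm x \<le> R + 1" if "x \<in> V \<delta>" for x
    proof -
      obtain y where y: "y \<in> K" "infdist x K = dist x y"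
        using infdist_attains_inf[of K x] K False by (auto simp: compact_imp_closed)
      then have "dist x y < 1" using that \<open>\<delta> \<le> 1\<close> by (auto simp: V_def)
      then show ?thesis using R[OF y(1)] norm_triangle_ineq2[of x y] by (simp add: dist_norm)
    qed
    then show ?thesis by (auto simp: bounded_iff)
  qed
  have main: "emeasure \<mu> K \<le> emeasure \<nu> K + of_nat N * (emeasure \<nu> (V \<delta> - K) + ennreal \<tau> * emeasure lborel (V \<delta>))"
    if \<delta>: "0 < \<delta>" "\<delta> \<le> 1" and \<tau>: "\<tau> > 0" for \<delta> \<tau>
  proof -
    define Q where "Q = {q \<in> \<rat>. 0 < q \<and> q < \<delta>}"
    have "countable Q" unfolding Q_def using countable_rat by (rule countable_subset[rotated]) auto
    moreover have "Q \<noteq> {}" using Rats_dense_in_real[OF \<delta>(1)] by (auto simp: Q_def)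
    ultimately have "range (from_nat_into Q) = Q" by (intro range_from_nat_into)
    then obtain q :: "nat \<Rightarrow> real" where q: "range q = Q" by blast
    define good where "good x \<rho> \<longleftrightarrow> emeasure \<mu> (ball x \<rho>) \<le> emeasure \<nu> (ball x \<rho>) + ennreal \<tau> * emeasure lborel (ball x \<rho>)" for x \<rho>
    \<comment> \<open>Allowing only the first rational radii makes the set of radii finite, as
      \<open>besicovitch_selection\<close> requires; these sets increase to
      \<open>K\<close>.\<close>
    define Kn where "Kn n = {x \<in> K. \<exists>i\<le>n. good x (q i)}" for n
    have [measurable]: "Measurable.pred borel (\<lambda>x. good x \<rho>)" for \<rho>
    proof -
      note [measurable] = emeasure_ball_measurable[OF \<mu>] emeasure_ball_measurable[OF \<nu>]
        emeasure_ball_measurable[OF lborel.sigma_finite_measure_axioms sets_lborel]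
      show ?thesis unfolding good_def by measurable
    qed
    have Knb [measurable]: "Kn n \<in> sets borel" for n unfolding Kn_def by measurable
    have Kn: "emeasure \<mu> (Kn n) \<le> emeasure \<nu> K + of_nat N * (emeasure \<nu> (V \<delta> - K) + ennreal \<tau> * emeasure lborel (V \<delta>))" for n
    proof -
      have "\<forall>x\<in>Kn n. \<exists>r\<in>q ` {..n}. good x r" by (auto simp: Kn_def)
      then obtain \<rho> where \<rho>: "\<And>x. x \<in> Kn n \<Longrightarrow> \<rho> x \<in> q ` {..n}" "\<And>x. x \<in> Kn n \<Longrightarrow> good x (\<rho> x)" by metis
      have qQ: "0 < r" "r < \<delta>" if "r \<in> q ` {..n}" for r using that q by (auto simp: Q_def)
      have "bounded (Kn n)" using compact_imp_bounded[OF K] by (rule bounded_subset) (auto simp: Kn_def)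
      then have "\<exists>A. finite A \<and> A \<subseteq> Kn n \<and> (\<forall>x\<in>A. \<forall>y\<in>A. x \<noteq> y \<longrightarrow> \<rho> x \<le> dist x y \<and> \<rho> y \<le> dist x y) \<and>
          Kn n \<subseteq> (\<Union>x\<in>A. ball x (\<rho> x))"
        by (intro besicovitch_selection[of "q ` {..n}"] qQ(1)) (use \<rho>(1) in blast)+
      then obtain A where A: "finite A" "A \<subseteq> Kn n"
          "\<forall>x\<in>A. \<forall>y\<in>A. x \<noteq> y \<longrightarrow> \<rho> x \<le> dist x y \<and> \<rho> y \<le> dist x y" "Kn n \<subseteq> (\<Union>x\<in>A. ball x (\<rho> x))"
        by (elim exE conjE)
      have sub: "ball x (\<rho> x) \<subseteq> V \<delta>" if "x \<in> A" for x
      proof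
        fix y assume "y \<in> ball x (\<rho> x)"
        moreover have x: "x \<in> Kn n" using that A(2) by blast
        then have "x \<in> K" by (simp add: Kn_def)
        moreover have "\<rho> x < \<delta>" by (rule qQ(2)[OF \<rho>(1)[OF x]])
        ultimately show "y \<in> V \<delta>" using infdist_le[of x K y] by (auto simp: V_def dist_commute)
      qed
      note ov = N[OF A(1,3)]
      let ?D = "\<lambda>x. ball x (\<rho> x) \<inter> K"
      have "emeasure \<mu> (Kn n) + (\<Sum>x\<in>A. emeasure \<nu> (?D x)) \<le> emeasure \<nu> (Kn n) + (\<Sum>x\<in>A. emeasure \<mu> (?D x))"
        using A le \<mu>(2) \<nu>(2) by (intro emeasure_excess_subadditive) (auto simp: Kn_def)
      also have "(\<Sum>x\<in>A. emeasure \<mu> (?D x)) \<le> (\<Sum>x\<in>A. emeasure \<nu> (?D x) +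
          (emeasure \<nu> (ball x (\<rho> x) - K) + ennreal \<tau> * emeasure lborel (ball x (\<rho> x))))"
      proof (rule sum_mono)
        fix x assume x: "x \<in> A"
        have "emeasure \<mu> (?D x) \<le> emeasure \<mu> (ball x (\<rho> x))" by (intro emeasure_mono) (auto simp: \<mu>)
        also have "\<dots> \<le> emeasure \<nu> (ball x (\<rho> x)) + ennreal \<tau> * emeasure lborel (ball x (\<rho> x))"
          using \<rho>(2)[of x] x A(2) by (auto simp: good_def)
        also have "emeasure \<nu> (ball x (\<rho> x)) = emeasure \<nu> (?D x) + emeasure \<nu> (ball x (\<rho> x) - K)"
          by (subst plus_emeasure) (auto simp: \<nu> Int_Diff_Un)
        finally show "emeasure \<mu> (?D x) \<le> emeasure \<nu> (?D x) +
          (emeasure \<nu> (ball x (\<rho> x) - K) + ennreal \<tau> * emeasure lborel (ball x (\<rho> x)))"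
          by (simp add: add.assoc)
      qed
      also have "\<dots> = (\<Sum>x\<in>A. emeasure \<nu> (?D x)) +
          ((\<Sum>x\<in>A. emeasure \<nu> (ball x (\<rho> x) - K)) + ennreal \<tau> * (\<Sum>x\<in>A. emeasure lborel (ball x (\<rho> x))))"
        by (simp add: sum.distrib sum_distrib_left)
      finally have "(\<Sum>x\<in>A. emeasure \<nu> (?D x)) + emeasure \<mu> (Kn n) \<le> (\<Sum>x\<in>A. emeasure \<nu> (?D x)) + (emeasure \<nu> (Kn n) +
          ((\<Sum>x\<in>A. emeasure \<nu> (ball x (\<rho> x) - K)) + ennreal \<tau> * (\<Sum>x\<in>A. emeasure lborel (ball x (\<rho> x)))))"
        by (simp add: add_ac add_left_mono)
      \<comment> \<open>The \<nu>-mass inside \<open>K\<close>, counted with overlaps, stands on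
        both sides and is cancelled. What remains with the factor \<open>N\<close> is only mass
        outside \<open>K\<close> and volume.\<close>
      moreover have "(\<Sum>x\<in>A. emeasure \<nu> (?D x)) \<noteq> top"
      proof -
        have "emeasure \<nu> (?D x) < \<infinity>" for x
          by (rule fin[OF bounded_subset[OF bounded_ball Int_lower1]]) simp
        then show ?thesis using A(1) by simp (metis less_irrefl)
      qed
      ultimately have "emeasure \<mu> (Kn n) \<le> emeasure \<nu> (Kn n) +
          ((\<Sum>x\<in>A. emeasure \<nu> (ball x (\<rho> x) - K)) + ennreal \<tau> * (\<Sum>x\<in>A. emeasure lborel (ball x (\<rho> x))))"
        unfolding ennreal_add_left_cancel_le infinity_ennreal_def by blast
      also have "\<dots> \<le> emeasure \<nu> K + (of_nat N * emeasure \<nu> (V \<delta> - K) + ennreal \<tau> * (of_nat N * emeasure lborel (V \<delta>)))"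
      proof (intro add_mono mult_left_mono)
        show "emeasure \<nu> (Kn n) \<le> emeasure \<nu> K" by (intro emeasure_mono) (auto simp: Kn_def \<nu>)
        show "(\<Sum>x\<in>A. emeasure \<nu> (ball x (\<rho> x) - K)) \<le> of_nat N * emeasure \<nu> (V \<delta> - K)"
        proof (rule sum_emeasure_le_overlap[OF A(1)])
          show "card {x \<in> A. t \<in> ball x (\<rho> x) - K} \<le> N" for t
            using A(1) by (intro order_trans[OF card_mono ov[of t]]) auto
        qed (use sub in \<open>auto simp: \<nu>\<close>)
        show "(\<Sum>x\<in>A. emeasure lborel (ball x (\<rho> x))) \<le> of_nat N * emeasure lborel (V \<delta>)"
          by (rule sum_emeasure_le_overlap[OF A(1)]) (use sub ov in auto)
      qed auto
      finally show ?thesis by (simp add: distrib_left mult_ac)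
    qed
    have "incseq Kn" by (intro incseq_SucI) (auto simp: Kn_def intro: le_SucI)
    then have "(\<lambda>n. emeasure \<mu> (Kn n)) \<longlonglongrightarrow> emeasure \<mu> (\<Union>n. Kn n)"
      by (intro Lim_emeasure_incseq) (auto simp: \<mu>)
    moreover have "(\<Union>n. Kn n) = K"
    proof
      show "K \<subseteq> (\<Union>n. Kn n)"
      proof
        fix x assume x: "x \<in> K"
        obtain r where "r \<in> Q" "good x r" using balls[OF x \<delta>(1) \<tau>] by (auto simp: Q_def good_def)
        then obtain i where "good x (q i)" using q by (metis imageE)
        then show "x \<in> (\<Union>n. Kn n)" using x by (auto simp: Kn_def)
      qed
    qed (auto simp: Kn_def)
    ultimately show ?thesis using Kn by (auto intro: LIMSEQ_le_const2)
  qed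
  show ?thesis
  proof (rule ennreal_le_epsilon)
    fix e :: real assume e: "e > 0"
    \<comment> \<open>Two errors of size \<open>e'\<close>, each multiplied by \<open>N\<close>; the
      added 1 covers \<open>N = 0\<close>.\<close>
    define e' where "e' = e / (2 * (real N + 1))"
    have e': "e' > 0" using e by (simp add: e'_def)
    have "(\<lambda>n. emeasure \<nu> (V (1 / real (Suc n)) - K)) \<longlonglongrightarrow> emeasure \<nu> (\<Inter>n. V (1 / real (Suc n)) - K)"
    proof (rule Lim_emeasure_decseq)
      show "decseq (\<lambda>n. V (1 / real (Suc n)) - K)"
        by (intro decseq_SucI) (auto simp: V_def elim!: less_le_trans intro!: divide_left_mono)
      show "emeasure \<nu> (V (1 / real (Suc n)) - K) \<noteq> \<infinity>" for n
        using fin[OF bounded_subset[OF Vbd[of "1 / real (Suc n)"] Diff_subset], of K] by auto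
    qed (auto simp: \<nu>)
    moreover have "(\<Inter>n. V (1 / real (Suc n)) - K) = {}"
    proof -
      have False if x: "x \<in> (\<Inter>n. V (1 / real (Suc n)) - K)" for x
      proof -
        have "x \<notin> K" using x by auto
        then have "infdist x K > 0" using K False infdist_pos_not_in_closed compact_imp_closed by blast
        then obtain n where "1 / real (Suc n) < infdist x K" using reals_Archimedean by (auto simp: inverse_eq_divide)
        moreover have "infdist x K < 1 / real (Suc n)" using x by (auto simp: V_def)
        ultimately show False by simp
      qed
      then show ?thesis by blast
    qed
    ultimately have "(\<lambda>n. emeasure \<nu> (V (1 / real (Suc n)) - K)) \<longlonglongrightarrow> 0"
      by (simp only: emeasure_empty)
    then have "eventually (\<lambda>n. emeasure \<nu> (V (1 / real (Suc n)) - K) < ennreal e') sequentially"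
      by (rule order_tendstoD(2)) (use e' in simp)
    then obtain n where n: "emeasure \<nu> (V (1 / real (Suc n)) - K) < ennreal e'"
      by (auto simp: eventually_sequentially)
    define \<delta> where "\<delta> = 1 / real (Suc n)"
    have \<delta>: "0 < \<delta>" "\<delta> \<le> 1" by (auto simp: \<delta>_def)
    define L where "L = measure lborel (V \<delta>)"
    have L: "emeasure lborel (V \<delta>) = ennreal L"
      using emeasure_bounded_finite[OF Vbd[OF \<delta>(2)]] unfolding L_def
      by (intro emeasure_eq_ennreal_measure) auto
    \<comment> \<open>Chosen after \<delta>, because the volume \<open>L\<close> of the
      neighbourhood depends on \<delta>.\<close>
    define \<tau> where "\<tau> = e' / (L + 1)"
    have L0: "L \<ge> 0" by (simp add: L_def)
    have \<tau>: "\<tau> > 0" "\<tau> * L \<le> e'" using e' L0 by (auto simp: \<tau>_def field_simps)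
    have "emeasure \<nu> (V \<delta> - K) + ennreal \<tau> * emeasure lborel (V \<delta>) \<le> ennreal e' + ennreal e'"
      using n \<tau> L0 unfolding L by (intro add_mono) (auto simp: \<delta>_def simp flip: ennreal_mult intro: ennreal_leI)
    then have "of_nat N * (emeasure \<nu> (V \<delta> - K) + ennreal \<tau> * emeasure lborel (V \<delta>)) \<le> of_nat N * (ennreal e' + ennreal e')"
      by (rule mult_left_mono) simp
    also have "\<dots> = ennreal (real N * (2 * e'))"
      using e' by (simp add: ennreal_of_nat_eq_real_of_nat ennreal_mult flip: ennreal_plus)
    also have "\<dots> \<le> ennreal e"
      using e by (intro ennreal_leI) (simp add: e'_def field_simps)
    finally show "emeasure \<mu> K \<le> emeasure \<nu> K + ennreal e"
      using main[OF \<delta> \<tau>(1)] by (meson add_left_mono order_trans)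
  qed
qed simp

section \<open>From compact sets to the whole contact set\<close>

lemma sigma_finite_of_compact_finite:
  fixes M :: "'a::euclidean_space measure"
  assumes sets: "sets M = sets borel" and fin: "\<And>K. compact K \<Longrightarrow> emeasure M K < \<infinity>"
  shows "sigma_finite_measure M"
proof
  show "\<exists>A. countable A \<and> A \<subseteq> sets M \<and> \<Union> A = space M \<and> (\<forall>a\<in>A. emeasure M a \<noteq> \<infinity>)"
  proof (intro exI conjI ballI)
    show "countable (range (\<lambda>n. cball (0::'a) (real n)))" by simp
    show "range (\<lambda>n. cball (0::'a) (real n)) \<subseteq> sets M" by (auto simp: sets)
    show "\<Union> (range (\<lambda>n. cball (0::'a) (real n))) = space M"
      using sets_eq_imp_space_eq[OF sets] real_arch_simple by auto
    fix a assume "a \<in> range (\<lambda>n. cball (0::'a) (real n))"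
    then have "compact a" by auto
    then show "emeasure M a \<noteq> \<infinity>" using fin[of a] by auto
  qed
qed

text \<open>Here \<open>d \<ge> 2\<close> enters: together with \<open>s > d - 2\<close> it gives
  \<open>s > 0\<close>.\<close>

lemma admissible_imp_riesz_measure:
  fixes M :: "'a::euclidean_space measure"
  assumes "admissible_measure s M" "DIM('a) \<ge> 2" "real DIM('a) - 2 < s" "s < real DIM('a)"
  shows "riesz_measure M s"
proof -
  have "sigma_finite_measure M"
    using assms(1) by (intro sigma_finite_of_compact_finite) (auto simp: admissible_measure_def)
  then show ?thesis using assms
    by (auto simp: riesz_measure_def riesz_measure_axioms_def admissible_measure_def)
qed

text \<open>Where both measures are infinite, \<mu> - \<nu> has no value; negativity of its
  restriction to \<open>E\<close> is therefore expressed by an inequality between the two measures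
  on all Borel parts of \<open>E\<close>.\<close>

theorem theorem3p2:
  fixes \<mu> \<nu> :: "'a::euclidean_space measure" and s C :: real
  assumes d: "DIM('a) \<ge> 2"
    and s: "real DIM('a) - 2 < s" "s < real DIM('a)"
    and \<mu>: "admissible_measure s \<mu>"
    and \<nu>: "admissible_measure s \<nu>"
    and fin: "AE x in \<nu>. riesz_potential s \<nu> x < \<infinity>"
    and C: "C \<ge> 0"
    and dom: "AE x in \<nu>. riesz_potential s \<nu> x \<le> riesz_potential s \<mu> x + ennreal C"
  defines "E \<equiv> {x. riesz_potential s \<nu> x = riesz_potential s \<mu> x + ennreal C
                   \<and> riesz_potential s \<mu> x + ennreal C < \<infinity>}"
  shows "\<forall>A \<in> sets borel. emeasure \<mu> (A \<inter> E) \<le> emeasure \<nu> (A \<inter> E)"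
proof
  have rm: "riesz_measure \<mu> s" "riesz_measure \<nu> s"
    using \<mu> \<nu> d s by (auto intro: admissible_imp_riesz_measure)
  interpret \<mu>: riesz_measure \<mu> s by (rule rm)
  interpret \<nu>: riesz_measure \<nu> s by (rule rm)
  have cfin: "emeasure \<mu> K < \<infinity>" "emeasure \<nu> K < \<infinity>" if "compact K" for K
    using \<mu> \<nu> that by (auto simp: admissible_measure_def)
  have bfin: "emeasure \<mu> B < \<infinity>" "emeasure \<nu> B < \<infinity>" if "bounded B" "B \<in> sets borel" for B
  proof -
    have cl: "compact (closure B)" using that by (simp add: compact_closure)
    show "emeasure \<mu> B < \<infinity>"
      by (rule le_less_trans[OF emeasure_mono[OF closure_subset] cfin(1)[OF cl]]) (simp add: \<mu>.sets_eq)
    show "emeasure \<nu> B < \<infinity>"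
      by (rule le_less_trans[OF emeasure_mono[OF closure_subset] cfin(2)[OF cl]]) (simp add: \<nu>.sets_eq)
  qed
  have dom': "riesz_potential s \<nu> y \<le> riesz_potential s \<mu> y + ennreal C" for y
    by (rule riesz_domination[OF rm(2,1) cfin(2) fin dom C])
  have [measurable]: "E \<in> sets borel" unfolding E_def by measurable
  have compact_le: "emeasure \<mu> K \<le> emeasure \<nu> K"
    if K: "compact K" "K \<subseteq> E" and le: "\<And>Z. Z \<in> sets borel \<Longrightarrow> Z \<subseteq> K \<Longrightarrow> emeasure \<nu> Z \<le> emeasure \<mu> Z" for K
  proof (rule emeasure_le_of_small_balls[OF \<mu>.sigma_finite_measure_axioms \<mu>.sets_eq
        \<nu>.sigma_finite_measure_axioms \<nu>.sets_eq bfin(2) K(1) le])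
    fix x \<delta> \<tau> :: real and y assume y: "y \<in> K" and "\<delta> > 0" "\<tau> > 0"
    have "riesz_potential s \<nu> y = riesz_potential s \<mu> y + ennreal C" "riesz_potential s \<mu> y < \<infinity>"
      using y K(2) by (auto simp: E_def)
    from small_ball_comparison[OF rm(2,1) dom' this \<open>\<delta> > 0\<close> \<open>\<tau> > 0\<close>]
    show "\<exists>\<rho>\<in>\<rat>. 0 < \<rho> \<and> \<rho> < \<delta> \<and> emeasure \<mu> (ball y \<rho>) \<le> emeasure \<nu> (ball y \<rho>) + ennreal \<tau> * emeasure lborel (ball y \<rho>)"
      by blast
  qed
  have bounded_le: "emeasure \<mu> X \<le> emeasure \<nu> X" if X: "bounded X" "X \<in> sets borel" "X \<subseteq> E" for X
  proof -
    \<comment> \<open>A Hahn decomposition of the bounded set \<open>X\<close>, on which both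
      measures are finite. Off \<open>Y\<close> the claim holds by construction; on
      \<open>Y\<close>, \<mu> dominates \<nu>, which is the hypothesis of \<open>compact_le\<close>,
      and inner regularity passes from compact subsets to \<open>Y\<close>.\<close>
    have "\<exists>Y\<in>sets \<mu>. Y \<subseteq> X \<and> (\<forall>Z\<in>sets \<mu>. Z \<subseteq> Y \<longrightarrow> emeasure \<nu> Z \<le> emeasure \<mu> Z) \<and>
        (\<forall>Z\<in>sets \<mu>. Z \<subseteq> X \<longrightarrow> Z \<inter> Y = {} \<longrightarrow> emeasure \<mu> Z \<le> emeasure \<nu> Z)"
      using bfin[OF X(1,2)] X(2) by (intro unsigned_Hahn_decomposition) (auto simp: \<mu>.sets_eq \<nu>.sets_eq)
    then obtain Y where Y: "Y \<in> sets borel" "Y \<subseteq> X" "\<And>Z. Z \<in> sets borel \<Longrightarrow> Z \<subseteq> Y \<Longrightarrow> emeasure \<nu> Z \<le> emeasure \<mu> Z"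
        "\<And>Z. Z \<in> sets borel \<Longrightarrow> Z \<subseteq> X \<Longrightarrow> Z \<inter> Y = {} \<Longrightarrow> emeasure \<mu> Z \<le> emeasure \<nu> Z"
      by (auto simp: \<mu>.sets_eq)
    have Yfin: "emeasure \<mu> Y < \<infinity>" using bfin(1)[OF bounded_subset[OF X(1) Y(2)] Y(1)] .
    have "emeasure \<mu> Y \<le> emeasure \<nu> Y"
    proof (rule ennreal_le_epsilon)
      fix e :: real assume "e > 0"
      obtain K where K: "compact K" "K \<subseteq> Y" "emeasure \<mu> (Y - K) \<le> ennreal e"
        using compact_approximation[OF \<mu>.sets_eq Y(1) Yfin \<open>e > 0\<close>] by blast
      have "emeasure \<mu> Y = emeasure \<mu> K + emeasure \<mu> (Y - K)"
        using K Y(1) by (subst plus_emeasure) (auto simp: \<mu>.sets_eq borel_compact Un_absorb1)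
      also have "\<dots> \<le> emeasure \<nu> K + ennreal e"
        using K X Y by (intro add_mono compact_le) auto
      also have "emeasure \<nu> K \<le> emeasure \<nu> Y" using K Y(1) by (intro emeasure_mono) (auto simp: \<nu>.sets_eq)
      finally show "emeasure \<mu> Y \<le> emeasure \<nu> Y + ennreal e" by (simp add: add_right_mono)
    qed
    moreover have "emeasure \<mu> (X - Y) \<le> emeasure \<nu> (X - Y)" using X Y by (intro Y(4)) auto
    ultimately have "emeasure \<mu> Y + emeasure \<mu> (X - Y) \<le> emeasure \<nu> Y + emeasure \<nu> (X - Y)" by (rule add_mono)
    then show ?thesis using X Y(1,2) by (simp add: plus_emeasure \<mu>.sets_eq \<nu>.sets_eq Un_absorb1)
  qed
  fix A :: "'a set" assume [measurable]: "A \<in> sets borel"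
  \<comment> \<open>Exhaustion by balls reduces to bounded sets, since on
    \<open>A \<inter> E\<close> itself both measures may be infinite.\<close>
  have inc: "incseq (\<lambda>n. A \<inter> E \<inter> cball 0 (real n))" by (auto intro!: incseq_SucI)
  have un: "(\<Union>n. A \<inter> E \<inter> cball 0 (real n)) = A \<inter> E" using real_arch_simple by auto
  have "(\<lambda>n. emeasure M (A \<inter> E \<inter> cball 0 (real n))) \<longlonglongrightarrow> emeasure M (A \<inter> E)"
    if "sets M = sets borel" for M :: "'a measure"
  proof -
    have "range (\<lambda>n. A \<inter> E \<inter> cball 0 (real n)) \<subseteq> sets M" by (auto simp: that)
    from Lim_emeasure_incseq[OF this inc] show ?thesis unfolding un .
  qed
  note lim = this[OF \<mu>.sets_eq] this[OF \<nu>.sets_eq]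
  show "emeasure \<mu> (A \<inter> E) \<le> emeasure \<nu> (A \<inter> E)"
    using lim by (rule LIMSEQ_le) (auto intro!: bounded_le bounded_subset[OF bounded_cball])
qed

end
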